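(* Let $\omega_r:[0,\infty)\to\mathfrak{so}(3)$ be a given target velocity (Lebesgue measurable and essentially bounded on bounded time intervals; it is not assumed to be bounded on $[0,\infty)$). Consider the system on $SO(3)\times SO(3)$ $$\dot R_r=R_r\,\omega_r,\qquad \dot R_1=R_1\,\omega_1,$$ where $\omega_1\in\mathfrak{so}(3)$ is a control input, and the two feedback laws $$\omega_{1,a}=\log(R_1^{-1}R_r)+\omega_r,\qquad \omega_{1,f}=\frac{1}{\|\log(R_1^{-1}R_r)\|_F}\log(R_1^{-1}R_r)+\omega_r .$$ Assume that the initial condition is non-singular, i.e. $\arccos\!\Big(\frac{\operatorname{tr}(R_r^\top(0)R_1(0))-1}{2}\Big)\neq\pi$. Then: (1) Both for $\omega_1=\omega_{1,a}$ and for $\omega_1=\omega_{1,f}$ the singularity is avoided for all time: every maximal solution of the closed loop with such an initial condition is defined for all $t\ge 0$ and satisfies $\arccos\!\Big(\frac{\operatorname{tr}(R_r^\top(t)R_1(t))-1}{2}\Big)\neq\pi$ for all $t\geq 0$. (2) With $\omega_1=\omega_{1,a}$, $R_1$ tracks $R_r$ exponentially. With $\omega_1=\omega_{1,f}$, $R_1$ tracks $R_r$ in finite time, and this holds for every Filippov solution of the closed loop with such an initial condition.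
   Context: $SO(3)=\{R\in\mathbb{R}^{3\times3}: RR^\top=I,\ \det R=1\}$; $\mathfrak{so}(3)$ is the space of real skew-symmetric $3\times3$ matrices; $\|\cdot\|_F$ is the Frobenius norm. Principal logarithm: for $R\in SO(3)$ let $\theta=\arccos\big(\frac{\operatorname{tr}(R)-1}{2}\big)\in[0,\pi]$. If $\theta\in(0,\pi)$ then $\log(R)=\frac{\theta}{2\sin\theta}(R-R^\top)$; if $\theta=0$ then $\log(R)=\log(I)=0$; $\log(R)$ is not defined for $\theta=\pi$ (the singularity). The closed loops are therefore considered on the open set $\mathcal D=\{(R_r,R_1)\in SO(3)\times SO(3):\arccos(\frac{\operatorname{tr}(R_r^\top R_1)-1}{2})\neq\pi\}$. Solutions. For $\omega_{1,a}$, solutions are absolutely continuous curves satisfying the closed-loop equations for almost all $t$. For $\omega_{1,f}$, whose formula is undefined and discontinuous at $R_1=R_r$, solutions are Filippov solutions: absolutely continuous curves $(R_r(t),R_1(t))$ satisfying, for almost all $t$, $$\dot R_r=R_r\omega_r(t),\qquad \dot R_1\in\mathcal F[R_1\omega_{1,f}](R_r(t),R_1(t),t).$$ Here, for a vector field $f(x,t)$, $$\mathcal F[f](x,t)=\bigcap_{\delta>0}\ \bigcap_{\mu(S)=0}\overline{\mathrm{co}}\{f(B(x,\delta)\setminus S,\,t)\},$$ where $B(x,\delta)$ is the ball of radius $\delta$ around $x$ in the state space, $S$ ranges over the null sets of the state space, $\mu$ is the Lebesgue (Riemannian volume) measure on it, and $\overline{\mathrm{co}}$ is the closed convex hull. A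 solution is maximal if it cannot be extended forward in time. Tracking. $R_1$ tracks $R_r$ exponentially if there are constants $C,c>0$ (possibly depending on the solution) with $\|R_1(t)-R_r(t)\|_F\leq Ce^{-ct}$ for all $t\geq0$. $R_1$ tracks $R_r$ in finite time if there exists $T>0$ such that $R_1(t)-R_r(t)\to0$ as $t\to T$. *)

theory Defs
  imports "HOL-Analysis.Analysis"
begin

type_synonym mat3 = "real^3^3"

(* The norm of mat3 provided by the library is the Frobenius norm, and the norm of
   mat3 * mat3 is the Euclidean norm of the 18 entries. *)

definition SO3 :: "mat3 set" where
  "SO3 = {R. R ** transpose R = mat 1 \<and> det R = 1}"

definition so3 :: "mat3 set" where
  "so3 = {A. transpose A = - A}"

definition rot_angle :: "mat3 \<Rightarrow> real" where
  "rot_angle R = arccos ((trace R - 1) / 2)"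

definition rot_log :: "mat3 \<Rightarrow> mat3" where
  "rot_log R =
     (let \<theta> = rot_angle R in
        if \<theta> = 0 then 0
        else if \<theta> < pi then (\<theta> / (2 * sin \<theta>)) *\<^sub>R (R - transpose R)
        else undefined)"

definition nonsingular_state :: "mat3 \<Rightarrow> mat3 \<Rightarrow> bool" where
  "nonsingular_state R\<^sub>r R\<^sub>1 \<longleftrightarrow> rot_angle (transpose R\<^sub>r ** R\<^sub>1) \<noteq> pi"

definition state_space :: "(mat3 \<times> mat3) set" where
  "state_space = {(R\<^sub>r, R\<^sub>1). R\<^sub>r \<in> SO3 \<and> R\<^sub>1 \<in> SO3 \<and> nonsingular_state R\<^sub>r R\<^sub>1}"

(* For an interval S, the members of a division of a subset of S are closed
   subintervals of S with disjoint interiors. *)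
definition absolutely_continuous_on :: "real set \<Rightarrow> (real \<Rightarrow> 'a::metric_space) \<Rightarrow> bool" where
  "absolutely_continuous_on S f \<longleftrightarrow>
     (\<forall>\<epsilon>>0. \<exists>\<delta>>0. \<forall>d t. d division_of t \<and> t \<subseteq> S \<and> (\<Sum>k\<in>d. Sup k - Inf k) < \<delta> \<longrightarrow>
        (\<Sum>k\<in>d. dist (f (Inf k)) (f (Sup k))) < \<epsilon>)"

(* k-dimensional Hausdorff (outer) measure for k > 0, normalised so that it agrees with the
   Riemannian volume on k-dimensional submanifolds of a Euclidean space. Boundedness is
   required because the library's diameter is unspecified on unbounded sets. *)
definition hausdorff_measure :: "nat \<Rightarrow> 'a::metric_space set \<Rightarrow> ennreal" where
  "hausdorff_measure k A =
     ennreal (unit_ball_vol (real k) / 2 ^ k) *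
     (SUP \<delta>\<in>{0<..}.
        INF C\<in>{C :: nat \<Rightarrow> 'a set.
                 A \<subseteq> (\<Union>i. C i) \<and> (\<forall>i. bounded (C i) \<and> diameter (C i) \<le> \<delta>)}.
          \<Sum>i. ennreal (diameter (C i) ^ k))"

(* Filippov regularisation of a time-dependent vector field on a k-dimensional submanifold X of
   a Euclidean space. Since S ranges over all null sets, the values of f on a
   null subset of X (for instance, where f has no meaningful value) are irrelevant. *)
definition filippov ::
  "nat \<Rightarrow> 'a::metric_space set \<Rightarrow> ('a \<Rightarrow> real \<Rightarrow> 'b::real_normed_vector) \<Rightarrow> 'a \<Rightarrow> real \<Rightarrow> 'b set" where
  "filippov k X f x t =
     (\<Inter>\<delta>\<in>{0<..}. \<Inter>S\<in>{S. S \<subseteq> X \<and> hausdorff_measure k S = 0}.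
        closure (convex hull ((\<lambda>y. f y t) ` (ball x \<delta> \<inter> X - S))))"

definition \<omega>_a :: "(real \<Rightarrow> mat3) \<Rightarrow> mat3 \<times> mat3 \<Rightarrow> real \<Rightarrow> mat3" where
  "\<omega>_a \<omega>\<^sub>r = (\<lambda>(R\<^sub>r, R\<^sub>1) t. rot_log (matrix_inv R\<^sub>1 ** R\<^sub>r) + \<omega>\<^sub>r t)"

definition \<omega>_f :: "(real \<Rightarrow> mat3) \<Rightarrow> mat3 \<times> mat3 \<Rightarrow> real \<Rightarrow> mat3" where
  "\<omega>_f \<omega>\<^sub>r = (\<lambda>(R\<^sub>r, R\<^sub>1) t.
     (1 / norm (rot_log (matrix_inv R\<^sub>1 ** R\<^sub>r))) *\<^sub>R rot_log (matrix_inv R\<^sub>1 ** R\<^sub>r) + \<omega>\<^sub>r t)"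

definition rhs_a :: "(real \<Rightarrow> mat3) \<Rightarrow> mat3 \<times> mat3 \<Rightarrow> real \<Rightarrow> mat3 set" where
  "rhs_a \<omega>\<^sub>r x t = {snd x ** \<omega>_a \<omega>\<^sub>r x t}"

(* The state space is an open subset of SO(3) x SO(3), hence of dimension 6. *)
definition rhs_f :: "(real \<Rightarrow> mat3) \<Rightarrow> mat3 \<times> mat3 \<Rightarrow> real \<Rightarrow> mat3 set" where
  "rhs_f \<omega>\<^sub>r = filippov 6 state_space (\<lambda>x t. snd x ** \<omega>_f \<omega>\<^sub>r x t)"

(* Only the values of the curves on the interval J matter. *)
definition closed_loop_solution ::
  "(real \<Rightarrow> mat3) \<Rightarrow> (mat3 \<times> mat3 \<Rightarrow> real \<Rightarrow> mat3 set) \<Rightarrow>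
   real set \<Rightarrow> (real \<Rightarrow> mat3) \<Rightarrow> (real \<Rightarrow> mat3) \<Rightarrow> bool" where
  "closed_loop_solution \<omega>\<^sub>r F J R\<^sub>r R\<^sub>1 \<longleftrightarrow>
     is_interval J \<and> 0 \<in> J \<and> J \<subseteq> {0..} \<and>
     (\<forall>t\<in>J. (R\<^sub>r t, R\<^sub>1 t) \<in> state_space) \<and>
     (\<forall>a b. {a..b} \<subseteq> J \<longrightarrow>
        absolutely_continuous_on {a..b} R\<^sub>r \<and> absolutely_continuous_on {a..b} R\<^sub>1) \<and>
     (AE t in lebesgue_on J.
        (R\<^sub>r has_vector_derivative (R\<^sub>r t ** \<omega>\<^sub>r t)) (at t within J) \<and>
        (\<exists>v \<in> F (R\<^sub>r t, R\<^sub>1 t) t. (R\<^sub>1 has_vector_derivative v) (at t within J)))"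

definition maximal_solution ::
  "(real \<Rightarrow> mat3) \<Rightarrow> (mat3 \<times> mat3 \<Rightarrow> real \<Rightarrow> mat3 set) \<Rightarrow>
   real set \<Rightarrow> (real \<Rightarrow> mat3) \<Rightarrow> (real \<Rightarrow> mat3) \<Rightarrow> bool" where
  "maximal_solution \<omega>\<^sub>r F J R\<^sub>r R\<^sub>1 \<longleftrightarrow>
     closed_loop_solution \<omega>\<^sub>r F J R\<^sub>r R\<^sub>1 \<and>
     \<not> (\<exists>J' R\<^sub>r' R\<^sub>1'. J \<subset> J' \<and> closed_loop_solution \<omega>\<^sub>r F J' R\<^sub>r' R\<^sub>1' \<and>
          (\<forall>t\<in>J. R\<^sub>r' t = R\<^sub>r t \<and> R\<^sub>1' t = R\<^sub>1 t))"

definition tracks_exponentially :: "(real \<Rightarrow> mat3) \<Rightarrow> (real \<Rightarrow> mat3) \<Rightarrow> bool" where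
  "tracks_exponentially R\<^sub>1 R\<^sub>r \<longleftrightarrow>
     (\<exists>C>0. \<exists>c>0. \<forall>t\<ge>0. norm (R\<^sub>1 t - R\<^sub>r t) \<le> C * exp (- c * t))"

definition tracks_in_finite_time :: "(real \<Rightarrow> mat3) \<Rightarrow> (real \<Rightarrow> mat3) \<Rightarrow> bool" where
  "tracks_in_finite_time R\<^sub>1 R\<^sub>r \<longleftrightarrow> (\<exists>T>0. ((\<lambda>t. R\<^sub>1 t - R\<^sub>r t) \<longlongrightarrow> 0) (at T))"

end

(* The error V = |R_1 - R_r|_F^2 = 4 (1 - cos theta), where theta is the angle of R_1^T R_r, satisfies
   V' = -4 theta sin theta for the first feedback and, as long as V > 0, V' = -2 sqrt 2 sin theta for
   the second; omega_r drops out since it is skew.  At V = 0 the derivative vanishes, whatever the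
   Filippov velocity is.  Hence V does not increase, V < 8 (i.e. theta < pi) is preserved, and the
   decay of V from V' <= -c V, respectively that of sqrt V from (sqrt V)' <= -c/2, give the tracking.

   A solution on a bounded interval is Lipschitz, so it converges to a nonsingular state at the end of its
   interval.  It can be continued from any such state: R_r solves a linear equation with measurable
   coefficients (Picard iteration and Lebesgue differentiation), and R_1 = G R_r, where G rotates
   about a fixed axis by an explicit angle.  That this is a Filippov solution uses that open sets of
   the state space are not null for the Hausdorff measure. *)
theory Submission
  imports Defs
begin

hide_const (open) Polynomial.content

section \<open>Absolutely continuous curves\<close>

text \<open>Solutions are differentiable only almost everywhere, so each bound on V' becomes a bound
  on V through a fundamental theorem of calculus for absolutely continuous curves, derived from the
  division form of the definition. V is preferred to the angle because it is polynomial in the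
  entries, whereas \<theta> is not differentiable at the identity, exactly where the curves meet.
  The decay constant c is a lower bound of sqrt (4 - V/2) = 2 cos (\<theta>/2); it is uniform along
  a solution because V \<le> V(0) < 8. Continuation is constructed explicitly because
  \<open>\<omega>\<^sub>r\<close> is merely measurable in time and the second field is
  discontinuous. The factor G acts on the left and \<open>\<omega>\<^sub>r\<close> on the right, so
  the two do not interfere and the feedback reduces to a scalar equation: \<theta>' = -\<theta> for
  the first law, and \<theta>' = -1 / sqrt 2 for the second, since |log| = sqrt 2 \<theta>. The
  second equation is used only while \<theta> > 0; from \<theta> = 0 the curve is continued by
  \<open>R\<^sub>1 = R\<^sub>r\<close>.\<close>

lemma AE_lebesgue_on_iff_negligible:
  assumes "S \<in> sets lebesgue"
  shows "(AE t in lebesgue_on S. P t) \<longleftrightarrow> (\<exists>N. negligible N \<and> (\<forall>t\<in>S - N. P t))"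
proof -
  have "(AE t in lebesgue_on S. P t) \<longleftrightarrow> (AE t in lebesgue. t \<in> S \<longrightarrow> P t)"
    using assms by (subst AE_restrict_space_iff) auto
  also have "\<dots> \<longleftrightarrow> (\<exists>N. negligible N \<and> (\<forall>t\<in>S - N. P t))"
    unfolding eventually_ae_filter negligible_iff_null_sets by (auto simp: subset_eq)
  finally show ?thesis .
qed

text \<open>Members of a division are nonempty compact intervals, so \<open>Inf\<close> and
  \<open>Sup\<close> recover their endpoints.\<close>

lemma division_interval_ends:
  fixes d :: "real set set"
  assumes "d division_of t" "t \<subseteq> S" "k \<in> d"
  shows "k = {Inf k..Sup k}" "Inf k \<le> Sup k" "Inf k \<in> S" "Sup k \<in> S"
proof -
  obtain u v where k: "k = cbox u v" "k \<noteq> {}" "k \<subseteq> t"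
    using division_ofD(2,3,4)[OF assms(1)] assms(3) by metis
  then have "u \<le> v" by simp
  with k assms show "k = {Inf k..Sup k}" "Inf k \<le> Sup k" "Inf k \<in> S" "Sup k \<in> S"
    by auto
qed

lemma absolutely_continuous_onD:
  assumes "absolutely_continuous_on S f" "\<epsilon> > 0"
  shows "\<exists>\<delta>>0. \<forall>d t. d division_of t \<longrightarrow> t \<subseteq> S \<longrightarrow> (\<Sum>k\<in>d. Sup k - Inf k) < \<delta> \<longrightarrow>
        (\<Sum>k\<in>d. dist (f (Inf k)) (f (Sup k))) < \<epsilon>"
  using assms(1)[unfolded absolutely_continuous_on_def, THEN spec, THEN mp, OF assms(2)] unfolding imp_conjL .

lemma absolutely_continuous_onI:
  assumes "\<And>\<epsilon>. \<epsilon> > 0 \<Longrightarrow> \<exists>\<delta>>0. \<forall>d t. d division_of t \<longrightarrow> t \<subseteq> S \<longrightarrow> (\<Sum>k\<in>d. Sup k - Inf k) < \<delta> \<longrightarrow>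
        (\<Sum>k\<in>d. dist (f (Inf k)) (f (Sup k))) < \<epsilon>"
  shows "absolutely_continuous_on S f"
  unfolding absolutely_continuous_on_def imp_conjL using assms by (intro allI impI)

text \<open>Differences, norms, squares and products of curves are all handled by this criterion: a
  bound on increments survives summation over a division.\<close>

lemma absolutely_continuous_on_dominated2:
  assumes f: "absolutely_continuous_on S f" and g: "absolutely_continuous_on S g"
    and le: "\<And>x y. x \<in> S \<Longrightarrow> y \<in> S \<Longrightarrow> dist (h x) (h y) \<le> L * dist (f x) (f y) + M * dist (g x) (g y)"
  shows "absolutely_continuous_on S h"
proof (rule absolutely_continuous_onI)
  fix \<epsilon> :: real assume "\<epsilon> > 0"
  \<comment> \<open>L and M may have any sign; one positive constant dominates both and allows the
    division by 2 K.\<close>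
  define K where "K = \<bar>L\<bar> + \<bar>M\<bar> + 1"
  have K: "K > 0" "L \<le> K" "M \<le> K" by (auto simp: K_def)
  have "\<epsilon> / (2 * K) > 0" using \<open>\<epsilon> > 0\<close> K by simp
  obtain \<delta>1 where \<delta>1: "\<delta>1 > 0"
    and 1: "\<forall>d t. d division_of t \<longrightarrow> t \<subseteq> S \<longrightarrow> (\<Sum>k\<in>d. Sup k - Inf k) < \<delta>1 \<longrightarrow>
      (\<Sum>k\<in>d. dist (f (Inf k)) (f (Sup k))) < \<epsilon> / (2 * K)"
    using absolutely_continuous_onD[OF f \<open>\<epsilon> / (2 * K) > 0\<close>] by (elim exE conjE) (rule that)
  obtain \<delta>2 where \<delta>2: "\<delta>2 > 0"
    and 2: "\<forall>d t. d division_of t \<longrightarrow> t \<subseteq> S \<longrightarrow> (\<Sum>k\<in>d. Sup k - Inf k) < \<delta>2 \<longrightarrow>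
      (\<Sum>k\<in>d. dist (g (Inf k)) (g (Sup k))) < \<epsilon> / (2 * K)"
    using absolutely_continuous_onD[OF g \<open>\<epsilon> / (2 * K) > 0\<close>] by (elim exE conjE) (rule that)
  have "(\<Sum>k\<in>d. dist (h (Inf k)) (h (Sup k))) < \<epsilon>"
    if d: "d division_of t" "t \<subseteq> S" "(\<Sum>k\<in>d. Sup k - Inf k) < min \<delta>1 \<delta>2" for d t
  proof -
    have "(\<Sum>k\<in>d. dist (h (Inf k)) (h (Sup k)))
        \<le> (\<Sum>k\<in>d. K * dist (f (Inf k)) (f (Sup k)) + K * dist (g (Inf k)) (g (Sup k)))"
    proof (rule sum_mono)
      fix k assume k: "k \<in> d"
      have "dist (h (Inf k)) (h (Sup k)) \<le> L * dist (f (Inf k)) (f (Sup k)) + M * dist (g (Inf k)) (g (Sup k))"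
        using division_interval_ends[OF d(1,2) k] le by blast
      also have "\<dots> \<le> K * dist (f (Inf k)) (f (Sup k)) + K * dist (g (Inf k)) (g (Sup k))"
        using K by (intro add_mono mult_right_mono) auto
      finally show "dist (h (Inf k)) (h (Sup k)) \<le> \<dots>" .
    qed
    also have "\<dots> = K * (\<Sum>k\<in>d. dist (f (Inf k)) (f (Sup k))) + K * (\<Sum>k\<in>d. dist (g (Inf k)) (g (Sup k)))"
      by (simp add: sum.distrib sum_distrib_left)
    also have "\<dots> < K * (\<epsilon> / (2 * K)) + K * (\<epsilon> / (2 * K))"
      using 1[rule_format, OF d(1,2)] 2[rule_format, OF d(1,2)] d(3) K by (intro add_strict_mono mult_strict_left_mono) auto
    also have "\<dots> = \<epsilon>" using K by simp
    finally show ?thesis .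
  qed
  then show "\<exists>\<delta>>0. \<forall>d t. d division_of t \<longrightarrow> t \<subseteq> S \<longrightarrow> (\<Sum>k\<in>d. Sup k - Inf k) < \<delta> \<longrightarrow>
        (\<Sum>k\<in>d. dist (h (Inf k)) (h (Sup k))) < \<epsilon>"
    using \<delta>1 \<delta>2 by (intro exI[of _ "min \<delta>1 \<delta>2"] conjI allI impI) simp_all
qed

lemma absolutely_continuous_on_dominated:
  assumes f: "absolutely_continuous_on S f"
    and le: "\<And>x y. x \<in> S \<Longrightarrow> y \<in> S \<Longrightarrow> dist (h x) (h y) \<le> L * dist (f x) (f y)"
  shows "absolutely_continuous_on S h"
  by (rule absolutely_continuous_on_dominated2[OF f f, where L = L and M = 0]) (use le in auto)

lemma absolutely_continuous_on_ident: "absolutely_continuous_on S (\<lambda>x::real. x)"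
proof (rule absolutely_continuous_onI, intro allI impI exI conjI)
  fix \<epsilon> :: real and d :: "real set set" and t
  assume "\<epsilon> > 0" then show "\<epsilon> > 0" .
  assume d: "d division_of t" "t \<subseteq> S" "(\<Sum>k\<in>d. Sup k - Inf k) < \<epsilon>"
  have "(\<Sum>k\<in>d. dist (Inf k) (Sup k)) = (\<Sum>k\<in>d. Sup k - Inf k)"
    using division_interval_ends(2)[OF d(1,2)] by (intro sum.cong) (simp_all add: dist_real_def)
  then show "(\<Sum>k\<in>d. dist (Inf k) (Sup k)) < \<epsilon>" using d by simp
qed

lemma lipschitz_imp_absolutely_continuous_on:
  fixes f :: "real \<Rightarrow> 'a::metric_space"
  assumes "\<And>x y. x \<in> S \<Longrightarrow> y \<in> S \<Longrightarrow> dist (f x) (f y) \<le> L * \<bar>x - y\<bar>"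
  shows "absolutely_continuous_on S f"
  by (rule absolutely_continuous_on_dominated[OF absolutely_continuous_on_ident, where L = L])
     (use assms in \<open>auto simp: dist_real_def\<close>)

lemma absolutely_continuous_on_imp_continuous_on:
  assumes f: "absolutely_continuous_on {a..b} f"
  shows "continuous_on {a..b} f"
  unfolding continuous_on_iff
proof (intro ballI allI impI)
  fix x and \<epsilon> :: real assume x: "x \<in> {a..b}" and "\<epsilon> > 0"
  obtain \<delta> where \<delta>: "\<delta> > 0"
    and 1: "\<forall>d t. d division_of t \<longrightarrow> t \<subseteq> {a..b} \<longrightarrow> (\<Sum>k\<in>d. Sup k - Inf k) < \<delta> \<longrightarrow>
      (\<Sum>k\<in>d. dist (f (Inf k)) (f (Sup k))) < \<epsilon>"
    using absolutely_continuous_onD[OF f \<open>\<epsilon> > 0\<close>] by (elim exE conjE) (rule that)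
  have *: "dist (f u) (f v) < \<epsilon>" if "u \<in> {a..b}" "v \<in> {a..b}" "u \<le> v" "v - u < \<delta>" for u v
  proof -
    have "{{u..v}} division_of {u..v}"
      using division_of_self[of u v] that by simp
    from 1[rule_format, OF this] show ?thesis using that by simp
  qed
  have "dist (f y) (f x) < \<epsilon>" if y: "y \<in> {a..b}" "dist y x < \<delta>" for y
    using *[of x y] *[of y x] x y by (cases "x \<le> y") (auto simp: dist_real_def dist_commute)
  then show "\<exists>\<delta>>0. \<forall>y\<in>{a..b}. dist y x < \<delta> \<longrightarrow> dist (f y) (f x) < \<epsilon>"
    using \<delta> by blast
qed

text \<open>On a fine tagged division, intervals tagged in the exceptional null set have small total
  length, so absolute continuity bounds their contribution; the others are controlled by the
  derivative at the tag.\<close>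

lemma fundamental_theorem_of_calculus_absolutely_continuous:
  fixes f :: "real \<Rightarrow> 'a::euclidean_space"
  assumes ac: "absolutely_continuous_on {a..b} f" and "a \<le> b" and N: "negligible N"
    and der: "\<And>t. t \<in> {a..b} - N \<Longrightarrow> (f has_vector_derivative f' t) (at t within {a..b})"
  shows "(f' has_integral f b - f a) {a..b}"
proof -
  \<comment> \<open>\<open>f'\<close> is arbitrary on N. With the value 0 there, a Riemann sum sees
    only the increment of f on intervals tagged in N.\<close>
  define g where "g t = (if t \<in> N then 0 else f' t)" for t
  have "(g has_integral f b - f a) {a..b}"
    unfolding has_integral_real
  proof (intro allI impI)
    fix e :: real assume "e > 0"
    define \<eta> where "\<eta> = e / (2 * (b - a + 1))"
    have \<eta>: "\<eta> > 0" "\<eta> * (b - a) < e / 2"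
      using \<open>e > 0\<close> \<open>a \<le> b\<close> by (auto simp: \<eta>_def field_simps)
    obtain \<delta> where \<delta>: "\<delta> > 0"
      and ac': "\<forall>d t. d division_of t \<longrightarrow> t \<subseteq> {a..b} \<longrightarrow> (\<Sum>k\<in>d. Sup k - Inf k) < \<delta> \<longrightarrow>
        (\<Sum>k\<in>d. dist (f (Inf k)) (f (Sup k))) < e / 2"
      using absolutely_continuous_onD[OF ac half_gt_zero] \<open>e > 0\<close> by blast
    \<comment> \<open>The gauge will force every interval tagged in N into the open set T, so these
      intervals have total length below \<delta>.\<close>
    obtain T where T: "open T" "N \<subseteq> T" "T - N \<in> lmeasurable" "emeasure lebesgue (T - N) < ennreal \<delta>"
      using sets_lebesgue_outer_open[of N \<delta>] negligible_imp_sets[OF N] \<delta> by blast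
    have neg: "negligible ((T - N) - T \<union> (T - (T - N)))"
      using N by (rule negligible_subset) auto
    have "measure lebesgue T = measure lebesgue (T - N)"
      using measure_negligible_symdiff[OF T(3) neg] .
    also have "\<dots> < \<delta>"
      using T(3,4) \<delta> by (simp add: emeasure_eq_measure2 ennreal_less_iff)
    finally have T': "T \<in> lmeasurable" "measure lebesgue T < \<delta>"
      using lmeasurable_negligible_symdiff[OF T(3) neg] by auto
    have "\<exists>r>0. (x \<in> N \<longrightarrow> ball x r \<subseteq> T) \<and> (x \<in> {a..b} - N \<longrightarrow>
        (\<forall>y\<in>{a..b}. \<bar>y - x\<bar> < r \<longrightarrow> norm (f y - f x - (y - x) *\<^sub>R f' x) \<le> \<eta> * \<bar>y - x\<bar>))" for x
    proof (cases "x \<in> N")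
      case True
      then show ?thesis using T(1,2) openE by blast
    next
      case False
      show ?thesis
      proof (cases "x \<in> {a..b}")
        case True
        with der False have "(f has_derivative (\<lambda>h. h *\<^sub>R f' x)) (at x within {a..b})"
          by (simp add: has_vector_derivative_def)
        then have "\<exists>r>0. \<forall>y\<in>{a..b}. norm (y - x) < r \<longrightarrow>
            norm (f y - f x - (y - x) *\<^sub>R f' x) \<le> \<eta> * norm (y - x)"
          using \<eta>(1) by (simp add: has_derivative_within_alt)
        then show ?thesis using False by auto
      qed (use False in \<open>auto intro: exI[of _ 1]\<close>)
    qed
    then obtain r where r: "\<And>x. r x > 0" "\<And>x. x \<in> N \<Longrightarrow> ball x (r x) \<subseteq> T"
      "\<And>x y. x \<in> {a..b} - N \<Longrightarrow> y \<in> {a..b} \<Longrightarrow> \<bar>y - x\<bar> < r x \<Longrightarrow>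
         norm (f y - f x - (y - x) *\<^sub>R f' x) \<le> \<eta> * \<bar>y - x\<bar>"
      by metis
    have "norm ((\<Sum>(x,k)\<in>p. content k *\<^sub>R g x) - (f b - f a)) < e"
      if p: "p tagged_division_of {a..b}" and fine: "(\<lambda>x. ball x (r x)) fine p" for p
    proof -
      have fin: "finite p" using p by blast
      define q where "q = {z \<in> p. fst z \<in> N}"
      have q: "q \<subseteq> p" "finite q" using fin by (auto simp: q_def)
      have pk: "\<exists>u v. k = {u..v} \<and> u \<le> v \<and> u \<in> {a..b} \<and> v \<in> {a..b} \<and> x \<in> {u..v} \<and> {u..v} \<subseteq> ball x (r x)"
        if xk: "(x,k) \<in> p" for x k
      proof -
        obtain u v where "k = cbox u v" using p xk by blast
        moreover have "x \<in> k" "k \<subseteq> {a..b}" using p xk by blast+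
        moreover have "k \<subseteq> ball x (r x)" using fine xk by (auto simp: fine_def)
        ultimately show ?thesis by (intro exI[of _ u] exI[of _ v]) auto
      qed
      have qpart: "q tagged_partial_division_of {a..b}"
        by (rule tagged_partial_division_subset[OF conjunct1[OF p[unfolded tagged_division_of_def]] q(1)])
      then have qdiv: "snd ` q division_of \<Union>(snd ` q)"
        by (rule partial_division_of_tagged_division)
      have qself: "q tagged_division_of \<Union>(snd ` q)"
        using qpart by (rule tagged_partial_division_of_Union_self)
      have sub: "\<Union>(snd ` q) \<subseteq> {a..b}"
      proof clarify
        fix x y k assume "(x,k) \<in> q" "y \<in> snd (x,k)"
        then show "y \<in> {a..b}" using pk[of x k] q(1) by force
      qed
      have subT: "\<Union>(snd ` q) \<subseteq> T"
      proof clarify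
        fix x y k assume "(x,k) \<in> q" "y \<in> snd (x,k)"
        then show "y \<in> T" using pk[of x k] r(2)[of x] by (auto simp: q_def)
      qed
      have "(\<Sum>k\<in>snd ` q. Sup k - Inf k) = sum (measure lebesgue) (snd ` q)"
      proof (rule sum.cong[OF refl])
        fix k assume "k \<in> snd ` q"
        note k = division_interval_ends(1,2)[OF qdiv sub this]
        have "measure lebesgue {Inf k..Sup k} = Sup k - Inf k"
          using k(2) by (simp add: measure_completion)
        with k(1) show "Sup k - Inf k = measure lebesgue k" by metis
      qed
      also have "\<dots> = measure lebesgue (\<Union>(snd ` q))"
        using content_division[OF qdiv] by metis
      also have "\<dots> \<le> measure lebesgue T"
        using measure_mono_fmeasurable[OF subT fmeasurableD[OF lmeasurable_division[OF qdiv]] T'(1)] .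
      also have "\<dots> < \<delta>" by (fact T')
      finally have "(\<Sum>k\<in>snd ` q. dist (f (Inf k)) (f (Sup k))) < e / 2"
        by (rule ac'[rule_format, OF qdiv sub])
      moreover have "(\<Sum>(x,k)\<in>q. dist (f (Inf k)) (f (Sup k))) = (\<Sum>k\<in>snd ` q. dist (f (Inf k)) (f (Sup k)))"
      proof -
        \<comment> \<open>Absolute continuity sums over intervals, the Riemann sum over tagged
          pairs. The two sums agree once the summand vanishes on every box without interior;
          \<open>w\<close> ensures this for the empty box as well.\<close>
        define w where "w k = (if k = {} then 0 else dist (f (Inf k)) (f (Sup k)))" for k
        have "w k = dist (f (Inf k)) (f (Sup k))" if "(x,k) \<in> q" for x k
          using pk[of x k] q(1) that by (auto simp: w_def)
        then have "(\<Sum>(x,k)\<in>q. dist (f (Inf k)) (f (Sup k))) = (\<Sum>(x,k)\<in>q. w k)"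
          "(\<Sum>k\<in>snd ` q. dist (f (Inf k)) (f (Sup k))) = (\<Sum>k\<in>snd ` q. w k)"
          by (auto intro!: sum.cong)
        moreover have "(\<Sum>(x,k)\<in>q. w k) = (\<Sum>k\<in>snd ` q. w k)"
          by (rule sum.over_tagged_division_lemma[OF qself]) (auto simp: w_def)
        ultimately show ?thesis by simp
      qed
      ultimately have 1: "(\<Sum>(x,k)\<in>q. dist (f (Inf k)) (f (Sup k))) < e / 2" by simp
      have "(\<Sum>(x,k)\<in>p - q. norm (content k *\<^sub>R f' x - (f (Sup k) - f (Inf k)))) \<le> (\<Sum>(x,k)\<in>p - q. \<eta> * content k)"
      proof (rule sum_mono, clarify)
        fix x k assume xk: "(x,k) \<in> p" "(x,k) \<notin> q"
        then have xN: "x \<notin> N" by (auto simp: q_def)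
        obtain u v where uv: "k = {u..v}" "u \<le> v" "u \<in> {a..b}" "v \<in> {a..b}" "x \<in> {u..v}" "{u..v} \<subseteq> ball x (r x)"
          using pk[OF xk(1)] by blast
        have xab: "x \<in> {a..b}" using uv by auto
        have "u \<in> ball x (r x)" "v \<in> ball x (r x)" using uv(2,6) by (auto simp: subset_eq)
        then have "\<bar>u - x\<bar> < r x" "\<bar>v - x\<bar> < r x" by (auto simp: dist_real_def)
        then have nb: "norm (f u - f x - (u - x) *\<^sub>R f' x) \<le> \<eta> * (x - u)"
          "norm (f v - f x - (v - x) *\<^sub>R f' x) \<le> \<eta> * (v - x)"
          using r(3)[of x u] r(3)[of x v] uv xN xab by auto
        \<comment> \<open>Straddling: both endpoints are compared with the tag x between them, so
          the errors \<eta> (x - u) and \<eta> (v - x) add up to \<eta> times the length.\<close>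
        have eq: "(v - u) *\<^sub>R f' x - (f v - f u)
            = (f u - f x - (u - x) *\<^sub>R f' x) - (f v - f x - (v - x) *\<^sub>R f' x)"
          by (simp add: algebra_simps)
        have "norm ((v - u) *\<^sub>R f' x - (f v - f u)) \<le> \<eta> * (x - u) + \<eta> * (v - x)"
          unfolding eq by (rule order_trans[OF norm_triangle_ineq4 add_mono[OF nb]])
        then show "norm (content k *\<^sub>R f' x - (f (Sup k) - f (Inf k))) \<le> \<eta> * content k"
          using uv by (simp add: algebra_simps)
      qed
      also have "\<dots> \<le> (\<Sum>(x,k)\<in>p. \<eta> * content k)"
        using fin \<eta> by (intro sum_mono2) auto
      also have "\<dots> = \<eta> * (b - a)"
        using additive_content_tagged_division[of p a b] p \<open>a \<le> b\<close>
        by (simp add: sum_distrib_left[symmetric] split_def)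
      finally have 2: "(\<Sum>(x,k)\<in>p - q. norm (content k *\<^sub>R f' x - (f (Sup k) - f (Inf k)))) < e / 2"
        using \<eta>(2) by linarith
      have "(\<Sum>(x,k)\<in>p. content k *\<^sub>R g x) - (f b - f a)
          = (\<Sum>(x,k)\<in>p. content k *\<^sub>R g x - (f (Sup k) - f (Inf k)))"
        using additive_tagged_division_1[OF \<open>a \<le> b\<close> p, of f] by (simp add: sum_subtractf split_def)
      also have "norm \<dots> \<le> (\<Sum>(x,k)\<in>p. norm (content k *\<^sub>R g x - (f (Sup k) - f (Inf k))))"
        unfolding split_def by (rule norm_sum)
      also have "\<dots> = (\<Sum>(x,k)\<in>p - q. norm (content k *\<^sub>R g x - (f (Sup k) - f (Inf k))))
          + (\<Sum>(x,k)\<in>q. norm (content k *\<^sub>R g x - (f (Sup k) - f (Inf k))))"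
        by (rule sum.subset_diff[OF q(1) fin])
      also have "\<dots> = (\<Sum>(x,k)\<in>p - q. norm (content k *\<^sub>R f' x - (f (Sup k) - f (Inf k))))
          + (\<Sum>(x,k)\<in>q. dist (f (Inf k)) (f (Sup k)))"
        by (intro arg_cong2[where f = "(+)"] sum.cong) (auto simp: q_def g_def dist_norm norm_minus_commute)
      also have "\<dots> < e" using 1 2 by linarith
      finally show ?thesis .
    qed
    moreover have "gauge (\<lambda>x. ball x (r x))" using r(1) by (auto simp: gauge_def)
    ultimately show "\<exists>\<gamma>. gauge \<gamma> \<and> (\<forall>p. p tagged_division_of {a..b} \<and> \<gamma> fine p \<longrightarrow>
        norm ((\<Sum>(x,k)\<in>p. content k *\<^sub>R g x) - (f b - f a)) < e)"
      by blast
  qed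
  then show ?thesis
    by (rule has_integral_spike[OF N, rotated]) (auto simp: g_def)
qed

text \<open>Serves twice: as the Lipschitz bound for solutions, and with \<open>B = 0\<close> as the
  constancy criterion that keeps a curve orthogonal.\<close>

lemma absolutely_continuous_on_norm_le:
  fixes f :: "real \<Rightarrow> 'a::euclidean_space"
  assumes "absolutely_continuous_on {a..b} f" "a \<le> b" "negligible N"
    and der: "\<And>t. t \<in> {a..b} - N \<Longrightarrow> \<exists>D. (f has_vector_derivative D) (at t within {a..b}) \<and> norm D \<le> B"
    and "B \<ge> 0"
  shows "norm (f b - f a) \<le> B * (b - a)"
proof -
  obtain f' where f': "\<And>t. t \<in> {a..b} - N \<Longrightarrow>
      (f has_vector_derivative f' t) (at t within {a..b}) \<and> norm (f' t) \<le> B"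
    using der by metis
  have "((\<lambda>t. if t \<in> N then 0 else f' t) has_integral f b - f a) {a..b}"
    by (rule fundamental_theorem_of_calculus_absolutely_continuous) (use assms f' in auto)
  then have "norm (f b - f a) \<le> B * content {a..b}"
    using f' \<open>B \<ge> 0\<close> by (intro has_integral_bound_real[where S = "{}"]) auto
  then show ?thesis using \<open>a \<le> b\<close> by simp
qed

lemma absolutely_continuous_on_increment_le:
  fixes f :: "real \<Rightarrow> real"
  assumes "absolutely_continuous_on {a..b} f" "a \<le> b" "negligible N"
    and der: "\<And>t. t \<in> {a..b} - N \<Longrightarrow> \<exists>D\<le>c. (f has_vector_derivative D) (at t within {a..b})"
  shows "f b - f a \<le> c * (b - a)"
proof -
  obtain f' where f': "\<And>t. t \<in> {a..b} - N \<Longrightarrow>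
      f' t \<le> c \<and> (f has_vector_derivative f' t) (at t within {a..b})"
    using der by metis
  \<comment> \<open>With the value c on N, the integrand is at most c at every point.\<close>
  have "((\<lambda>t. if t \<in> N then c else f' t) has_integral f b - f a) {a..b}"
    by (rule fundamental_theorem_of_calculus_absolutely_continuous) (use assms f' in auto)
  moreover have "((\<lambda>t. c) has_integral c * (b - a)) {a..b}"
    using has_integral_const_real[of c a b] \<open>a \<le> b\<close> by (simp add: mult.commute)
  ultimately show ?thesis
    by (rule has_integral_le) (use f' in auto)
qed

section \<open>Rotations of the three-dimensional space\<close>

interpretation matmul: bounded_bilinear "(**) :: mat3 \<Rightarrow> mat3 \<Rightarrow> mat3"
  unfolding bilinear_conv_bounded_bilinear[symmetric] bilinear_def
  by (auto intro!: linearI simp: matrix_matrix_mult_def vec_eq_iff sum.distrib sum_distrib_left algebra_simps)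

lemmas matmul_simps = matmul.add_left matmul.add_right matmul.diff_left matmul.diff_right
  matmul.scaleR_left matmul.scaleR_right matmul.minus_left matmul.minus_right

lemmas mat3_simps = vec_eq_iff forall_3 sum_3 matrix_matrix_mult_def transpose_def mat_def
  trace_def inner_vec_def det_3

lemma transpose_linear_simps:
  fixes A B :: mat3
  shows "transpose (A + B) = transpose A + transpose B"
    and "transpose (A - B) = transpose A - transpose B"
    and "transpose (- A) = - transpose A"
    and "transpose (c *\<^sub>R A) = c *\<^sub>R transpose A"
  by (simp_all add: transpose_def vec_eq_iff)

lemma inner_matmul_left:
  fixes A B C :: mat3
  shows "inner (A ** B) (C::mat3) = inner B (transpose A ** C)"
  by (simp add: mat3_simps algebra_simps)

lemma inner_matmul_right:
  fixes A B C :: mat3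
  shows "inner (A ** B) (C::mat3) = inner A (C ** transpose B)"
  by (simp add: mat3_simps algebra_simps)

lemma inner_transpose: "inner (transpose A) (transpose B :: mat3) = inner A B"
  by (simp add: mat3_simps)

lemma inner_mat1_left: "inner (mat 1) (A::mat3) = trace A"
  by (simp add: mat3_simps)

lemma trace_transpose: "trace (transpose A :: mat3) = trace A"
  by (simp add: mat3_simps)

lemma norm_transpose: "norm (transpose A :: mat3) = norm A"
  by (simp add: norm_eq_sqrt_inner inner_transpose)

lemma so3_transpose: "A \<in> so3 \<Longrightarrow> transpose A = - A"
  by (simp add: so3_def)

lemma SO3_mult_transpose: "R \<in> SO3 \<Longrightarrow> R ** transpose R = mat 1"
  by (simp add: SO3_def)

lemma SO3_transpose_mult: "R \<in> SO3 \<Longrightarrow> transpose R ** R = mat 1"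
  using matrix_left_right_inverse SO3_mult_transpose by blast

lemma SO3_cancel [simp]:
  fixes A :: mat3
  assumes "R \<in> SO3"
  shows "R ** (transpose R ** A) = A" "transpose R ** (R ** A) = A"
    "A ** R ** transpose R = A" "A ** transpose R ** R = A"
  by (simp_all add: matrix_mul_assoc SO3_mult_transpose[OF assms] SO3_transpose_mult[OF assms])
     (simp_all add: matrix_mul_assoc[symmetric] SO3_mult_transpose[OF assms] SO3_transpose_mult[OF assms])

lemma mat1_SO3: "mat 1 \<in> SO3"
  by (simp add: SO3_def)

lemma SO3_transpose: "R \<in> SO3 \<Longrightarrow> transpose R \<in> SO3"
  using SO3_transpose_mult by (simp add: SO3_def)

lemma SO3_mult:
  assumes "R \<in> SO3" "Q \<in> SO3" shows "R ** Q \<in> SO3"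
proof -
  have "R ** Q ** transpose (R ** Q) = R ** Q ** transpose Q ** transpose R"
    by (simp add: matrix_transpose_mul matrix_mul_assoc)
  then show ?thesis using assms by (simp add: SO3_def det_mul)
qed

lemma closed_SO3: "closed SO3"
proof -
  have "continuous_on UNIV (\<lambda>R::mat3. R ** transpose R)" "continuous_on UNIV (\<lambda>R::mat3. det R)"
    unfolding det_3 transpose_def matrix_matrix_mult_def by (intro continuous_intros)+
  then have "closed ((\<lambda>R::mat3. R ** transpose R) -` {mat 1} \<inter> (\<lambda>R::mat3. det R) -` {1})"
    by (intro closed_Int closed_vimage) auto
  then show ?thesis by (simp add: SO3_def vimage_def Int_def)
qed

lemma matrix_inv_SO3: "R \<in> SO3 \<Longrightarrow> matrix_inv R = transpose R"
  unfolding matrix_inv_def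
proof (rule some_equality)
  assume R: "R \<in> SO3"
  show "R ** transpose R = mat 1 \<and> transpose R ** R = mat 1"
    using R by (simp add: SO3_mult_transpose SO3_transpose_mult)
  fix A assume "R ** A = mat 1 \<and> A ** R = mat 1"
  then show "A = transpose R"
    using SO3_cancel(3)[OF R, of A] by simp
qed

lemma inner_SO3_left:
  fixes A B :: mat3
  shows "R \<in> SO3 \<Longrightarrow> inner (R ** A) (R ** B) = inner A B"
  by (simp add: inner_matmul_left)

lemma inner_SO3_right:
  fixes A B :: mat3
  shows "R \<in> SO3 \<Longrightarrow> inner (A ** R) (B ** R) = inner A B"
  by (simp add: inner_matmul_right)

lemma norm_SO3_left:
  fixes A :: mat3
  shows "R \<in> SO3 \<Longrightarrow> norm (R ** A) = norm A"
  by (simp add: norm_eq_sqrt_inner inner_SO3_left)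

lemma norm_SO3_right:
  fixes A :: mat3
  shows "R \<in> SO3 \<Longrightarrow> norm (A ** R) = norm A"
  by (simp add: norm_eq_sqrt_inner inner_SO3_right)

lemma inner_SO3_self: "R \<in> SO3 \<Longrightarrow> inner R R = 3"
  using inner_SO3_left[of R "mat 1" "mat 1"] by (simp add: mat3_simps)

text \<open>Cayley--Hamilton for a rotation: the adjugate of \<open>R\<close> is its transpose.\<close>

lemma SO3_square:
  assumes "R \<in> SO3"
  shows "R ** R = trace R *\<^sub>R R - trace R *\<^sub>R mat 1 + transpose R"
proof -
  define A :: mat3 where "A = vector [
     vector [R$2$2 * R$3$3 - R$2$3 * R$3$2, R$1$3 * R$3$2 - R$1$2 * R$3$3, R$1$2 * R$2$3 - R$1$3 * R$2$2],
     vector [R$2$3 * R$3$1 - R$2$1 * R$3$3, R$1$1 * R$3$3 - R$1$3 * R$3$1, R$1$3 * R$2$1 - R$1$1 * R$2$3],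
     vector [R$2$1 * R$3$2 - R$2$2 * R$3$1, R$1$2 * R$3$1 - R$1$1 * R$3$2, R$1$1 * R$2$2 - R$1$2 * R$2$1]]"
  have "A ** R = det R *\<^sub>R mat 1"
    unfolding A_def by (simp add: mat3_simps algebra_simps)
  then have "A ** R = mat 1" using assms by (simp add: SO3_def)
  then have A: "transpose R = A"
    using SO3_cancel(3)[OF assms, of A] by simp
  then have tr: "trace A = trace R" by (metis trace_transpose)
  \<comment> \<open>Cayley-Hamilton in terms of the adjugate A, valid for every 3 x 3 matrix; that R
    is a rotation enters only through A.\<close>
  have "R ** R = trace R *\<^sub>R R - trace A *\<^sub>R mat 1 + A"
    unfolding A_def by (simp add: mat3_simps algebra_simps)
  then show ?thesis using A tr by simp
qed

lemma inner_SO3_transpose: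
  assumes "R \<in> SO3"
  shows "inner R (transpose R) = (trace R)\<^sup>2 - 2 * trace R"
proof -
  have "inner R (transpose R) = inner (mat 1) (R ** R)"
    by (simp add: mat3_simps)
  also have "\<dots> = (trace R)\<^sup>2 - 2 * trace R"
    unfolding SO3_square[OF assms] inner_add_right inner_diff_right inner_scaleR_right inner_mat1_left
    by (simp add: power2_eq_square trace_transpose) (simp add: trace_def mat_def sum_3)
  finally show ?thesis .
qed

lemma norm_SO3_diff:
  assumes "R \<in> SO3" "Q \<in> SO3"
  shows "(norm (R - Q))\<^sup>2 = 2 * (3 - trace (transpose Q ** R))"
proof -
  have "(norm (R - Q))\<^sup>2 = inner R R + inner Q Q - 2 * inner Q R"
    by (simp add: power2_norm_eq_inner inner_diff inner_commute)
  moreover have "inner Q R = trace (transpose Q ** R)"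
    using inner_matmul_left[of Q "mat 1" R] by (simp add: inner_mat1_left)
  ultimately show ?thesis using assms by (simp add: inner_SO3_self)
qed

text \<open>In terms of the angle the value is 8 sin^2 \<theta>. The skew part thus vanishes
  precisely at the identity (trace 3) and at the half-turns (trace -1).\<close>

lemma norm_SO3_skew_part:
  assumes "R \<in> SO3"
  shows "(norm (R - transpose R))\<^sup>2 = 2 * (3 - trace R) * (1 + trace R)"
proof -
  have "(norm (R - transpose R))\<^sup>2 = inner R R + inner (transpose R) (transpose R) - 2 * inner R (transpose R)"
    by (simp add: power2_norm_eq_inner inner_diff inner_commute)
  then show ?thesis
    using assms by (simp add: inner_SO3_self inner_transpose inner_SO3_transpose power2_eq_square algebra_simps)
qed

lemma trace_SO3_le: "R \<in> SO3 \<Longrightarrow> trace R \<le> 3"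
  using norm_SO3_diff[OF _ mat1_SO3, of R] zero_le_power2[of "norm (R - mat 1)"] by simp

lemma trace_SO3_eq_3: "R \<in> SO3 \<Longrightarrow> trace R = 3 \<longleftrightarrow> R = mat 1"
  using norm_SO3_diff[OF _ mat1_SO3, of R] by auto

text \<open>A squared norm is nonnegative: (3 - tr R) (1 + tr R) \<ge> 0 with tr R < 3 forces the
  second factor to be nonnegative. No eigenvalues are involved.\<close>

lemma trace_SO3_ge:
  assumes "R \<in> SO3" shows "trace R \<ge> -1"
proof (cases "trace R = 3")
  case False
  then have "3 - trace R > 0" using trace_SO3_le[OF assms] by simp
  moreover have "(3 - trace R) * (1 + trace R) = (norm (R - transpose R))\<^sup>2 / 2"
    unfolding norm_SO3_skew_part[OF assms] by (simp add: algebra_simps)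
  then have "0 \<le> (3 - trace R) * (1 + trace R)" by (metis zero_le_power2 divide_nonneg_pos zero_less_numeral)
  ultimately show ?thesis by (simp add: zero_le_mult_iff)
qed simp

section \<open>Angle and logarithm of a rotation\<close>

lemma rot_angle_bounds:
  assumes "R \<in> SO3"
  shows "0 \<le> rot_angle R" "rot_angle R \<le> pi"
  using trace_SO3_le[OF assms] trace_SO3_ge[OF assms]
  unfolding rot_angle_def by (auto intro!: arccos_lbound arccos_ubound)

lemma cos_rot_angle: "R \<in> SO3 \<Longrightarrow> 2 * cos (rot_angle R) = trace R - 1"
  using trace_SO3_le[of R] trace_SO3_ge[of R] unfolding rot_angle_def by simp

lemma sin_rot_angle:
  assumes "R \<in> SO3" shows "norm (R - transpose R) = 2 * sqrt 2 * sin (rot_angle R)"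
proof -
  have c: "cos (rot_angle R) = (trace R - 1) / 2" using cos_rot_angle[OF assms] by simp
  have "(norm (R - transpose R))\<^sup>2 = (2 * sqrt 2 * sin (rot_angle R))\<^sup>2"
    unfolding norm_SO3_skew_part[OF assms] power_mult_distrib sin_squared_eq c
    by (simp add: power2_eq_square field_simps)
  moreover have "sin (rot_angle R) \<ge> 0"
    using rot_angle_bounds[OF assms] by (intro sin_ge_zero)
  ultimately show ?thesis by (metis norm_ge_zero power2_eq_imp_eq mult_nonneg_nonneg real_sqrt_ge_zero zero_le_numeral)
qed

lemma rot_angle_eq_pi: "R \<in> SO3 \<Longrightarrow> rot_angle R = pi \<longleftrightarrow> trace R = -1"
  using cos_rot_angle[of R] by (auto simp: rot_angle_def)

lemma rot_angle_eq_0: "R \<in> SO3 \<Longrightarrow> rot_angle R = 0 \<longleftrightarrow> R = mat 1"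
  using cos_rot_angle[of R] trace_SO3_eq_3[of R] by (auto simp: rot_angle_def)

lemma trace_matmul_commute:
  fixes A B :: mat3
  shows "trace (A ** B) = trace (B ** A :: mat3)"
  by (simp add: mat3_simps algebra_simps)

text \<open>The second form makes the singularity a level of the Lyapunov function: trace -1 is
  squared error 8, its maximal value.\<close>

lemma nonsingular_state_iff:
  assumes "P \<in> SO3" "Q \<in> SO3"
  shows "nonsingular_state P Q \<longleftrightarrow> trace (transpose Q ** P) \<noteq> -1"
    and "nonsingular_state P Q \<longleftrightarrow> (norm (Q - P))\<^sup>2 < 8"
proof -
  have SO: "transpose P ** Q \<in> SO3" using assms by (simp add: SO3_mult SO3_transpose)
  have tr: "trace (transpose Q ** P) = trace (transpose P ** Q)"
    by (metis matrix_transpose_mul trace_transpose transpose_transpose)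
  show "nonsingular_state P Q \<longleftrightarrow> trace (transpose Q ** P) \<noteq> -1"
    unfolding nonsingular_state_def rot_angle_eq_pi[OF SO] tr ..
  then show "nonsingular_state P Q \<longleftrightarrow> (norm (Q - P))\<^sup>2 < 8"
    using norm_SO3_diff[OF assms(2,1)] trace_SO3_ge[OF SO] tr by auto
qed

lemma rot_angle_less_pi:
  "R \<in> SO3 \<Longrightarrow> trace R \<noteq> -1 \<Longrightarrow> rot_angle R < pi"
  using rot_angle_bounds(2)[of R] rot_angle_eq_pi[of R] by auto

lemma skew_part_nonzero:
  assumes "R \<in> SO3" "trace R \<noteq> -1" "R \<noteq> mat 1"
  shows "norm (R - transpose R) > 0"
proof -
  have "trace R < 3" "trace R > -1"
    using assms trace_SO3_eq_3[of R] trace_SO3_le[of R] trace_SO3_ge[of R] by auto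
  then have "(norm (R - transpose R))\<^sup>2 > 0" unfolding norm_SO3_skew_part[OF assms(1)] by simp
  then show ?thesis by simp
qed

lemma sin_rot_angle_pos:
  assumes "R \<in> SO3" "trace R \<noteq> -1" "R \<noteq> mat 1"
  shows "sin (rot_angle R) > 0"
  using skew_part_nonzero[OF assms] sin_rot_angle[OF assms(1)] by (simp add: zero_less_mult_iff)

lemma rot_log_nonsingular:
  assumes "R \<in> SO3" "trace R \<noteq> -1"
  shows "rot_log R = (rot_angle R / (2 * sin (rot_angle R))) *\<^sub>R (R - transpose R)"
  using rot_angle_less_pi[OF assms] by (simp add: rot_log_def Let_def)

text \<open>The factor sqrt 2 is the Frobenius norm of the cross-product matrix of a unit
  vector.\<close>

lemma norm_rot_log:
  assumes "R \<in> SO3" "trace R \<noteq> -1"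
  shows "norm (rot_log R) = sqrt 2 * rot_angle R"
proof (cases "R = mat 1")
  case True
  then show ?thesis using rot_angle_eq_0[OF mat1_SO3] by (simp add: rot_log_def Let_def)
next
  case False
  note s = sin_rot_angle_pos[OF assms False]
  show ?thesis
    unfolding rot_log_nonsingular[OF assms] using s rot_angle_bounds(1)[OF assms(1)] sin_rot_angle[OF assms(1)]
    by simp
qed

lemma rot_log_normalized:
  assumes "R \<in> SO3" "trace R \<noteq> -1" "R \<noteq> mat 1"
  shows "(1 / norm (rot_log R)) *\<^sub>R rot_log R = (1 / norm (R - transpose R)) *\<^sub>R (R - transpose R)"
proof -
  have "rot_angle R > 0"
    using rot_angle_bounds(1)[OF assms(1)] rot_angle_eq_0[OF assms(1)] assms(3) by linarith
  then show ?thesis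
    unfolding norm_rot_log[OF assms(1,2)] sin_rot_angle[OF assms(1)]
    unfolding rot_log_nonsingular[OF assms(1,2)] by simp
qed

lemma inner_skew_part:
  assumes "R \<in> SO3"
  shows "inner R (R - transpose R) = (norm (R - transpose R))\<^sup>2 / 2"
proof -
  have "(norm (R - transpose R))\<^sup>2 = inner R (R - transpose R) - inner (transpose R) (R - transpose R)"
    by (simp add: power2_norm_eq_inner inner_diff_left)
  also have "inner (transpose R) (R - transpose R) = - inner R (R - transpose R)"
    using inner_transpose[of R "transpose R"] inner_transpose[of R R] by (simp add: inner_diff_right)
  finally show ?thesis by simp
qed

text \<open>The exact value is 2 \<theta> sin \<theta> = 8 \<phi> sin \<phi> cos \<phi> with \<phi>
  = \<theta>/2. Replacing \<phi> by sin \<phi> leaves 8 sin^2 \<phi> cos \<phi>, which is a function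
  of the trace alone; the factor 3 - tr R is what an exponential rate requires.\<close>

lemma inner_rot_log_ge:
  assumes "R \<in> SO3" "trace R \<noteq> -1"
  shows "inner R (rot_log R) \<ge> sqrt (1 + trace R) * (3 - trace R)"
proof -
  define \<phi> where "\<phi> = rot_angle R / 2"
  have \<theta>: "rot_angle R = 2 * \<phi>" by (simp add: \<phi>_def)
  have \<phi>: "0 \<le> \<phi>" "\<phi> < pi / 2"
    using rot_angle_bounds[OF assms(1)] rot_angle_less_pi[OF assms] by (auto simp: \<phi>_def)
  have c: "cos \<phi> > 0" using \<phi> by (intro cos_gt_zero_pi) auto
  have s: "sin \<phi> \<ge> 0" using \<phi> by (intro sin_ge_zero) auto
  have t: "1 + trace R = (2 * cos \<phi>)\<^sup>2" "3 - trace R = 4 * (sin \<phi>)\<^sup>2"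
    using cos_rot_angle[OF assms(1)] cos_double_cos[of \<phi>] cos_double_sin[of \<phi>]
    by (auto simp: \<theta> power2_eq_square algebra_simps)
  have *: "sqrt (1 + trace R) = 2 * cos \<phi>" unfolding t(1) real_sqrt_abs using c by simp
  have "inner R (rot_log R) = 2 * rot_angle R * sin (rot_angle R)"
  proof (cases "R = mat 1")
    case True
    then show ?thesis using rot_angle_eq_0[OF mat1_SO3] by (simp add: rot_log_def Let_def)
  next
    case False
    then show ?thesis
      using sin_rot_angle_pos[OF assms False]
      unfolding rot_log_nonsingular[OF assms] inner_scaleR_right inner_skew_part[OF assms(1)]
        sin_rot_angle[OF assms(1)] by (simp add: power2_eq_square)
  qed
  also have "\<dots> = 8 * (\<phi> * (sin \<phi> * cos \<phi>))"
    unfolding \<theta> sin_double by simp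
  also have "\<dots> \<ge> 8 * (sin \<phi> * (sin \<phi> * cos \<phi>))"
    using s c \<phi> sin_x_le_x[of \<phi>] by (intro mult_left_mono mult_right_mono) auto
  finally show ?thesis unfolding * t(2) by (simp add: power2_eq_square mult.assoc mult.left_commute mult.commute)
qed

section \<open>The Rodrigues formula\<close>

text \<open>The cross-product matrices of unit vectors: each coordinate of the vector occurs twice,
  hence the norm sqrt 2.\<close>

definition unit_axis :: "mat3 \<Rightarrow> bool" where
  "unit_axis K \<longleftrightarrow> transpose K = - K \<and> norm K = sqrt 2"

text \<open>For a unit axis K this is the matrix exponential of \<theta> K, the rotation about K by
  \<theta>.\<close>

definition rodrigues :: "real \<Rightarrow> mat3 \<Rightarrow> mat3" where
  "rodrigues \<theta> K = mat 1 + sin \<theta> *\<^sub>R K + (1 - cos \<theta>) *\<^sub>R (K ** K)"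

lemma unit_axis_entries:
  assumes "unit_axis K"
  obtains a b c where "K = vector [vector [0, a, b], vector [- a, 0, c], vector [- b, - c, 0]]"
    "a\<^sup>2 + b\<^sup>2 + c\<^sup>2 = 1"
proof
  have e: "K$j$i = - K$i$j" for i j
  proof -
    have "transpose K $ i $ j = (- K) $ i $ j" using assms unfolding unit_axis_def by metis
    then show ?thesis by (simp only: transpose_def vec_lambda_beta vector_uminus_component)
  qed
  have sk: "K$1$1 = 0" "K$2$2 = 0" "K$3$3 = 0"
    "K$2$1 = - K$1$2" "K$3$1 = - K$1$3" "K$3$2 = - K$2$3"
    using e[of 1 1] e[of 2 2] e[of 3 3] e[of 2 1] e[of 3 1] e[of 3 2] by simp_all
  then show "K = vector [vector [0, K$1$2, K$1$3], vector [- (K$1$2), 0, K$2$3], vector [- (K$1$3), - (K$2$3), 0]]"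
    by (simp add: mat3_simps)
  have "inner K K = 2" using assms unfolding unit_axis_def by (simp add: power2_norm_eq_inner[symmetric])
  then show "(K$1$2)\<^sup>2 + (K$1$3)\<^sup>2 + (K$2$3)\<^sup>2 = 1"
    using sk by (simp add: mat3_simps power2_eq_square)
qed

text \<open>Cayley-Hamilton: the characteristic polynomial of K is x^3 + x. All powers of K thereby
  reduce to K and its square.\<close>

lemma unit_axis_cube:
  assumes "unit_axis K" shows "K ** K ** K = - K"
proof -
  obtain a b c where K: "K = vector [vector [0, a, b], vector [- a, 0, c], vector [- b, - c, 0]]"
    and n: "a\<^sup>2 + b\<^sup>2 + c\<^sup>2 = 1" using assms by (rule unit_axis_entries)
  have "K ** K ** K = - (a\<^sup>2 + b\<^sup>2 + c\<^sup>2) *\<^sub>R K"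
    unfolding K by (simp add: mat3_simps) (simp add: power2_eq_square algebra_simps)
  then show ?thesis using n by simp
qed

lemma unit_axis_trace:
  assumes "unit_axis K" shows "trace K = 0" "trace (K ** K) = - 2"
proof -
  obtain a b c where K: "K = vector [vector [0, a, b], vector [- a, 0, c], vector [- b, - c, 0]]"
    and n: "a\<^sup>2 + b\<^sup>2 + c\<^sup>2 = 1" using assms by (rule unit_axis_entries)
  show "trace K = 0" unfolding K by (simp add: mat3_simps)
  have "trace (K ** K) = - 2 * (a\<^sup>2 + b\<^sup>2 + c\<^sup>2)"
    unfolding K by (simp add: mat3_simps power2_eq_square)
  then show "trace (K ** K) = - 2" using n by simp
qed

lemma unit_axis_conjugate:
  assumes "unit_axis K" "R \<in> SO3" shows "unit_axis (transpose R ** K ** R)"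
  using assms unfolding unit_axis_def
  by (simp add: matrix_transpose_mul matmul_simps norm_SO3_right norm_SO3_left SO3_transpose matrix_mul_assoc)

lemma unit_axis_minus: "unit_axis K \<Longrightarrow> unit_axis (- K)"
  by (simp add: unit_axis_def transpose_linear_simps)

lemma ex_unit_axis: "\<exists>K. unit_axis K"
proof
  show "unit_axis (vector [vector [0, 1, 0], vector [- 1, 0, 0], vector [0, 0, 0]])"
    unfolding unit_axis_def by (simp add: norm_eq_sqrt_inner mat3_simps)
qed

lemma rodrigues_0 [simp]: "rodrigues 0 K = mat 1"
  by (simp add: rodrigues_def)

lemma rodrigues_mult_axis:
  assumes "unit_axis K"
  shows "rodrigues \<theta> K ** K = cos \<theta> *\<^sub>R K + sin \<theta> *\<^sub>R (K ** K)"
  unfolding rodrigues_def by (simp add: matmul_simps unit_axis_cube[OF assms] algebra_simps)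

lemma rodrigues_conjugate:
  assumes "R \<in> SO3"
  shows "rodrigues \<theta> (transpose R ** K ** R) = transpose R ** rodrigues \<theta> K ** R"
proof -
  have "transpose R ** K ** R ** (transpose R ** K ** R) = transpose R ** (K ** K) ** R"
    using assms by (simp add: matrix_mul_assoc)
  then show ?thesis
    unfolding rodrigues_def using assms by (simp add: matmul_simps SO3_transpose_mult)
qed

lemma transpose_rodrigues:
  assumes "unit_axis K" shows "transpose (rodrigues \<theta> K) = rodrigues \<theta> (- K)"
  using assms unfolding rodrigues_def unit_axis_def
  by (simp add: transpose_linear_simps matrix_transpose_mul matmul_simps)

lemma rodrigues_add:
  assumes "unit_axis K"
  shows "rodrigues \<theta> K ** rodrigues \<phi> K = rodrigues (\<theta> + \<phi>) K"
proof -
  have 3: "K ** (K ** K) = - K" "K ** K ** K = - K"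
    using unit_axis_cube[OF assms] by (simp_all add: matrix_mul_assoc)
  have 4: "K ** K ** (K ** K) = - (K ** K)"
    using 3 by (simp add: matrix_mul_assoc matmul_simps)
  have "rodrigues \<theta> K ** rodrigues \<phi> K
     = mat 1 + (sin \<theta> + sin \<phi> - sin \<theta> * (1 - cos \<phi>) - (1 - cos \<theta>) * sin \<phi>) *\<^sub>R K
       + (1 - cos \<theta> + (1 - cos \<phi>) + sin \<theta> * sin \<phi> - (1 - cos \<theta>) * (1 - cos \<phi>)) *\<^sub>R (K ** K)"
    unfolding rodrigues_def by (simp add: matmul_simps 3 4 algebra_simps)
  also have "\<dots> = rodrigues (\<theta> + \<phi>) K"
    unfolding rodrigues_def by (simp add: sin_add cos_add algebra_simps)
  finally show ?thesis .
qed

lemma rodrigues_SO3: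
  assumes "unit_axis K" shows "rodrigues \<theta> K \<in> SO3"
proof -
  have orth: "rodrigues \<theta> K ** transpose (rodrigues \<theta> K) = mat 1" for \<theta>
  proof -
    have "transpose (rodrigues \<theta> K) = rodrigues (- \<theta>) K"
      unfolding transpose_rodrigues[OF assms] by (simp add: rodrigues_def matmul_simps)
    then show ?thesis by (simp add: rodrigues_add[OF assms])
  qed
  \<comment> \<open>Orthogonality leaves the determinant \<plusminus>1; being the square of an
    orthogonal matrix excludes -1.\<close>
  have "rodrigues \<theta> K = rodrigues (\<theta> / 2) K ** rodrigues (\<theta> / 2) K"
    by (simp add: rodrigues_add[OF assms])
  then have "det (rodrigues \<theta> K) = det (rodrigues (\<theta> / 2) K) * det (transpose (rodrigues (\<theta> / 2) K))"
    by (simp add: det_mul)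
  also have "\<dots> = 1" by (metis det_I det_mul orth)
  finally show ?thesis using orth by (simp add: SO3_def)
qed

lemma trace_rodrigues:
  assumes "unit_axis K" shows "trace (rodrigues \<theta> K) = 1 + 2 * cos \<theta>"
proof -
  have "trace (rodrigues \<theta> K) = trace (mat 1 :: mat3) + sin \<theta> * trace K + (1 - cos \<theta>) * trace (K ** K)"
    unfolding rodrigues_def trace_def by (simp add: sum_3 algebra_simps)
  then show ?thesis
    using unit_axis_trace[OF assms] by (simp add: trace_def mat_def sum_3)
qed

lemma rot_angle_rodrigues:
  assumes "unit_axis K" "0 \<le> \<theta>" "\<theta> \<le> pi"
  shows "rot_angle (rodrigues \<theta> K) = \<theta>"
  using assms by (simp add: rot_angle_def trace_rodrigues arccos_cos)

lemma rodrigues_skew_part: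
  assumes "unit_axis K"
  shows "rodrigues \<theta> K - transpose (rodrigues \<theta> K) = (2 * sin \<theta>) *\<^sub>R K"
proof -
  have "(2 * sin \<theta>) *\<^sub>R K = sin \<theta> *\<^sub>R K + sin \<theta> *\<^sub>R K"
    by (simp add: scaleR_left_distrib[symmetric])
  then show ?thesis
    unfolding transpose_rodrigues[OF assms] by (simp add: rodrigues_def matmul_simps)
qed

lemma rot_log_rodrigues:
  assumes "unit_axis K" "0 \<le> \<theta>" "\<theta> < pi"
  shows "rot_log (rodrigues \<theta> K) = \<theta> *\<^sub>R K"
proof (cases "\<theta> = 0")
  case True
  then show ?thesis using rot_angle_eq_0[OF mat1_SO3] by (simp add: rot_log_def Let_def)
next
  case False
  then have "sin \<theta> > 0" using assms by (intro sin_gt_zero) auto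
  then show ?thesis
    using assms False by (simp add: rot_log_def Let_def rot_angle_rodrigues rodrigues_skew_part)
qed

text \<open>The axis is read off the skew part, which is nonzero except at the identity, where any
  axis serves. The symmetric part is then determined by Cayley-Hamilton.\<close>

lemma SO3_eq_rodrigues:
  assumes "R \<in> SO3" "trace R \<noteq> -1"
  obtains K where "unit_axis K" "R = rodrigues (rot_angle R) K"
proof (cases "R = mat 1")
  case True
  obtain K where "unit_axis K" using ex_unit_axis by blast
  then show ?thesis using that[of K] True rot_angle_eq_0[OF mat1_SO3] by simp
next
  case False
  define K where "K = (1 / (2 * sin (rot_angle R))) *\<^sub>R (R - transpose R)"
  note s = sin_rot_angle_pos[OF assms False]
  have t: "trace R > -1" using trace_SO3_ge[OF assms(1)] assms(2) by simp
  have "transpose K = - K"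
    unfolding K_def by (simp add: transpose_linear_simps scaleR_minus_right[symmetric] del: scaleR_minus_right)
  moreover have "norm K = sqrt 2"
    unfolding K_def using s sin_rot_angle[OF assms(1)] by simp
  ultimately have K: "unit_axis K" by (simp add: unit_axis_def)
  have sK: "sin (rot_angle R) *\<^sub>R K = (1/2) *\<^sub>R (R - transpose R)"
    unfolding K_def using s by simp
  have c: "cos (rot_angle R) = (trace R - 1) / 2" using cos_rot_angle[OF assms(1)] by simp
  have s2: "(2 * sin (rot_angle R)) * (2 * sin (rot_angle R)) = (3 - trace R) * (1 + trace R)"
    using sin_squared_eq[of "rot_angle R"] unfolding c by (simp add: power2_eq_square field_simps)
  \<comment> \<open>Cayley-Hamilton for R and for its transpose expresses the square of the skew
    part through the symmetric part.\<close>
  have sq: "(R - transpose R) ** (R - transpose R) = (1 + trace R) *\<^sub>R (R + transpose R - 2 *\<^sub>R mat 1)"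
    unfolding matmul.diff_left matmul.diff_right SO3_square[OF assms(1)]
      SO3_square[OF SO3_transpose[OF assms(1)]]
      SO3_mult_transpose[OF assms(1)] SO3_transpose_mult[OF assms(1)] trace_transpose transpose_transpose
    by (simp add: vec_eq_iff) (simp add: algebra_simps)
  have k: "1 / (2 * sin (rot_angle R)) * (1 / (2 * sin (rot_angle R))) = 1 / ((3 - trace R) * (1 + trace R))"
    unfolding s2[symmetric] by simp
  have "K ** K = (1 / (2 * sin (rot_angle R)) * (1 / (2 * sin (rot_angle R))) * (1 + trace R)) *\<^sub>R
      (R + transpose R - 2 *\<^sub>R mat 1)"
    unfolding K_def matmul.scaleR_left matmul.scaleR_right sq scaleR_scaleR by (simp only: mult.assoc)
  then have "(1 - cos (rot_angle R)) *\<^sub>R (K ** K)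
      = ((1 - cos (rot_angle R)) * (1 / ((3 - trace R) * (1 + trace R)) * (1 + trace R))) *\<^sub>R (R + transpose R - 2 *\<^sub>R mat 1)"
    by (simp only: k scaleR_scaleR)
  also have "(1 - cos (rot_angle R)) * (1 / ((3 - trace R) * (1 + trace R)) * (1 + trace R)) = 1 / 2"
  proof -
    have "1 - cos (rot_angle R) = (3 - trace R) / 2" unfolding c by (simp add: field_simps)
    moreover have "3 - trace R \<noteq> 0" "1 + trace R \<noteq> 0"
      using t trace_SO3_eq_3[OF assms(1)] False by auto
    ultimately show ?thesis by simp
  qed
  finally have "rodrigues (rot_angle R) K
      = mat 1 + (1/2) *\<^sub>R (R - transpose R) + (1/2) *\<^sub>R (R + transpose R - 2 *\<^sub>R mat 1)"
    unfolding rodrigues_def sK by simp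
  also have "\<dots> = (1/2 + 1/2) *\<^sub>R R"
    by (simp add: vec_eq_iff) (simp add: field_simps)
  finally show ?thesis using that K by simp
qed

lemma rodrigues_has_vector_derivative:
  assumes "unit_axis K" "(\<theta> has_real_derivative \<theta>') (at t within S)"
  shows "((\<lambda>t. rodrigues (\<theta> t) K) has_vector_derivative \<theta>' *\<^sub>R (rodrigues (\<theta> t) K ** K)) (at t within S)"
  unfolding rodrigues_mult_axis[OF assms(1)] unfolding rodrigues_def
  by (auto intro!: derivative_eq_intros assms(2) simp: algebra_simps)

section \<open>Null sets of the state space\<close>

text \<open>Makes the empty set admissible in the Filippov intersection. In dimension 0 the power
  0^0 = 1 would spoil the cover by empty sets.\<close>

lemma hausdorff_measure_empty:
  assumes "k > 0" shows "hausdorff_measure k ({} :: 'a::metric_space set) = 0"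
proof -
  have "(INF C\<in>{C :: nat \<Rightarrow> 'a set.
           {} \<subseteq> (\<Union>i. C i) \<and> (\<forall>i. bounded (C i) \<and> diameter (C i) \<le> \<delta>)}.
          \<Sum>i. ennreal (diameter (C i) ^ k)) \<le> 0" if "\<delta> > 0" for \<delta>
  proof (rule INF_lower2)
    show "(\<lambda>i. {}) \<in> {C :: nat \<Rightarrow> 'a set. {} \<subseteq> (\<Union>i. C i) \<and> (\<forall>i. bounded (C i) \<and> diameter (C i) \<le> \<delta>)}"
      using that by simp
  qed (use assms in \<open>simp add: power_0_left\<close>)
  then have "(SUP \<delta>\<in>{0<..}. INF C\<in>{C :: nat \<Rightarrow> 'a set.
           {} \<subseteq> (\<Union>i. C i) \<and> (\<forall>i. bounded (C i) \<and> diameter (C i) \<le> \<delta>)}.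
          \<Sum>i. ennreal (diameter (C i) ^ k)) \<le> 0"
    by (intro SUP_least) auto
  then show ?thesis unfolding hausdorff_measure_def by simp
qed

lemma hausdorff_null_cover:
  fixes S :: "'a::metric_space set"
  assumes "hausdorff_measure k S = 0" "e > 0"
  obtains C :: "nat \<Rightarrow> 'a set" where "S \<subseteq> (\<Union>i. C i)" "\<And>i. bounded (C i)"
    "(\<Sum>i. ennreal (diameter (C i) ^ k)) < e"
proof -
  let ?\<C> = "\<lambda>\<delta>. {C :: nat \<Rightarrow> 'a set. S \<subseteq> (\<Union>i. C i) \<and> (\<forall>i. bounded (C i) \<and> diameter (C i) \<le> \<delta>)}"
  have "\<not> unit_ball_vol (real k) / 2 ^ k \<le> 0" by (simp add: not_le)
  then have "(SUP \<delta>\<in>{0<..}. INF C\<in>?\<C> \<delta>. \<Sum>i. ennreal (diameter (C i) ^ k)) = 0"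
    using assms(1) unfolding hausdorff_measure_def by (auto simp: ennreal_eq_0_iff)
  \<comment> \<open>The supremum over all scales is 0, so the infimum at each scale is 0; scale 1 is
    an arbitrary choice.\<close>
  moreover have "(INF C\<in>?\<C> 1. \<Sum>i. ennreal (diameter (C i) ^ k))
      \<le> (SUP \<delta>\<in>{0<..}. INF C\<in>?\<C> \<delta>. \<Sum>i. ennreal (diameter (C i) ^ k))"
    by (rule SUP_upper) simp
  ultimately have "(INF C\<in>?\<C> 1. \<Sum>i. ennreal (diameter (C i) ^ k)) < e"
    using assms(2) by simp
  then show ?thesis
    unfolding INF_less_iff using that by blast
qed

text \<open>Each covering set meets S in a part whose image lies in a ball of radius L times the
  diameter. The volumes of these balls sum to a constant times the small sum of powers of
  diameters.\<close>

lemma hausdorff_null_lipschitz_image_negligible: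
  fixes p :: "'a::metric_space \<Rightarrow> 'b::euclidean_space"
  assumes null: "hausdorff_measure DIM('b) S = 0"
    and lip: "\<And>x y. x \<in> S \<Longrightarrow> y \<in> S \<Longrightarrow> dist (p x) (p y) \<le> L * dist x y" and "L \<ge> 0"
  shows "negligible (p ` S)"
  unfolding negligible_outer_le
proof (intro allI impI)
  fix e :: real assume "e > 0"
  define c where "c = unit_ball_vol (real DIM('b)) * L ^ DIM('b)"
  have c: "c \<ge> 0" using \<open>L \<ge> 0\<close> by (simp add: c_def)
  \<comment> \<open>\<open>c\<close> may be 0, namely for \<open>L = 0\<close>; hence the
    denominator c + 1.\<close>
  have "ennreal (e / (c + 1)) > 0" using \<open>e > 0\<close> c by simp
  then obtain C :: "nat \<Rightarrow> 'a set" where C: "S \<subseteq> (\<Union>i. C i)" "\<And>i. bounded (C i)"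
    "(\<Sum>i. ennreal (diameter (C i) ^ DIM('b))) < ennreal (e / (c + 1))"
    using hausdorff_null_cover[OF null] by blast
  have "\<exists>z. p ` (C i \<inter> S) \<subseteq> cball z (L * diameter (C i))" for i
  proof (cases "C i \<inter> S = {}")
    case False
    then obtain x where x: "x \<in> C i" "x \<in> S" by blast
    have "dist (p x) (p y) \<le> L * diameter (C i)" if "y \<in> C i" "y \<in> S" for y
      using lip[OF x(2) that(2)] diameter_bounded_bound[OF C(2) x(1) that(1)] \<open>L \<ge> 0\<close>
      by (meson mult_left_mono order_trans)
    then show ?thesis by (intro exI[of _ "p x"]) auto
  qed auto
  then obtain z where z: "\<And>i. p ` (C i \<inter> S) \<subseteq> cball (z i) (L * diameter (C i))" by metis
  define B where "B i = cball (z i) (L * diameter (C i))" for i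
  have "emeasure lborel (\<Union>i. B i) \<le> (\<Sum>i. emeasure lborel (B i))"
    by (rule emeasure_subadditive_countably) (auto simp: B_def)
  also have "\<dots> = (\<Sum>i. ennreal c * ennreal (diameter (C i) ^ DIM('b)))"
    using \<open>L \<ge> 0\<close> c diameter_ge_0[OF C(2)]
    by (intro suminf_cong)
      (simp add: B_def emeasure_cball c_def power_mult_distrib mult.assoc flip: ennreal_mult')
  also have "\<dots> = ennreal c * (\<Sum>i. ennreal (diameter (C i) ^ DIM('b)))"
    by simp
  also have "\<dots> \<le> ennreal c * ennreal (e / (c + 1))"
    using C(3) by (intro mult_left_mono) auto
  also have "\<dots> \<le> ennreal e"
    using c \<open>e > 0\<close> by (simp add: field_simps flip: ennreal_mult)
  finally have le: "emeasure lebesgue (\<Union>i. B i) \<le> ennreal e"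
    by (simp add: B_def)
  have sets: "(\<Union>i. B i) \<in> sets lebesgue" by (auto simp: B_def)
  have "(\<Union>i. B i) \<in> lmeasurable"
    using le sets by (intro fmeasurableI) (auto simp: less_top[symmetric] top_unique)
  moreover have "measure lebesgue (\<Union>i. B i) \<le> e"
    using le \<open>e > 0\<close> by (simp add: measure_def enn2real_leI)
  moreover have "p ` S \<subseteq> (\<Union>i. B i)"
    using C(1) z unfolding B_def by blast
  ultimately show "\<exists>T. p ` S \<subseteq> T \<and> T \<in> lmeasurable \<and> measure lebesgue T \<le> e"
    by blast
qed

text \<open>A chart of SO(3) at the identity. Unlike the logarithm it is linear in the entries,
  hence globally Lipschitz.\<close>

definition skew_coords :: "mat3 \<Rightarrow> real^3" where
  "skew_coords A = vector [(A$1$2 - A$2$1) / 2, (A$1$3 - A$3$1) / 2, (A$2$3 - A$3$2) / 2]"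

lemma bounded_linear_skew_coords: "bounded_linear skew_coords"
  unfolding linear_conv_bounded_linear[symmetric]
  by (rule linearI) (simp_all add: skew_coords_def vec_eq_iff forall_3 field_simps)

text \<open>The rotation about the direction of u with sine |u| of its angle has skew part u; this
  inverts the chart on the open unit ball.\<close>

lemma SO3_with_skew_coords:
  assumes "norm u < 1"
  obtains R where "R \<in> SO3" "skew_coords R = u" "norm (R - mat 1) \<le> 2 * norm u"
proof (cases "u = 0")
  case True
  show ?thesis
  proof (rule that[OF mat1_SO3])
    show "skew_coords (mat 1) = u" by (simp add: True skew_coords_def vec_eq_iff forall_3 mat_def)
  qed simp
next
  case False
  define \<theta> where "\<theta> = arcsin (norm u)"
  define a b c where "a = u$1 / norm u" "b = u$2 / norm u" "c = u$3 / norm u"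
  define K :: mat3 where "K = vector [vector [0, a, b], vector [- a, 0, c], vector [- b, - c, 0]]"
  have u: "- 1 \<le> norm u" "norm u \<le> 1" using assms norm_ge_zero[of u] by linarith+
  have s: "sin \<theta> = norm u" unfolding \<theta>_def using u by (rule sin_arcsin)
  have "cos \<theta> \<ge> 0"
    unfolding \<theta>_def cos_arcsin[OF u] using assms by (simp add: abs_square_le_1)
  have nu: "(norm u)\<^sup>2 = (u$1)\<^sup>2 + (u$2)\<^sup>2 + (u$3)\<^sup>2"
    unfolding power2_norm_eq_inner by (simp add: inner_vec_def sum_3 power2_eq_square)
  have "a * a + b * b + c * c = ((u$1)\<^sup>2 + (u$2)\<^sup>2 + (u$3)\<^sup>2) / (norm u)\<^sup>2"
    unfolding a_b_c_def by (simp add: power2_eq_square add_divide_distrib)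
  then have n: "a * a + b * b + c * c = 1"
    unfolding nu[symmetric] using False by simp
  have "inner K K = 2 * (a * a + b * b + c * c)"
    unfolding K_def by (simp add: mat3_simps)
  then have "norm K = sqrt 2" unfolding norm_eq_sqrt_inner n by simp
  moreover have "transpose K = - K" unfolding K_def by (simp add: mat3_simps)
  ultimately have K: "unit_axis K" by (simp add: unit_axis_def)
  show ?thesis
  proof (rule that[of "rodrigues \<theta> K"])
    show SO: "rodrigues \<theta> K \<in> SO3" by (rule rodrigues_SO3[OF K])
    have "skew_coords (rodrigues \<theta> K)
        = (1/2) *\<^sub>R skew_coords (rodrigues \<theta> K - transpose (rodrigues \<theta> K))"
      by (simp add: skew_coords_def vec_eq_iff forall_3 transpose_def field_simps)
    also have "\<dots> = (1/2) *\<^sub>R skew_coords ((2 * norm u) *\<^sub>R K)"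
      unfolding rodrigues_skew_part[OF K] s ..
    also have "\<dots> = u"
      using False by (simp add: skew_coords_def K_def a_b_c_def vec_eq_iff forall_3)
    finally show "skew_coords (rodrigues \<theta> K) = u" .
    \<comment> \<open>From cos^2 \<theta> \<le> cos \<theta> follows 1 - cos \<theta> \<le> sin^2
      \<theta> = |u|^2, and the squared distance to the identity is 4 (1 - cos \<theta>).\<close>
    have "cos \<theta> * cos \<theta> \<le> 1 * cos \<theta>"
      using \<open>cos \<theta> \<ge> 0\<close> by (intro mult_right_mono) auto
    moreover have "(sin \<theta>)\<^sup>2 + (cos \<theta>)\<^sup>2 = 1" by simp
    ultimately have "(norm (rodrigues \<theta> K - mat 1))\<^sup>2 \<le> (2 * norm u)\<^sup>2"
      using norm_SO3_diff[OF SO mat1_SO3] trace_rodrigues[OF K, of \<theta>]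
      unfolding s by (simp add: power2_eq_square)
    then show "norm (rodrigues \<theta> K - mat 1) \<le> 2 * norm u"
      by (rule power2_le_imp_le) simp
  qed
qed

lemma state_space_iff:
  "(P, Q) \<in> state_space \<longleftrightarrow> P \<in> SO3 \<and> Q \<in> SO3 \<and> (norm (Q - P))\<^sup>2 < 8"
  using nonsingular_state_iff(2)[of P Q] by (auto simp: state_space_def)

text \<open>If S contained a whole relative ball around x, its image under the product of the two
  charts would be null in dimension 6 and yet contain a Euclidean ball.\<close>

lemma state_space_null_complement_dense:
  assumes x: "x \<in> state_space" and S: "hausdorff_measure 6 S = 0" and "\<delta> > 0"
  obtains y where "y \<in> ball x \<delta>" "y \<in> state_space" "y \<notin> S"
proof -
  obtain P Q where xPQ: "x = (P, Q)" by (cases x)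
  have PQ: "P \<in> SO3" "Q \<in> SO3" "(norm (Q - P))\<^sup>2 < 8"
    using x unfolding xPQ state_space_iff by auto
  have "\<exists>y. y \<in> ball x \<delta> \<inter> state_space - S"
  proof (rule ccontr)
    assume "\<nexists>y. y \<in> ball x \<delta> \<inter> state_space - S"
    then have sub: "ball x \<delta> \<inter> state_space \<subseteq> S" by blast
    define p :: "mat3 \<times> mat3 \<Rightarrow> (real^3) \<times> (real^3)" where
      "p y = (skew_coords (transpose P ** fst y), skew_coords (transpose Q ** snd y))" for y
    have "bounded_linear p"
      unfolding p_def
      by (intro bounded_linear_Pair bounded_linear_compose[OF bounded_linear_skew_coords]
        bounded_linear_compose[OF matmul.bounded_linear_right] bounded_linear_fst bounded_linear_snd)
    then obtain L where L: "L > 0" "\<And>y. norm (p y) \<le> norm y * L"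
      using bounded_linear.pos_bounded by blast
    have lip: "dist (p y) (p z) \<le> L * dist y z" for y z
      using L(2)[of "y - z"] linear_diff[OF bounded_linear.linear[OF \<open>bounded_linear p\<close>], of y z]
      by (simp add: dist_norm mult.commute)
    have "DIM((real^3) \<times> (real^3)) = 6" by simp
    then have neg: "negligible (p ` S)"
      using hausdorff_null_lipschitz_image_negligible[of S p L] S lip L(1) by simp
    define m where "m = sqrt 8 - norm (Q - P)"
    have m: "m > 0" using PQ(3) real_less_rsqrt[of "norm (Q - P)" 8] by (simp add: m_def)
    \<comment> \<open>Each component moves by at most 2 \<rho>. The total 4 \<rho> stays below
      \<delta> and below the slack m of the error norm under sqrt 8; the bound 1/2 keeps u and v
      inside the domain of the inverse chart.\<close>
    define \<rho> where "\<rho> = min (1/2) (min (m / 5) (\<delta> / 5))"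
    have \<rho>: "\<rho> > 0" "\<rho> < 1" "4 * \<rho> < m" "4 * \<rho> < \<delta>"
      using m \<open>\<delta> > 0\<close> by (auto simp: \<rho>_def min_def)
    have "ball 0 \<rho> \<subseteq> p ` S"
    proof
      fix w :: "(real^3) \<times> (real^3)" assume "w \<in> ball 0 \<rho>"
      obtain u v where w: "w = (u, v)" by (cases w)
      have "norm u < \<rho>" "norm v < \<rho>"
        using \<open>w \<in> ball 0 \<rho>\<close> norm_fst_le[of u v] norm_snd_le[of v u] by (auto simp: w)
      then have uv: "norm u < 1" "norm v < 1" using \<rho>(2) by auto
      obtain A where A: "A \<in> SO3" "skew_coords A = u" "norm (A - mat 1) \<le> 2 * norm u"
        by (rule SO3_with_skew_coords[OF uv(1)])
      obtain B where B: "B \<in> SO3" "skew_coords B = v" "norm (B - mat 1) \<le> 2 * norm v"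
        by (rule SO3_with_skew_coords[OF uv(2)])
      define y where "y = (P ** A, Q ** B)"
      have nA: "norm (P ** A - P) \<le> 2 * \<rho>"
        using norm_SO3_left[OF PQ(1), of "A - mat 1"] A(3) \<open>norm u < \<rho>\<close> by (simp add: matmul_simps)
      have nB: "norm (Q ** B - Q) \<le> 2 * \<rho>"
        using norm_SO3_left[OF PQ(2), of "B - mat 1"] B(3) \<open>norm v < \<rho>\<close> by (simp add: matmul_simps)
      have "norm (y - x) \<le> norm (P ** A - P) + norm (Q ** B - Q)"
        unfolding y_def xPQ by (simp add: norm_Pair sqrt_sum_squares_le_sum)
      then have "y \<in> ball x \<delta>"
        using nA nB \<rho>(4) by (simp add: dist_norm norm_minus_commute)
      moreover have "y \<in> state_space"
      proof -
        have eq: "Q ** B - P ** A = (Q - P) + ((Q ** B - Q) - (P ** A - P))" by simp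
        have "norm (Q ** B - P ** A) \<le> norm (Q - P) + (norm (Q ** B - Q) + norm (P ** A - P))"
          unfolding eq by (rule order_trans[OF norm_triangle_ineq add_left_mono[OF norm_triangle_ineq4]])
        also have "\<dots> < sqrt 8" using nA nB \<rho>(3) unfolding m_def by linarith
        finally have "(norm (Q ** B - P ** A))\<^sup>2 < (sqrt 8)\<^sup>2"
          by (intro power_strict_mono) auto
        then show ?thesis
          unfolding y_def state_space_iff using A(1) B(1) PQ by (simp add: SO3_mult)
      qed
      ultimately have "y \<in> S" using sub by blast
      moreover have "p y = w"
        unfolding p_def y_def w using PQ A(2) B(2) by simp
      ultimately show "w \<in> p ` S" by blast
    qed
    then have "negligible (ball (0::(real^3) \<times> (real^3)) \<rho>)"
      using neg negligible_subset by blast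
    then show False
      using open_not_negligible[of "ball (0::(real^3) \<times> (real^3)) \<rho>"] \<rho>(1) by simp
  qed
  then show ?thesis using that by blast
qed

section \<open>The regularised closed loop\<close>

lemma state_space_error:
  assumes "(P, Q) \<in> state_space"
  shows "transpose Q ** P \<in> SO3" "trace (transpose Q ** P) \<noteq> -1"
    "P \<noteq> Q \<Longrightarrow> transpose Q ** P \<noteq> mat 1" "matrix_inv Q = transpose Q"
proof -
  have PQ: "P \<in> SO3" "Q \<in> SO3" "nonsingular_state P Q" using assms by (auto simp: state_space_def)
  show "transpose Q ** P \<in> SO3" using PQ by (simp add: SO3_mult SO3_transpose)
  show "trace (transpose Q ** P) \<noteq> -1" using PQ nonsingular_state_iff(1) by blast
  show "transpose Q ** P \<noteq> mat 1" if "P \<noteq> Q"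
  proof
    assume "transpose Q ** P = mat 1"
    then have "Q ** (transpose Q ** P) = Q ** mat 1" by simp
    then show False using SO3_cancel(1)[OF PQ(2), of P] that by simp
  qed
  show "matrix_inv Q = transpose Q" by (rule matrix_inv_SO3[OF PQ(2)])
qed

text \<open>The normalised logarithm of a rotation that is neither the identity nor a half-turn: the
  angle cancels, and continuity no longer involves arccos.\<close>

definition unit_skew_part :: "mat3 \<Rightarrow> mat3" where
  "unit_skew_part E = (1 / norm (E - transpose E)) *\<^sub>R (E - transpose E)"

lemma \<omega>_f_off_diagonal:
  assumes "(P, Q) \<in> state_space" "P \<noteq> Q"
  shows "\<omega>_f \<omega> (P, Q) t = unit_skew_part (transpose Q ** P) + \<omega> t"
  using rot_log_normalized[OF state_space_error(1,2)[OF assms(1)] state_space_error(3)[OF assms]]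
  by (simp add: \<omega>_f_def unit_skew_part_def state_space_error(4)[OF assms(1)])

lemma continuous_transpose: "continuous F f \<Longrightarrow> continuous F (\<lambda>x. transpose (f x) :: mat3)"
proof -
  have "bounded_linear (transpose :: mat3 \<Rightarrow> mat3)"
    unfolding linear_conv_bounded_linear[symmetric] by (rule linearI) (simp_all add: transpose_linear_simps)
  then show "continuous F f \<Longrightarrow> continuous F (\<lambda>x. transpose (f x) :: mat3)"
    by (rule bounded_linear.continuous)
qed

lemma field_f_continuous:
  assumes PQ: "(P, Q) \<in> state_space" "P \<noteq> Q"
  shows "continuous (at (P, Q) within state_space) (\<lambda>x. snd x ** \<omega>_f \<omega> x t)"
proof (rule continuous_transform_within)
  define E where "E x = transpose (snd x) ** fst x" for x :: "mat3 \<times> mat3"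
  have "norm (E (P, Q) - transpose (E (P, Q))) \<noteq> 0"
    using skew_part_nonzero[OF state_space_error(1,2)[OF PQ(1)] state_space_error(3)[OF PQ]] by (simp add: E_def)
  moreover have "continuous (at (P, Q) within state_space) E"
    unfolding E_def by (intro matmul.continuous continuous_transpose continuous_intros)
  ultimately show "continuous (at (P, Q) within state_space) (\<lambda>x. snd x ** (unit_skew_part (E x) + \<omega> t))"
    unfolding unit_skew_part_def
    by (intro matmul.continuous continuous_transpose continuous_intros) auto
  \<comment> \<open>Within half of the gap |Q - P| neither component can close the gap, so nearby
    states stay off the diagonal.\<close>
  show "0 < norm (Q - P) / 2" using PQ by simp
  show "(P, Q) \<in> state_space" by fact
  fix x assume x: "x \<in> state_space" "dist x (P, Q) < norm (Q - P) / 2"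
  obtain A B where AB: "x = (A, B)" by (cases x)
  have "norm (A - P) < norm (Q - P) / 2" "norm (B - Q) < norm (Q - P) / 2"
    using x(2) norm_fst_le[of "A - P" "B - Q"] norm_snd_le[of "B - Q" "A - P"]
    unfolding AB dist_norm by auto
  then have "norm ((A - P) - (B - Q)) < norm (Q - P)"
    using norm_triangle_ineq4[of "A - P" "B - Q"] by simp
  then have "A \<noteq> B" by auto
  then show "snd x ** (unit_skew_part (E x) + \<omega> t) = snd x ** \<omega>_f \<omega> x t"
    using \<omega>_f_off_diagonal[of A B] x(1) by (simp add: AB E_def)
qed

text \<open>Deleting a null set cannot remove the value at a continuity point, since points outside
  S come arbitrarily close to it. The centre z is kept apart from x so that the diagonal can use
  values at neighbouring states.\<close>

lemma filippov_approx_mem: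
  fixes f :: "mat3 \<times> mat3 \<Rightarrow> 'b::real_normed_vector"
  assumes x: "x \<in> state_space" "x \<in> ball z \<delta>" and S: "hausdorff_measure 6 S = 0"
    and cont: "continuous (at x within state_space) f"
  shows "f x \<in> closure (convex hull (f ` (ball z \<delta> \<inter> state_space - S)))"
  unfolding closure_approachable
proof (intro allI impI)
  fix e :: real assume "e > 0"
  then obtain d where d: "d > 0" "\<And>y. y \<in> state_space \<Longrightarrow> dist y x < d \<Longrightarrow> dist (f y) (f x) < e"
    using cont unfolding continuous_within_eps_delta by metis
  have "min d (\<delta> - dist z x) > 0" using x(2) d(1) by simp
  then obtain y where y: "y \<in> ball x (min d (\<delta> - dist z x))" "y \<in> state_space" "y \<notin> S"
    using state_space_null_complement_dense[OF x(1) S] by blast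
  have "y \<in> ball z \<delta>" using y(1) dist_triangle[of z y x] by simp
  then have "f y \<in> convex hull (f ` (ball z \<delta> \<inter> state_space - S))"
    using y by (intro hull_inc) auto
  moreover have "dist (f y) (f x) < e" using d(2)[OF y(2)] y(1) by (simp add: dist_commute)
  ultimately show "\<exists>v\<in>convex hull (f ` (ball z \<delta> \<inter> state_space - S)). dist v (f x) < e"
    by (intro bexI[of _ "f y"])
qed

text \<open>Upper bound on the regularisation, obtained with the empty exceptional set: a closed
  ball is closed and convex.\<close>

lemma filippov_subset_cball:
  assumes "v \<in> filippov 6 X f x t" "\<delta> > 0"
    and "\<And>y. y \<in> ball x \<delta> \<Longrightarrow> y \<in> X \<Longrightarrow> dist c (f y t) \<le> B"
  shows "dist c v \<le> B"
proof -
  have "v \<in> closure (convex hull ((\<lambda>y. f y t) ` (ball x \<delta> \<inter> X - {})))"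
    by (rule INT_D[OF INT_D[OF assms(1)[unfolded filippov_def]]])
      (use assms(2) hausdorff_measure_empty[of 6] in auto)
  also have "\<dots> \<subseteq> cball c B"
    using assms(3) by (intro closure_minimal hull_minimal) auto
  finally show ?thesis by simp
qed

lemma rhs_f_bounded:
  assumes "v \<in> rhs_f \<omega> x t"
  shows "norm v \<le> 1 + norm (\<omega> t)"
proof -
  have "dist 0 (snd y ** \<omega>_f \<omega> y t) \<le> 1 + norm (\<omega> t)" if "y \<in> state_space" for y
  proof -
    obtain A B where AB: "y = (A, B)" by (cases y)
    \<comment> \<open>Where the logarithm is 0 the factor 1 / 0 is 0, so the bound by 1 holds on the
      diagonal too.\<close>
    have "norm (\<omega>_f \<omega> (A, B) t) \<le> 1 + norm (\<omega> t)"
      unfolding \<omega>_f_def by (simp, rule norm_triangle_mono) auto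
    then show ?thesis
      using that norm_SO3_left[of B] by (auto simp: AB state_space_def)
  qed
  then have "dist 0 v \<le> 1 + norm (\<omega> t)"
    by (intro filippov_subset_cball[OF assms[unfolded rhs_f_def] zero_less_one])
  then show ?thesis by simp
qed

text \<open>States off the diagonal are continuity points of the field, so all values near such a
  state lie in arbitrarily small balls around its own value.\<close>

lemma rhs_f_off_diagonal:
  assumes PQ: "(P, Q) \<in> state_space" "P \<noteq> Q"
  shows "rhs_f \<omega> (P, Q) t = {Q ** \<omega>_f \<omega> (P, Q) t}"
proof
  note cont = field_f_continuous[OF PQ, of \<omega> t]
  show "{Q ** \<omega>_f \<omega> (P, Q) t} \<subseteq> rhs_f \<omega> (P, Q) t"
    using filippov_approx_mem[OF PQ(1) _ _ cont] unfolding rhs_f_def filippov_def by auto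
  show "rhs_f \<omega> (P, Q) t \<subseteq> {Q ** \<omega>_f \<omega> (P, Q) t}"
  proof
    fix v assume v: "v \<in> rhs_f \<omega> (P, Q) t"
    have "dist (Q ** \<omega>_f \<omega> (P, Q) t) v \<le> 0 + e" if e: "e > 0" for e
    proof -
      obtain d where d: "d > 0" "\<And>y. y \<in> state_space \<Longrightarrow> dist y (P, Q) < d \<Longrightarrow>
          dist (snd y ** \<omega>_f \<omega> y t) (snd (P, Q) ** \<omega>_f \<omega> (P, Q) t) < e"
        using cont e unfolding continuous_within_eps_delta by metis
      show ?thesis
      proof (rule filippov_subset_cball[OF v[unfolded rhs_f_def] d(1)])
        fix y assume "y \<in> ball (P, Q) d" "y \<in> state_space"
        then show "dist (Q ** \<omega>_f \<omega> (P, Q) t) (snd y ** \<omega>_f \<omega> y t) \<le> 0 + e"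
          using d(2)[of y] by (simp add: dist_commute)
      qed
    qed
    then have "dist (Q ** \<omega>_f \<omega> (P, Q) t) v \<le> 0" by (rule field_le_epsilon)
    then show "v \<in> {Q ** \<omega>_f \<omega> (P, Q) t}" by simp
  qed
qed

text \<open>On the diagonal, the values of the field at the two nearby states \<open>(P exp(\<plusminus>\<epsilon>K), P)\<close> average
  to \<open>P \<omega>(t)\<close>.\<close>

lemma rhs_f_diagonal:
  assumes P: "P \<in> SO3"
  shows "P ** \<omega> t \<in> rhs_f \<omega> (P, P) t"
  unfolding rhs_f_def filippov_def
proof (intro INT_I)
  fix \<delta> :: real and S assume "\<delta> \<in> {0<..}" and S: "S \<in> {S. S \<subseteq> state_space \<and> hausdorff_measure 6 S = 0}"
  define H where "H = closure (convex hull ((\<lambda>y. snd y ** \<omega>_f \<omega> y t) ` (ball (P, P) \<delta> \<inter> state_space - S)))"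
  obtain K where K: "unit_axis K" using ex_unit_axis by blast
  \<comment> \<open>The perturbed state is at distance at most 2 \<epsilon>: less than \<delta>, and
    at most 2, which is nonsingular because 4 < 8. Moreover \<epsilon> < pi makes sin \<epsilon>
    positive.\<close>
  define \<epsilon> where "\<epsilon> = min 1 (\<delta> / 4)"
  have \<epsilon>: "0 < \<epsilon>" "\<epsilon> \<le> 1" "2 * \<epsilon> < \<delta>" using \<open>\<delta> \<in> {0<..}\<close> by (auto simp: \<epsilon>_def min_def)
  have mem: "P ** ((1 / sqrt 2) *\<^sub>R K + \<omega> t) \<in> H" if K: "unit_axis K" for K
  proof -
    define R where "R = rodrigues \<epsilon> K"
    have R: "R \<in> SO3" unfolding R_def by (rule rodrigues_SO3[OF K])
    have "sin \<epsilon> > 0" using \<epsilon> pi_gt3 by (intro sin_gt_zero) auto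
    have tr: "3 - trace R = 4 * (sin (\<epsilon> / 2))\<^sup>2"
      using cos_double_sin[of "\<epsilon> / 2"] unfolding R_def trace_rodrigues[OF K] by simp
    have "sin (\<epsilon> / 2) \<le> \<epsilon> / 2" "0 \<le> sin (\<epsilon> / 2)"
      using \<epsilon> pi_gt3 sin_x_le_x[of "\<epsilon> / 2"] sin_ge_zero[of "\<epsilon> / 2"] by auto
    then have "(sin (\<epsilon> / 2))\<^sup>2 \<le> (\<epsilon> / 2)\<^sup>2" by (rule power_mono)
    then have "(norm (R - mat 1))\<^sup>2 \<le> 2 * \<epsilon>\<^sup>2"
      using norm_SO3_diff[OF R mat1_SO3] tr by (simp add: power_divide)
    also have "\<dots> \<le> (2 * \<epsilon>)\<^sup>2" by (simp add: power_mult_distrib)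
    finally have "norm (R - mat 1) \<le> 2 * \<epsilon>"
      by (rule power2_le_imp_le) (use \<epsilon>(1) in simp)
    then have n: "norm (P ** R - P) \<le> 2 * \<epsilon>"
      using norm_SO3_left[OF P, of "R - mat 1"] by (simp add: matmul_simps)
    have ball: "(P ** R, P) \<in> ball (P, P) \<delta>"
      using n \<epsilon>(3) by (simp add: dist_Pair_Pair dist_norm norm_minus_commute)
    have "norm (P ** R - P) * norm (P ** R - P) \<le> 2 * 2"
      using n \<epsilon>(2) by (intro mult_mono) auto
    then have X: "(P ** R, P) \<in> state_space"
      using P R by (simp add: state_space_iff SO3_mult norm_minus_commute power2_eq_square)
    have sk: "R - transpose R = (2 * sin \<epsilon>) *\<^sub>R K"
      unfolding R_def by (rule rodrigues_skew_part[OF K])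
    have "K \<noteq> 0" using K by (auto simp: unit_axis_def)
    then have "R \<noteq> mat 1" using sk \<open>sin \<epsilon> > 0\<close> by auto
    then have ne: "P ** R \<noteq> P" using SO3_cancel(2)[OF P, of R] SO3_transpose_mult[OF P] by auto
    have "unit_skew_part R = (1 / sqrt 2) *\<^sub>R K"
      unfolding unit_skew_part_def sk using \<open>sin \<epsilon> > 0\<close> K by (simp add: unit_axis_def)
    then have "P ** ((1 / sqrt 2) *\<^sub>R K + \<omega> t) = snd (P ** R, P) ** \<omega>_f \<omega> (P ** R, P) t"
      unfolding \<omega>_f_off_diagonal[OF X ne] using P by simp
    also have "\<dots> \<in> H"
      unfolding H_def using S
      by (intro filippov_approx_mem[OF X ball _ field_f_continuous[OF X ne]]) auto
    finally show ?thesis .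
  qed
  have "convex H" unfolding H_def by (intro convex_closure convex_convex_hull)
  then have "(1/2) *\<^sub>R (P ** ((1 / sqrt 2) *\<^sub>R K + \<omega> t)) + (1/2) *\<^sub>R (P ** ((1 / sqrt 2) *\<^sub>R (- K) + \<omega> t)) \<in> H"
    using mem[OF K] mem[OF unit_axis_minus[OF K]] by (intro convexD) auto
  also have "(1/2) *\<^sub>R (P ** ((1 / sqrt 2) *\<^sub>R K + \<omega> t)) + (1/2) *\<^sub>R (P ** ((1 / sqrt 2) *\<^sub>R (- K) + \<omega> t))
      = (1/2 + 1/2) *\<^sub>R (P ** \<omega> t)"
    unfolding scaleR_left_distrib by (simp add: matmul_simps algebra_simps)
  finally show "P ** \<omega> t \<in> closure (convex hull ((\<lambda>y. snd y ** \<omega>_f \<omega> y t) ` (ball (P, P) \<delta> \<inter> state_space - S)))"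
    unfolding H_def by simp
qed

section \<open>Linear differential equations with measurable coefficients\<close>

lemma negligible_uminus_image: "negligible (N :: real set) \<Longrightarrow> negligible (uminus ` N)"
  by (rule negligible_differentiable_image_negligible) (auto intro: differentiable_on_minus)

text \<open>Lebesgue differentiation is available for averages to the right of x. Applied also to
  the reflected function it supplies the left derivative. The null set comes from f alone and serves
  every base point a.\<close>

lemma indefinite_integral_has_vector_derivative_ae:
  fixes f :: "real \<Rightarrow> 'a::euclidean_space"
  assumes int: "\<And>a b. f integrable_on {a..b}"
  obtains N where "negligible N"
    "\<And>a x. a < x \<Longrightarrow> x \<notin> N \<Longrightarrow> ((\<lambda>t. integral {a..t} f) has_vector_derivative f x) (at x)"
proof -
  have quot: "norm (I - h *\<^sub>R c) \<le> e * h" if "norm (I /\<^sub>R h - c) < e" "h > 0" for I c :: 'a and h e :: real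
  proof -
    have "I - h *\<^sub>R c = h *\<^sub>R (I /\<^sub>R h - c)" using that(2) by (simp add: scaleR_diff_right)
    then have "norm (I - h *\<^sub>R c) = h * norm (I /\<^sub>R h - c)" using that(2) by simp
    also have "\<dots> \<le> h * e" using that by (intro mult_left_mono) auto
    finally show ?thesis by (simp add: mult.commute)
  qed
  have cb: "f integrable_on cbox a b" for a b using int by simp
  have cb': "(\<lambda>x. f (- x)) integrable_on cbox a b" for a b
    using int[of "-b" "-a"] Henstock_Kurzweil_Integration.integrable_reflect_real[of f "-a" "-b"] by simp
  obtain N1 where N1: "negligible N1" and R: "\<And>x e. x \<notin> N1 \<Longrightarrow> 0 < e \<Longrightarrow>
      \<exists>d>0. \<forall>h. 0 < h \<and> h < d \<longrightarrow> norm (integral (cbox x (x + h *\<^sub>R One)) f /\<^sub>R h ^ DIM(real) - f x) < e"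
    using integrable_ccontinuous_explicit[of f, OF cb] by blast
  obtain N2 where N2: "negligible N2" and L: "\<And>x e. x \<notin> N2 \<Longrightarrow> 0 < e \<Longrightarrow>
      \<exists>d>0. \<forall>h. 0 < h \<and> h < d \<longrightarrow>
        norm (integral (cbox x (x + h *\<^sub>R One)) (\<lambda>x. f (- x)) /\<^sub>R h ^ DIM(real) - f (- x)) < e"
    using integrable_ccontinuous_explicit[of "\<lambda>x. f (- x)", OF cb'] by blast
  show ?thesis
  proof (rule that[of "N1 \<union> uminus ` N2"])
    show "negligible (N1 \<union> uminus ` N2)" using N1 N2 negligible_uminus_image by simp
    fix a x assume "a < x" and x: "x \<notin> N1 \<union> uminus ` N2"
    then have "- x \<notin> N2" by force
    define F where "F t = integral {a..t} f" for t
    have diff: "F t - F s = integral {s..t} f" if "a \<le> s" "s \<le> t" for s t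
      using Henstock_Kurzweil_Integration.integral_combine[of a s t f] that int unfolding F_def by (simp add: algebra_simps)
    have "\<exists>d>0. \<forall>y. norm (y - x) < d \<longrightarrow> norm (F y - F x - (y - x) *\<^sub>R f x) \<le> e * norm (y - x)"
      if "e > 0" for e
    proof -
      obtain d1 where d1: "d1 > 0" "\<And>h. 0 < h \<Longrightarrow> h < d1 \<Longrightarrow> norm (integral {x..x + h} f /\<^sub>R h - f x) < e"
        using R[of x e] x \<open>e > 0\<close> by auto
      obtain d2 where d2: "d2 > 0" "\<And>h. 0 < h \<Longrightarrow> h < d2 \<Longrightarrow>
          norm (integral {- x..- x + h} (\<lambda>x. f (- x)) /\<^sub>R h - f x) < e"
        using L[OF \<open>- x \<notin> N2\<close> \<open>e > 0\<close>] by auto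
      have "norm (F y - F x - (y - x) *\<^sub>R f x) \<le> e * norm (y - x)"
        if y: "norm (y - x) < min (min d1 d2) (x - a)" for y
      proof -
        consider "y = x" | "y > x" | "y < x" by linarith
        then show ?thesis
        proof cases
          case 2
          then have "norm (integral {x..x + (y - x)} f /\<^sub>R (y - x) - f x) < e"
            using y by (intro d1(2)) auto
          from quot[OF this] 2 show ?thesis
            using diff[of x y] \<open>a < x\<close> by simp
        next
          case 3
          have "integral {- x..- x + (x - y)} (\<lambda>x. f (- x)) = integral {y..x} f"
            using Henstock_Kurzweil_Integration.integral_reflect_real[of x y f] by simp
          moreover have "norm (integral {- x..- x + (x - y)} (\<lambda>x. f (- x)) /\<^sub>R (x - y) - f x) < e"
            using y 3 by (intro d2(2)) auto
          ultimately have "norm (integral {y..x} f - (x - y) *\<^sub>R f x) \<le> e * (x - y)"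
            using quot[where I = "integral {y..x} f" and h = "x - y" and c = "f x" and e = e] 3 by simp
          moreover have "F x - F y = integral {y..x} f"
            using y 3 by (intro diff) auto
          then have "F y - F x - (y - x) *\<^sub>R f x = - (integral {y..x} f - (x - y) *\<^sub>R f x)"
            by (simp add: algebra_simps)
          ultimately show ?thesis
            using 3 by (simp only: norm_minus_cancel) simp
        qed simp
      qed
      then show ?thesis
        using d1(1) d2(1) \<open>a < x\<close> by (intro exI[of _ "min (min d1 d2) (x - a)"]) auto
    qed
    then show "((\<lambda>t. integral {a..t} f) has_vector_derivative f x) (at x)"
      unfolding F_def[symmetric] has_vector_derivative_def has_derivative_at_alt
      by (simp add: bounded_linear_scaleR_left)
  qed
qed

lemma integral_bounded_measurable:
  fixes f :: "real \<Rightarrow> 'a::euclidean_space"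
  assumes "f \<in> borel_measurable lebesgue" "\<And>x. norm (f x) \<le> C"
  shows "f integrable_on {a..b}"
    and "a \<le> b \<Longrightarrow> norm (integral {a..b} f) \<le> C * (b - a)"
    and "a \<le> s \<Longrightarrow> a \<le> t \<Longrightarrow> norm (integral {a..t} f - integral {a..s} f) \<le> C * \<bar>t - s\<bar>"
proof -
  have int: "f integrable_on {a..b}" for a b
    by (rule measurable_bounded_by_integrable_imp_integrable[where g = "\<lambda>x. C"])
      (use assms in \<open>auto intro: measurable_restrict_space1\<close>)
  then show "f integrable_on {a..b}" .
  have "0 \<le> C" using assms(2)[of 0] norm_ge_zero[of "f 0"] by linarith
  have bd: "norm (integral {a..b} f) \<le> C * (b - a)" if "a \<le> b" for a b
    using has_integral_bound[OF \<open>0 \<le> C\<close>, of f "integral {a..b} f" a b] int[of a b] assms(2) that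
    by (simp add: integrable_integral)
  then show "a \<le> b \<Longrightarrow> norm (integral {a..b} f) \<le> C * (b - a)" .
  have le: "norm (integral {a..t} f - integral {a..s} f) \<le> C * \<bar>t - s\<bar>" if "a \<le> s" "s \<le> t" for s t
  proof -
    have "integral {a..t} f - integral {a..s} f = integral {s..t} f"
      using Henstock_Kurzweil_Integration.integral_combine[of a s t f] that int[of a t]
      by (simp add: algebra_simps)
    then show ?thesis using bd[OF that(2)] that(2) by simp
  qed
  show "norm (integral {a..t} f - integral {a..s} f) \<le> C * \<bar>t - s\<bar>" if "a \<le> s" "a \<le> t"
    using le[of s t] le[of t s] that by (cases "s \<le> t") (auto simp: norm_minus_commute abs_minus_commute)
qed

lemma matmul_norm_bound:
  "\<exists>K>0. \<forall>(A::mat3) (B::mat3). norm (A ** B) \<le> norm A * norm B * K"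
  using matmul.pos_bounded .

text \<open>Picard iteration on the integral equation. The fixed point is differentiable almost
  everywhere by Lebesgue differentiation of its integrand.\<close>

lemma bounded_measurable_linear_ode:
  fixes \<omega> :: "real \<Rightarrow> mat3" and P :: mat3
  assumes meas: "\<omega> \<in> borel_measurable lebesgue" and bd: "\<And>t. norm (\<omega> t) \<le> B"
  obtains h U N L where "0 < h" "h \<le> 1" "U b = P" "negligible N"
    "\<forall>s\<in>{b..b + h}. \<forall>t\<in>{b..b + h}. dist (U s) (U t) \<le> L * \<bar>s - t\<bar>"
    "\<forall>t\<in>{b..b + h} - N. (U has_vector_derivative U t ** \<omega> t) (at t within {b..b + h})"
proof -
  have "0 \<le> B" using bd[of 0] norm_ge_zero[of "\<omega> 0"] by linarith
  obtain K where K0: "K > 0 \<and> (\<forall>(A::mat3) (B::mat3). norm (A ** B) \<le> norm A * norm B * K)"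
    using matmul_norm_bound ..
  have K: "K > 0" "norm (A ** B) \<le> norm A * norm B * K" for A B :: mat3
    using K0 by auto
  \<comment> \<open>Chosen so that the Picard map contracts by K B h \<le> 1/2; the summand 1 covers
    \<open>B = 0\<close> and gives \<open>h \<le> 1\<close>.\<close>
  define h where "h = 1 / (2 * (K * B + 1))"
  have KB: "0 \<le> K * B" using K \<open>0 \<le> B\<close> by simp
  then have h: "0 < h" "h \<le> 1" "K * B * h \<le> 1 / 2" by (auto simp: h_def field_simps)
  \<comment> \<open>Retraction of the line onto the interval. It turns curves on the interval into
    bounded continuous functions on the whole line, the complete space on which the contraction
    acts.\<close>
  define clamp where "clamp t = max b (min (b + h) t)" for t
  have clamp: "clamp t \<in> {b..b + h}" "\<bar>clamp s - clamp t\<bar> \<le> \<bar>s - t\<bar>" "t \<in> {b..b + h} \<Longrightarrow> clamp t = t" for s t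
    using h(1) by (auto simp: clamp_def)
  have prod: "(\<lambda>t. u t ** \<omega> t) \<in> borel_measurable lebesgue" "norm (u t ** \<omega> t) \<le> M * B * K"
    if "continuous_on UNIV u" "\<And>t. norm (u t) \<le> M" for u :: "real \<Rightarrow> mat3" and M t
  proof -
    have "u \<in> borel_measurable lebesgue"
      using borel_measurable_continuous_onI[OF that(1)] by (simp add: measurable_completion)
    then show "(\<lambda>t. u t ** \<omega> t) \<in> borel_measurable lebesgue"
      using borel_measurable_bilinear[of "(**)" u UNIV \<omega>] meas matmul.bounded_bilinear_axioms
      by (simp add: bilinear_conv_bounded_bilinear)
    have "0 \<le> M" using that(2)[of t] norm_ge_zero[of "u t"] by linarith
    then have "norm (u t) * norm (\<omega> t) * K \<le> M * B * K"
      using that(2)[of t] bd[of t] K(1) \<open>0 \<le> B\<close> by (intro mult_mono mult_right_mono) auto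
    then show "norm (u t ** \<omega> t) \<le> M * B * K" using K(2)[of "u t" "\<omega> t"] by simp
  qed
  define \<Phi> where "\<Phi> u t = P + integral {b..clamp t} (\<lambda>s. u s ** \<omega> s)" for u :: "real \<Rightarrow> mat3" and t
  have cont: "continuous_on UNIV (apply_bcontfun u)" for u :: "real \<Rightarrow>\<^sub>C mat3" by simp
  have bdd: "\<exists>M. \<forall>t. norm (apply_bcontfun u t) \<le> M" for u :: "real \<Rightarrow>\<^sub>C mat3"
    using bounded_apply_bcontfun[of u] by (auto simp: bounded_iff)
  have \<Phi>: "\<Phi> (apply_bcontfun u) \<in> bcontfun" for u
  proof -
    obtain M where M: "\<And>t. norm (apply_bcontfun u t) \<le> M" using bdd by blast
    note p = prod[OF cont M]
    have lip: "dist (\<Phi> u s) (\<Phi> u t) \<le> (M * B * K) * dist s t" for s t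
    proof -
      have MBK: "0 \<le> M * B * K" using order_trans[OF norm_ge_zero p(2)[of 0]] .
      have "dist (\<Phi> u s) (\<Phi> u t) \<le> (M * B * K) * \<bar>clamp s - clamp t\<bar>"
        using integral_bounded_measurable(3)[OF p, of b "clamp t" "clamp s"] clamp(1)[of s] clamp(1)[of t]
        by (simp add: \<Phi>_def dist_norm)
      also have "\<dots> \<le> (M * B * K) * \<bar>s - t\<bar>"
        using clamp(2) MBK by (intro mult_left_mono)
      finally show ?thesis by (simp add: dist_real_def)
    qed
    have "norm (\<Phi> u t) \<le> norm P + M * B * K * h" for t
    proof -
      have MBK: "0 \<le> M * B * K" using order_trans[OF norm_ge_zero p(2)[of 0]] .
      have "norm (\<Phi> u t) \<le> norm P + norm (integral {b..clamp t} (\<lambda>s. u s ** \<omega> s))"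
        unfolding \<Phi>_def by (rule norm_triangle_ineq)
      also have "\<dots> \<le> norm P + M * B * K * (clamp t - b)"
        using integral_bounded_measurable(2)[OF p, of b "clamp t"] clamp(1)[of t] by simp
      also have "\<dots> \<le> norm P + M * B * K * h"
        using clamp(1)[of t] MBK by (intro add_left_mono mult_left_mono) auto
      finally show ?thesis .
    qed
    then have "bounded (range (\<Phi> u))" by (auto simp: bounded_iff)
    moreover have "continuous_on UNIV (\<Phi> u)"
      unfolding continuous_on_iff
    proof (intro ballI allI impI)
      fix s :: real and e :: real assume "e > 0"
      define c where "c = \<bar>M * B * K\<bar> + 1"
      have "dist (\<Phi> u t) (\<Phi> u s) < e" if "dist t s < e / c" for t
      proof -
        have "dist (\<Phi> u t) (\<Phi> u s) \<le> c * dist t s"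
          by (rule order_trans[OF lip mult_right_mono]) (auto simp: c_def)
        also have "\<dots> < e" using that by (simp add: c_def field_simps)
        finally show ?thesis .
      qed
      moreover have "e / c > 0" using \<open>e > 0\<close> by (simp add: c_def)
      ultimately show "\<exists>d>0. \<forall>t\<in>UNIV. dist t s < d \<longrightarrow> dist (\<Phi> u t) (\<Phi> u s) < e" by blast
    qed
    ultimately show ?thesis by (simp add: bcontfun_def)
  qed
  define \<Psi> where "\<Psi> u = Bcontfun (\<Phi> (apply_bcontfun u))" for u
  have \<Psi>: "apply_bcontfun (\<Psi> u) = \<Phi> (apply_bcontfun u)" for u
    unfolding \<Psi>_def by (rule Bcontfun_inverse[OF \<Phi>])
  have "dist (\<Psi> u) (\<Psi> v) \<le> 1 / 2 * dist u v" for u v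
  proof (rule dist_bound)
    fix t
    obtain M where M: "\<And>t. norm (apply_bcontfun u t) \<le> M" using bdd by blast
    obtain M' where M': "\<And>t. norm (apply_bcontfun v t) \<le> M'" using bdd by blast
    have duv: "norm (apply_bcontfun u t - apply_bcontfun v t) \<le> dist u v" for t
      using dist_bounded[of u t v] by (simp add: dist_norm)
    have c: "continuous_on UNIV (\<lambda>t. apply_bcontfun u t - apply_bcontfun v t)"
      by (intro continuous_on_diff cont)
    note p = prod[OF c duv]
    have "dist (\<Phi> u t) (\<Phi> v t) = norm (integral {b..clamp t} (\<lambda>s. (u s - v s) ** \<omega> s))"
      unfolding \<Phi>_def dist_norm
      using integral_diff[OF integral_bounded_measurable(1)[OF prod[OF cont M]]
          integral_bounded_measurable(1)[OF prod[OF cont M']], of b "clamp t"]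
      by (simp add: matmul.diff_left)
    also have "\<dots> \<le> dist u v * B * K * (clamp t - b)"
      using integral_bounded_measurable(2)[OF p, of b "clamp t"] clamp(1)[of t] by simp
    also have "\<dots> \<le> dist u v * B * K * h"
      using clamp(1)[of t] \<open>0 \<le> B\<close> K(1) by (intro mult_left_mono) auto
    also have "\<dots> = dist u v * (K * B * h)" by simp
    also have "\<dots> \<le> dist u v * (1 / 2)" using h(3) by (intro mult_left_mono) auto
    finally show "dist (\<Psi> u t) (\<Psi> v t) \<le> 1 / 2 * dist u v" by (simp add: \<Psi>)
  qed
  then have "\<exists>!u. \<Psi> u = u" by (intro banach_fix_type[of "1/2"]) auto
  then obtain u where "\<Psi> u = u" by blast
  define U where "U = apply_bcontfun u"
  have U: "U t = P + integral {b..clamp t} (\<lambda>s. U s ** \<omega> s)" for t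
    using \<Psi>[of u] \<open>\<Psi> u = u\<close> unfolding U_def \<Phi>_def by metis
  obtain M where M: "\<And>t. norm (U t) \<le> M" using bdd U_def by blast
  have contU: "continuous_on UNIV U" unfolding U_def by (rule cont)
  note p = prod[OF contU M]
  obtain N where N: "negligible N" and der: "\<And>a x. a < x \<Longrightarrow> x \<notin> N \<Longrightarrow>
      ((\<lambda>t. integral {a..t} (\<lambda>s. U s ** \<omega> s)) has_vector_derivative U x ** \<omega> x) (at x)"
    using indefinite_integral_has_vector_derivative_ae[OF integral_bounded_measurable(1)[OF p]] by blast
  define I where "I t = integral {b..t} (\<lambda>s. U s ** \<omega> s)" for t
  have UI: "U t = P + I t" if "t \<in> {b..b + h}" for t
    using U[of t] unfolding I_def clamp(3)[OF that] .
  show ?thesis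
  \<comment> \<open>The base point b of the integral joins the null set, because differentiation is
    known only to the right of it.\<close>
  proof (rule that[where h = h and U = U and N = "insert b N" and L = "M * B * K"])
    show "0 < h" "h \<le> 1" by (fact h)+
    show "U b = P" using UI[of b] h(1) by (simp add: I_def)
    show "negligible (insert b N)" using N by simp
    show "\<forall>s\<in>{b..b + h}. \<forall>t\<in>{b..b + h}. dist (U s) (U t) \<le> (M * B * K) * \<bar>s - t\<bar>"
    proof (intro ballI)
      fix s t assume st: "s \<in> {b..b + h}" "t \<in> {b..b + h}"
      have "norm (I s - I t) \<le> (M * B * K) * \<bar>s - t\<bar>"
        using integral_bounded_measurable(3)[OF p, of b t s] st unfolding I_def by simp
      then show "dist (U s) (U t) \<le> (M * B * K) * \<bar>s - t\<bar>"
        unfolding UI[OF st(1)] UI[OF st(2)] dist_norm by simp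
    qed
    show "\<forall>t\<in>{b..b + h} - insert b N. (U has_vector_derivative U t ** \<omega> t) (at t within {b..b + h})"
    proof
      fix t assume t: "t \<in> {b..b + h} - insert b N"
      then have "(I has_vector_derivative U t ** \<omega> t) (at t within {b..b + h})"
        using der[of b t] unfolding I_def[abs_def] by (auto intro: has_vector_derivative_at_within)
      then have "((\<lambda>t. P + I t) has_vector_derivative U t ** \<omega> t) (at t within {b..b + h})"
        by (auto intro!: derivative_eq_intros)
      then show "(U has_vector_derivative U t ** \<omega> t) (at t within {b..b + h})"
        using t by (intro has_vector_derivative_transform[OF _ UI]) auto
    qed
  qed
qed

text \<open>For a skew coefficient \<open>U ** transpose U\<close> has derivative 0, so U stays
  orthogonal. Its determinant is then \<plusminus>1, and it is positive near b by continuity,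
  possibly on a shorter interval.\<close>

lemma linear_ode_SO3:
  fixes \<omega> :: "real \<Rightarrow> mat3"
  assumes so3: "\<And>t. t \<ge> 0 \<Longrightarrow> \<omega> t \<in> so3"
    and meas: "\<omega> \<in> borel_measurable (lebesgue_on {0..})"
    and bd: "\<And>T. \<exists>B. AE t in lebesgue_on {0..T}. norm (\<omega> t) \<le> B"
    and P: "P \<in> SO3" and "b \<ge> 0"
  obtains h U N L where "0 < h" "U b = P" "negligible N" "\<forall>t\<in>{b..b + h}. U t \<in> SO3"
    "\<forall>s\<in>{b..b + h}. \<forall>t\<in>{b..b + h}. dist (U s) (U t) \<le> L * \<bar>s - t\<bar>"
    "\<forall>t\<in>{b..b + h} - N. (U has_vector_derivative U t ** \<omega> t) (at t within {b..b + h})"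
proof -
  obtain B where "AE t in lebesgue_on {0..b + 1}. norm (\<omega> t) \<le> B"
    using bd[of "b + 1"] ..
  then have "\<exists>N. negligible N \<and> (\<forall>t\<in>{0..b + 1} - N. norm (\<omega> t) \<le> B)"
    by (subst (asm) AE_lebesgue_on_iff_negligible) auto
  then obtain N0 where N0': "negligible N0 \<and> (\<forall>t\<in>{0..b + 1} - N0. norm (\<omega> t) \<le> B)" ..
  then have N0: "negligible N0" "\<And>t. t \<in> {0..b + 1} - N0 \<Longrightarrow> norm (\<omega> t) \<le> B" by auto
  \<comment> \<open>Truncation makes the coefficient bounded and measurable on the whole line, and 0
    is skew as well.\<close>
  define w where "w t = (if t \<in> {0..} then (if norm (\<omega> t) \<le> B then \<omega> t else 0) else 0)" for t
  have "(\<lambda>t. if norm (\<omega> t) \<le> B then \<omega> t else 0) \<in> borel_measurable (lebesgue_on {0..})"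
    using meas by measurable
  then have w_meas: "w \<in> borel_measurable lebesgue"
    unfolding w_def by (subst borel_measurable_if) auto
  have w_bd: "norm (w t) \<le> max B 0" for t by (auto simp: w_def)
  obtain h U N L where h: "0 < h" "h \<le> 1" and U: "U b = P" "negligible N"
    "\<forall>s\<in>{b..b + h}. \<forall>t\<in>{b..b + h}. dist (U s) (U t) \<le> L * \<bar>s - t\<bar>"
    "\<forall>t\<in>{b..b + h} - N. (U has_vector_derivative U t ** w t) (at t within {b..b + h})"
    by (rule bounded_measurable_linear_ode[OF w_meas w_bd, of b P]) (rule that)
  \<comment> \<open>Here \<open>h \<le> 1\<close> matters: B is an essential bound up to time b + 1
    only.\<close>
  have w_eq: "w t = \<omega> t" if "t \<in> {b..b + h} - N0" for t
    using N0(2)[of t] that h \<open>b \<ge> 0\<close> by (auto simp: w_def)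
  have w_skew: "transpose (w t) = - w t" for t
  proof -
    have "transpose (0 :: mat3) = 0" by (simp add: transpose_def vec_eq_iff)
    then show ?thesis using so3[of t] by (auto simp: w_def so3_transpose)
  qed
  have U_cont: "continuous_on {b..b + h} U"
    by (intro absolutely_continuous_on_imp_continuous_on lipschitz_imp_absolutely_continuous_on)
      (rule U(3)[rule_format])
  obtain \<delta> where \<delta>: "0 < \<delta>" "\<delta> \<le> h" "\<And>t. t \<in> {b..b + \<delta>} \<Longrightarrow> det (U t) > 0"
  proof -
    have "continuous_on {b..b + h} (\<lambda>t. det (U t))"
      unfolding det_3 by (intro continuous_intros U_cont)
    moreover have "det (U b) = 1" using P U(1) by (simp add: SO3_def)
    ultimately have "\<exists>d>0. \<forall>t\<in>{b..b + h}. dist t b < d \<longrightarrow> dist (det (U t)) 1 < 1"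
      using h(1) unfolding continuous_on_iff
      by (metis atLeastAtMost_iff le_add_same_cancel1 less_imp_le order_refl zero_less_one)
    then obtain d where d: "d > 0" "\<And>t. t \<in> {b..b + h} \<Longrightarrow> dist t b < d \<Longrightarrow> dist (det (U t)) 1 < 1"
      by auto
    show ?thesis
    proof (rule that[of "min h (d / 2)"])
      fix t assume "t \<in> {b..b + min h (d / 2)}"
      then have "dist (det (U t)) 1 < 1" using d(1) by (intro d(2)) (auto simp: dist_real_def)
      then show "det (U t) > 0" by (simp add: dist_real_def)
    qed (use h d(1) in auto)
  qed
  have orth: "U t ** transpose (U t) = mat 1" if t: "t \<in> {b..b + h}" for t
  proof -
    define W where "W s = U s ** transpose (U s)" for s
    have "compact (U ` {b..t})"
      using t by (intro compact_continuous_image continuous_on_subset[OF U_cont]) auto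
    then obtain M where M: "\<And>s. s \<in> {b..t} \<Longrightarrow> norm (U s) \<le> M"
      by (meson bounded_iff compact_imp_bounded image_eqI)
    obtain K where K0: "K > 0 \<and> (\<forall>(A::mat3) (B::mat3). norm (A ** B) \<le> norm A * norm B * K)"
    using matmul_norm_bound ..
  have K: "K > 0" "norm (A ** B) \<le> norm A * norm B * K" for A B :: mat3
    using K0 by auto
    have ac: "absolutely_continuous_on {b..t} U"
      by (rule lipschitz_imp_absolutely_continuous_on[OF U(3)[rule_format]]) (use t in auto)
    have acW: "absolutely_continuous_on {b..t} W"
    proof (rule absolutely_continuous_on_dominated[OF ac])
      fix x y assume xy: "x \<in> {b..t}" "y \<in> {b..t}"
      have "W x - W y = (U x - U y) ** transpose (U x) + U y ** transpose (U x - U y)"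
        unfolding W_def by (simp add: matmul_simps transpose_linear_simps)
      then have "norm (W x - W y) \<le> norm (U x - U y) * norm (U x) * K + norm (U y) * norm (U x - U y) * K"
        by (metis K(2) norm_transpose norm_triangle_mono)
      also have "\<dots> \<le> norm (U x - U y) * M * K + M * norm (U x - U y) * K"
        using M xy K(1) by (intro add_mono mult_right_mono mult_left_mono) auto
      finally show "dist (W x) (W y) \<le> (2 * M * K) * dist (U x) (U y)"
        by (simp add: dist_norm algebra_simps)
    qed
    have "norm (W t - W b) \<le> 0 * (t - b)"
    proof (rule absolutely_continuous_on_norm_le[OF acW _ U(2)])
      fix s assume s: "s \<in> {b..t} - N"
      have dU: "(U has_vector_derivative U s ** w s) (at s within {b..t})"
        by (rule has_vector_derivative_within_subset[OF U(4)[rule_format]]) (use s t in auto)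
      have bl: "bounded_linear (transpose :: mat3 \<Rightarrow> mat3)"
        unfolding linear_conv_bounded_linear[symmetric] by (rule linearI) (simp_all add: transpose_linear_simps)
      have "(W has_vector_derivative U s ** transpose (U s ** w s) + (U s ** w s) ** transpose (U s)) (at s within {b..t})"
        unfolding W_def
        by (rule matmul.has_vector_derivative[OF dU bounded_linear.has_vector_derivative[OF bl dU]])
      moreover have "U s ** transpose (U s ** w s) + (U s ** w s) ** transpose (U s) = 0"
        by (simp add: matrix_transpose_mul w_skew matmul_simps matrix_mul_assoc)
      ultimately show "\<exists>D. (W has_vector_derivative D) (at s within {b..t}) \<and> norm D \<le> 0"
        by (intro exI[of _ 0]) simp
    qed (use t in auto)
    then show ?thesis unfolding W_def U(1) using SO3_mult_transpose[OF P] by simp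
  qed
  show ?thesis
  proof (rule that[where h = \<delta> and U = U and N = "N \<union> N0" and L = L])
    show "0 < \<delta>" "U b = P" by (fact \<delta>(1) U(1))+
    show "negligible (N \<union> N0)" using U(2) N0(1) by simp
    show "\<forall>t\<in>{b..b + \<delta>}. U t \<in> SO3"
    proof
      fix t assume t: "t \<in> {b..b + \<delta>}"
      have o: "U t ** transpose (U t) = mat 1" using t \<delta>(2) by (intro orth) auto
      then have "det (U t) * det (U t) = 1" by (metis det_I det_mul det_transpose)
      then have "det (U t) = 1" using \<delta>(3)[OF t] by (metis abs_mult_self_eq abs_of_pos abs_square_eq_1 power2_eq_square)
      with o show "U t \<in> SO3" by (simp add: SO3_def)
    qed
    show "\<forall>s\<in>{b..b + \<delta>}. \<forall>t\<in>{b..b + \<delta>}. dist (U s) (U t) \<le> L * \<bar>s - t\<bar>"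
      using U(3) \<delta>(2) by auto
    show "\<forall>t\<in>{b..b + \<delta>} - (N \<union> N0). (U has_vector_derivative U t ** \<omega> t) (at t within {b..b + \<delta>})"
    proof
      fix t assume t: "t \<in> {b..b + \<delta>} - (N \<union> N0)"
      have "(U has_vector_derivative U t ** w t) (at t within {b..b + \<delta>})"
        by (rule has_vector_derivative_within_subset[OF U(4)[rule_format]]) (use t \<delta>(2) in auto)
      then show "(U has_vector_derivative U t ** \<omega> t) (at t within {b..b + \<delta>})"
        using w_eq[of t] t \<delta>(2) by auto
    qed
  qed
qed

section \<open>Local solutions\<close>

text \<open>For gluing: away from the junction, both the curve and the interval of differentiation
  are exchanged without changing the derivative.\<close>

lemma has_vector_derivative_agree_on_open:
  fixes f g :: "real \<Rightarrow> 'a::real_normed_vector"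
  assumes "open T" "t \<in> T" "t \<in> J" and T: "T \<inter> J = T \<inter> J'"
    and eq: "\<And>s. s \<in> T \<Longrightarrow> s \<in> J \<Longrightarrow> f s = g s"
    and der: "(f has_vector_derivative D) (at t within J)"
  shows "(g has_vector_derivative D) (at t within J')"
proof -
  have "at t within J = at t within J'"
    by (rule at_within_nhd[OF \<open>t \<in> T\<close> \<open>open T\<close>]) (use T in blast)
  with der have der': "(f has_vector_derivative D) (at t within J')" by simp
  obtain d where d: "d > 0" "ball t d \<subseteq> T" using \<open>open T\<close> \<open>t \<in> T\<close> openE by blast
  show ?thesis
  proof (rule has_vector_derivative_transform_within[OF der' d(1)])
    show "t \<in> J'" using assms by blast
    fix s assume "s \<in> J'" "dist s t < d"
    then have "s \<in> T" using d(2) by (auto simp: dist_commute)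
    with \<open>s \<in> J'\<close> T show "f s = g s" by (intro eq) auto
  qed
qed

text \<open>The left factor does not touch the right multiplication by w, so the common velocity
  passes through. The axis K, fixed in space, appears in the moving frame as \<plusminus>K'; along
  it the error has logarithm \<theta> K' and the relative angular velocity is -\<theta>' K'. A
  feedback law thus becomes a scalar equation for \<theta>.\<close>

lemma rodrigues_rotated_curve:
  fixes U :: "real \<Rightarrow> mat3" and b h :: real
  defines "I \<equiv> {b..b + h}"
  assumes K: "unit_axis K"
    and U: "\<forall>t\<in>I. U t \<in> SO3" "\<forall>s\<in>I. \<forall>t\<in>I. dist (U s) (U t) \<le> L * \<bar>s - t\<bar>"
    and \<theta>: "\<forall>t\<in>I. (\<theta> has_real_derivative \<theta>' t) (at t within I)"
      "\<forall>t\<in>I. \<bar>\<theta>' t\<bar> \<le> M" "\<forall>t\<in>I. 0 \<le> \<theta> t \<and> \<theta> t < pi"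
  shows "\<exists>L. \<forall>s\<in>I. \<forall>t\<in>I. dist (rodrigues (\<theta> s) K ** U s) (rodrigues (\<theta> t) K ** U t) \<le> L * \<bar>s - t\<bar>"
    and "t \<in> I \<Longrightarrow> (U t, rodrigues (\<theta> t) K ** U t) \<in> state_space"
    and "t \<in> I \<Longrightarrow> \<exists>K'. unit_axis K' \<and> rot_log (transpose (rodrigues (\<theta> t) K ** U t) ** U t) = \<theta> t *\<^sub>R K' \<and>
      (\<forall>w. (U has_vector_derivative U t ** w) (at t within I) \<longrightarrow>
        ((\<lambda>t. rodrigues (\<theta> t) K ** U t) has_vector_derivative
          (rodrigues (\<theta> t) K ** U t) ** ((- \<theta>' t) *\<^sub>R K' + w)) (at t within I))"
proof -
  define G where "G t = rodrigues (\<theta> t) K" for t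
  have G: "G t \<in> SO3" for t unfolding G_def by (rule rodrigues_SO3[OF K])
  have dG: "(G has_vector_derivative \<theta>' t *\<^sub>R (G t ** K)) (at t within I)" if "t \<in> I" for t
    unfolding G_def by (rule rodrigues_has_vector_derivative[OF K \<theta>(1)[rule_format, OF that]])
  have lipG: "norm (G s - G t) \<le> (M * sqrt 2) * norm (s - t)" if st: "s \<in> I" "t \<in> I" for s t
  proof (rule differentiable_bound[where S = I])
    show "convex I" by (simp add: I_def)
    fix x assume x: "x \<in> I"
    show "(G has_derivative (\<lambda>h. h *\<^sub>R (\<theta>' x *\<^sub>R (G x ** K)))) (at x within I)"
      using dG[OF x] by (simp add: has_vector_derivative_def)
    have "norm (\<theta>' x *\<^sub>R (G x ** K)) \<le> M * sqrt 2"
      using \<theta>(2)[rule_format, OF x] K by (simp add: norm_SO3_left[OF G] unit_axis_def mult_right_mono)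
    then show "onorm (\<lambda>h. h *\<^sub>R (\<theta>' x *\<^sub>R (G x ** K))) \<le> M * sqrt 2"
      by (intro onorm_le) (simp only: norm_scaleR real_norm_def, metis mult.commute mult_left_mono abs_ge_zero)
  qed (use st in auto)
  have "dist (G s ** U s) (G t ** U t) \<le> (M * sqrt 2 + L) * \<bar>s - t\<bar>" if st: "s \<in> I" "t \<in> I" for s t
  proof -
    have eq: "G s ** U s - G t ** U t = (G s - G t) ** U s + G t ** (U s - U t)"
      by (simp add: matmul_simps)
    have "norm (G s ** U s - G t ** U t) \<le> norm ((G s - G t) ** U s) + norm (G t ** (U s - U t))"
      unfolding eq by (rule norm_triangle_ineq)
    also have "\<dots> = norm (G s - G t) + norm (U s - U t)"
      using U(1) st by (simp add: norm_SO3_left[OF G] norm_SO3_right)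
    also have "\<dots> \<le> M * sqrt 2 * \<bar>s - t\<bar> + L * \<bar>s - t\<bar>"
      using lipG[OF st] U(2) st by (intro add_mono) (auto simp: dist_norm)
    finally show ?thesis by (simp add: dist_norm algebra_simps)
  qed
  then show "\<exists>L. \<forall>s\<in>I. \<forall>t\<in>I. dist (rodrigues (\<theta> s) K ** U s) (rodrigues (\<theta> t) K ** U t) \<le> L * \<bar>s - t\<bar>"
    unfolding G_def by blast
  assume t: "t \<in> I"
  have Ut: "U t \<in> SO3" using U(1) t by blast
  show "(U t, rodrigues (\<theta> t) K ** U t) \<in> state_space"
  proof -
    have "cos pi < cos (\<theta> t)" using \<theta>(3)[rule_format, OF t] by (intro cos_monotone_0_pi) auto
    then have "(norm (G t - mat 1))\<^sup>2 < 8"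
      using norm_SO3_diff[OF G mat1_SO3, of t] trace_rodrigues[OF K, of "\<theta> t"] by (simp add: G_def)
    moreover have "G t ** U t - U t = (G t - mat 1) ** U t" by (simp add: matmul_simps)
    ultimately have "(norm (G t ** U t - U t))\<^sup>2 < 8" using norm_SO3_right[OF Ut] by simp
    then show ?thesis
      unfolding state_space_iff G_def[symmetric] using Ut G by (simp add: SO3_mult)
  qed
  \<comment> \<open>The sign is negative because the error
    \<open>transpose (G t ** U t) ** U t\<close> is conjugate to the inverse of
    \<open>G t\<close>.\<close>
  define K' where "K' = transpose (U t) ** (- K) ** U t"
  have K': "unit_axis K'"
    unfolding K'_def by (rule unit_axis_conjugate[OF unit_axis_minus[OF K] Ut])
  have "transpose (G t ** U t) ** U t = transpose (U t) ** transpose (G t) ** U t"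
    by (simp add: matrix_transpose_mul)
  also have "\<dots> = rodrigues (\<theta> t) K'"
    unfolding G_def transpose_rodrigues[OF K] K'_def by (rule rodrigues_conjugate[OF Ut, symmetric])
  finally have log: "rot_log (transpose (G t ** U t) ** U t) = \<theta> t *\<^sub>R K'"
    using rot_log_rodrigues[OF K'] \<theta>(3)[rule_format, OF t] by simp
  have "((\<lambda>t. G t ** U t) has_vector_derivative (G t ** U t) ** ((- \<theta>' t) *\<^sub>R K' + w)) (at t within I)"
    if w: "(U has_vector_derivative U t ** w) (at t within I)" for w
  proof -
    have "(G t ** U t) ** ((- \<theta>' t) *\<^sub>R K' + w) = G t ** (U t ** w) + (\<theta>' t *\<^sub>R (G t ** K)) ** U t"
    proof -
      have "G t ** U t ** K' = - (G t ** K ** U t)"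
        unfolding K'_def using Ut by (simp add: matmul_simps matrix_mul_assoc)
      then show ?thesis by (simp add: matmul_simps matrix_mul_assoc)
    qed
    then show ?thesis
      using matmul.has_vector_derivative[OF dG[OF t] w] by simp
  qed
  then show "\<exists>K'. unit_axis K' \<and> rot_log (transpose (rodrigues (\<theta> t) K ** U t) ** U t) = \<theta> t *\<^sub>R K' \<and>
      (\<forall>w. (U has_vector_derivative U t ** w) (at t within I) \<longrightarrow>
        ((\<lambda>t. rodrigues (\<theta> t) K ** U t) has_vector_derivative
          (rodrigues (\<theta> t) K ** U t) ** ((- \<theta>' t) *\<^sub>R K' + w)) (at t within I))"
    using K' log unfolding G_def by blast
qed

text \<open>Lipschitz pieces are required rather than absolutely continuous ones, since they
  concatenate directly with the Lipschitz extension of a given solution.\<close>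

definition local_solution ::
  "(real \<Rightarrow> mat3) \<Rightarrow> (mat3 \<times> mat3 \<Rightarrow> real \<Rightarrow> mat3 set) \<Rightarrow> real \<Rightarrow> real \<Rightarrow>
     (real \<Rightarrow> mat3) \<Rightarrow> (real \<Rightarrow> mat3) \<Rightarrow> bool" where
  "local_solution \<omega> F b h S\<^sub>r S\<^sub>1 \<longleftrightarrow>
     (\<exists>L. \<forall>s\<in>{b..b + h}. \<forall>t\<in>{b..b + h}. dist (S\<^sub>r s) (S\<^sub>r t) \<le> L * \<bar>s - t\<bar>) \<and>
     (\<exists>L. \<forall>s\<in>{b..b + h}. \<forall>t\<in>{b..b + h}. dist (S\<^sub>1 s) (S\<^sub>1 t) \<le> L * \<bar>s - t\<bar>) \<and>
     (\<forall>t\<in>{b..b + h}. (S\<^sub>r t, S\<^sub>1 t) \<in> state_space) \<and>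
     (\<exists>N. negligible N \<and> (\<forall>t\<in>{b..b + h} - N.
        (S\<^sub>r has_vector_derivative S\<^sub>r t ** \<omega> t) (at t within {b..b + h}) \<and>
        (\<exists>v\<in>F (S\<^sub>r t, S\<^sub>1 t) t. (S\<^sub>1 has_vector_derivative v) (at t within {b..b + h}))))"

text \<open>\<open>R\<^sub>r\<close> follows the linear equation, and \<open>R\<^sub>1\<close> is
  \<open>R\<^sub>r\<close> turned by an angle solving the scalar equation of the feedback. The
  second law on the diagonal is separate: there the two curves move together.\<close>

lemma ex_local_solution:
  fixes \<omega> :: "real \<Rightarrow> mat3"
  assumes so3: "\<And>t. t \<ge> 0 \<Longrightarrow> \<omega> t \<in> so3"
    and meas: "\<omega> \<in> borel_measurable (lebesgue_on {0..})"
    and bd: "\<And>T. \<exists>B. AE t in lebesgue_on {0..T}. norm (\<omega> t) \<le> B"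
    and F: "F \<in> {rhs_a \<omega>, rhs_f \<omega>}"
    and PQ: "(P, Q) \<in> state_space" and "b \<ge> 0"
  shows "\<exists>h>0. \<exists>S\<^sub>r S\<^sub>1. S\<^sub>r b = P \<and> S\<^sub>1 b = Q \<and> local_solution \<omega> F b h S\<^sub>r S\<^sub>1"
proof -
  have SO: "P \<in> SO3" "Q \<in> SO3" using PQ by (auto simp: state_space_def)
  obtain h0 U N L where h0: "0 < h0" and Ub: "U b = P" and N: "negligible N"
    and U: "\<forall>t\<in>{b..b + h0}. U t \<in> SO3"
      "\<forall>s\<in>{b..b + h0}. \<forall>t\<in>{b..b + h0}. dist (U s) (U t) \<le> L * \<bar>s - t\<bar>"
      "\<forall>t\<in>{b..b + h0} - N. (U has_vector_derivative U t ** \<omega> t) (at t within {b..b + h0})"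
    by (rule linear_ode_SO3[OF so3 meas bd SO(1) \<open>b \<ge> 0\<close>], assumption, rule that)
  show ?thesis
  proof (cases "F = rhs_f \<omega> \<and> P = Q")
    case True
    have "local_solution \<omega> F b h0 U U"
      unfolding local_solution_def
    proof (intro conjI exI[of _ L] exI[of _ N] ballI)
      show "(U t, U t) \<in> state_space" if "t \<in> {b..b + h0}" for t
        using U(1) that by (simp add: state_space_iff)
      show "(U has_vector_derivative U t ** \<omega> t) (at t within {b..b + h0})" if "t \<in> {b..b + h0} - N" for t
        using U(3) that by blast
      show "\<exists>v\<in>F (U t, U t) t. (U has_vector_derivative v) (at t within {b..b + h0})"
        if t: "t \<in> {b..b + h0} - N" for t
      proof
        show "U t ** \<omega> t \<in> F (U t, U t) t" using rhs_f_diagonal U(1) t True by auto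
        show "(U has_vector_derivative U t ** \<omega> t) (at t within {b..b + h0})" using U(3) t by blast
      qed
    qed (use U N in auto)
    then show ?thesis using h0 Ub True by blast
  next
    case False
    define R0 where "R0 = Q ** transpose P"
    have R0: "R0 \<in> SO3" unfolding R0_def using SO by (simp add: SO3_mult SO3_transpose)
    have "trace R0 = trace (transpose P ** Q)" unfolding R0_def by (rule trace_matmul_commute)
    also have "\<dots> = trace (transpose Q ** P)"
      by (metis matrix_transpose_mul trace_transpose transpose_transpose)
    finally have tr: "trace R0 \<noteq> -1" using state_space_error(2)[OF PQ] by simp
    obtain K where K: "unit_axis K" and RK: "R0 = rodrigues (rot_angle R0) K"
      using SO3_eq_rodrigues[OF R0 tr] .
    define \<theta>0 where "\<theta>0 = rot_angle R0"
    have \<theta>0: "0 \<le> \<theta>0" "\<theta>0 < pi"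
      unfolding \<theta>0_def using rot_angle_bounds(1)[OF R0] rot_angle_less_pi[OF R0 tr] by auto
    have \<theta>0_pos: "0 < \<theta>0" if "P \<noteq> Q"
    proof (rule ccontr)
      assume "\<not> 0 < \<theta>0"
      then have "rot_angle R0 = 0" using \<theta>0 by (simp add: \<theta>0_def)
      then have "Q ** transpose P ** P = P" using rot_angle_eq_0[OF R0] by (simp add: R0_def)
      then show False using SO3_cancel(4)[OF SO(1), of Q] that by simp
    qed
    have "rodrigues \<theta>0 K = R0"
      unfolding \<theta>0_def by (rule RK[symmetric])
    then have Q: "rodrigues \<theta>0 K ** U b = Q"
      using SO3_cancel(4)[OF SO(1), of Q] by (simp add: Ub R0_def)
    \<comment> \<open>The premise \<open>mem\<close> is the scalar equation: -\<theta>' K' must be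
      the feedback at an error with logarithm \<theta> K'.\<close>
    have restrict: "local_solution \<omega> F b h U (\<lambda>t. rodrigues (\<theta> t) K ** U t)"
      if h: "h \<le> h0"
        and \<theta>: "\<And>t. t \<in> {b..b + h} \<Longrightarrow> (\<theta> has_real_derivative \<theta>' t) (at t within {b..b + h})"
          "\<And>t. t \<in> {b..b + h} \<Longrightarrow> \<bar>\<theta>' t\<bar> \<le> M" "\<And>t. t \<in> {b..b + h} \<Longrightarrow> 0 \<le> \<theta> t \<and> \<theta> t < pi"
        and mem: "\<And>t R K'. t \<in> {b..b + h} \<Longrightarrow> (U t, R) \<in> state_space \<Longrightarrow> unit_axis K' \<Longrightarrow>
          rot_log (transpose R ** U t) = \<theta> t *\<^sub>R K' \<Longrightarrow> R ** ((- \<theta>' t) *\<^sub>R K' + \<omega> t) \<in> F (U t, R) t"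
      for h \<theta> \<theta>' M
    proof -
      have Uh: "\<forall>t\<in>{b..b + h}. U t \<in> SO3"
        "\<forall>s\<in>{b..b + h}. \<forall>t\<in>{b..b + h}. dist (U s) (U t) \<le> L * \<bar>s - t\<bar>"
        using U(1,2) h by auto
      have \<theta>': "\<forall>t\<in>{b..b + h}. (\<theta> has_real_derivative \<theta>' t) (at t within {b..b + h})"
        "\<forall>t\<in>{b..b + h}. \<bar>\<theta>' t\<bar> \<le> M" "\<forall>t\<in>{b..b + h}. 0 \<le> \<theta> t \<and> \<theta> t < pi"
        using \<theta> by simp_all
      note rc = rodrigues_rotated_curve[OF K Uh \<theta>']
      have dU: "(U has_vector_derivative U t ** \<omega> t) (at t within {b..b + h})" if "t \<in> {b..b + h} - N" for t
        by (rule has_vector_derivative_within_subset[OF U(3)[rule_format]]) (use that h in auto)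
      show ?thesis
        unfolding local_solution_def
      proof (intro conjI exI[of _ N] ballI)
        fix t assume t: "t \<in> {b..b + h} - N"
        then have t': "t \<in> {b..b + h}" by blast
        show "(U has_vector_derivative U t ** \<omega> t) (at t within {b..b + h})" using dU t by blast
        show "\<exists>v\<in>F (U t, rodrigues (\<theta> t) K ** U t) t.
            ((\<lambda>t. rodrigues (\<theta> t) K ** U t) has_vector_derivative v) (at t within {b..b + h})"
          using rc(3)[OF t'] mem[OF t' rc(2)[OF t']] dU[OF t] by blast
      next
        show "\<exists>L. \<forall>s\<in>{b..b + h}. \<forall>t\<in>{b..b + h}. dist (U s) (U t) \<le> L * \<bar>s - t\<bar>"
          using Uh(2) by blast
      qed (use rc(1,2) N in auto)
    qed
    consider "F = rhs_a \<omega>" | "F = rhs_f \<omega>" "P \<noteq> Q" using F False by blast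
    then show ?thesis
    proof cases
      case 1
      \<comment> \<open>The feedback equals \<theta> K', so \<theta>' = -\<theta>; the angle
        \<theta>0 = 0 is included.\<close>
      define \<theta> where "\<theta> t = \<theta>0 * exp (b - t)" for t
      have "local_solution \<omega> F b h0 U (\<lambda>t. rodrigues (\<theta> t) K ** U t)"
      proof (rule restrict[where \<theta>' = "\<lambda>t. - \<theta> t" and M = pi])
        show "(\<theta> has_real_derivative - \<theta> t) (at t within {b..b + h0})" for t
          unfolding \<theta>_def by (auto intro!: derivative_eq_intros)
        show bnd: "0 \<le> \<theta> t \<and> \<theta> t < pi" if "t \<in> {b..b + h0}" for t
        proof -
          have "\<theta>0 * exp (b - t) \<le> \<theta>0 * 1" using that \<theta>0 by (intro mult_left_mono) auto
          then show ?thesis using \<theta>0 by (simp add: \<theta>_def)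
        qed
        show "\<bar>- \<theta> t\<bar> \<le> pi" if "t \<in> {b..b + h0}" for t using bnd[OF that] by simp
        show "R ** (- (- \<theta> t) *\<^sub>R K' + \<omega> t) \<in> F (U t, R) t"
          if "(U t, R) \<in> state_space" "rot_log (transpose R ** U t) = \<theta> t *\<^sub>R K'" for t R K'
          using that state_space_error(4)[OF that(1)] by (simp add: 1 rhs_a_def \<omega>_a_def)
      qed simp
      moreover have "rodrigues (\<theta> b) K ** U b = Q" using Q by (simp add: \<theta>_def)
      ultimately show ?thesis using h0 Ub
        by - (rule exI[of _ h0], rule conjI, assumption, rule exI[of _ U],
          rule exI[of _ "\<lambda>t. rodrigues (\<theta> t) K ** U t"], simp)
    next
      case 2
      note pos = \<theta>0_pos[OF 2(2)]
      \<comment> \<open>The angle falls at rate 1 / sqrt 2 < 1, so it is still positive after time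
        \<theta>0 / 2 and the curve stays off the diagonal.\<close>
      define h where "h = min h0 (\<theta>0 / 2)"
      have h: "0 < h" "h \<le> h0" "h \<le> \<theta>0 / 2" using h0 pos by (auto simp: h_def)
      define \<theta> where "\<theta> t = \<theta>0 - (t - b) / sqrt 2" for t
      have bnd: "0 < \<theta> t \<and> \<theta> t < pi" if "t \<in> {b..b + h}" for t
      proof -
        have "(t - b) / sqrt 2 \<le> (t - b) / 1" using that by (intro divide_left_mono) auto
        moreover have "(t - b) / sqrt 2 \<ge> 0" using that by simp
        ultimately show ?thesis using that h(3) pos \<theta>0 by (auto simp: \<theta>_def)
      qed
      have "local_solution \<omega> F b h U (\<lambda>t. rodrigues (\<theta> t) K ** U t)"
      proof (rule restrict[where \<theta>' = "\<lambda>t. - (1 / sqrt 2)" and M = 1])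
        show "(\<theta> has_real_derivative - (1 / sqrt 2)) (at t within {b..b + h})" for t
          unfolding \<theta>_def by (auto intro!: derivative_eq_intros simp: real_div_sqrt)
        show "0 \<le> \<theta> t \<and> \<theta> t < pi" if "t \<in> {b..b + h}" for t using bnd[OF that] by simp
        show "R ** (- (- (1 / sqrt 2)) *\<^sub>R K' + \<omega> t) \<in> F (U t, R) t"
          if t: "t \<in> {b..b + h}" and X: "(U t, R) \<in> state_space" and K': "unit_axis K'"
            and log: "rot_log (transpose R ** U t) = \<theta> t *\<^sub>R K'" for t R K'
        proof -
          have "norm (\<theta> t *\<^sub>R K') > 0" using bnd[OF t] K' by (simp add: unit_axis_def)
          moreover have "rot_log (mat 1) = 0"
            using rot_angle_eq_0[OF mat1_SO3] by (simp add: rot_log_def Let_def)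
          ultimately have ne: "U t \<noteq> R"
            using log SO3_transpose_mult X by (force simp: state_space_iff)
          have "(1 / norm (\<theta> t *\<^sub>R K')) *\<^sub>R \<theta> t *\<^sub>R K' = (1 / sqrt 2) *\<^sub>R K'"
            using bnd[OF t] K' by (simp add: unit_axis_def)
          then have "\<omega>_f \<omega> (U t, R) t = (1 / sqrt 2) *\<^sub>R K' + \<omega> t"
            by (simp only: \<omega>_f_def prod.case state_space_error(4)[OF X] log)
          then show ?thesis
            unfolding 2(1) rhs_f_off_diagonal[OF X ne] by simp
        qed
      qed (use h in auto)
      moreover have "rodrigues (\<theta> b) K ** U b = Q" using Q by (simp add: \<theta>_def)
      ultimately show ?thesis using h(1) Ub
        by - (rule exI[of _ h], rule conjI, assumption, rule exI[of _ U],
          rule exI[of _ "\<lambda>t. rodrigues (\<theta> t) K ** U t"], simp)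
    qed
  qed
qed

section \<open>The Lyapunov function\<close>

text \<open>The a priori bounds shared by both feedbacks: a speed bound, and half of V' being
  nonpositive. The constant 6 exceeds sqrt 2 pi, which bounds the norm of the logarithm.\<close>

definition dissipative :: "(real \<Rightarrow> mat3) \<Rightarrow> (mat3 \<times> mat3 \<Rightarrow> real \<Rightarrow> mat3 set) \<Rightarrow> bool" where
  "dissipative \<omega> F \<longleftrightarrow> (\<forall>P Q t. \<forall>v\<in>F (P, Q) t. (P, Q) \<in> state_space \<longrightarrow> \<omega> t \<in> so3 \<longrightarrow>
      norm v \<le> 6 + norm (\<omega> t) \<and> inner (Q - P) (v - P ** \<omega> t) \<le> 0)"

lemma inner_skew:
  fixes A B :: mat3
  assumes "transpose A = - A"
  shows "inner (B ** A) B = 0" "inner (mat 1) A = 0"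
proof -
  have "inner (B ** A) B = - inner B (B ** A)"
    using inner_matmul_right[of B A B] assms by (simp add: matmul.minus_right)
  then show "inner (B ** A) B = 0" by (simp add: inner_commute)
  show "inner (mat 1) A = 0"
    using inner_transpose[of "mat 1" A] assms by simp
qed

text \<open>The relative velocity is Q A + (Q - P) w. The second term is orthogonal to Q - P because
  w is skew, and Q A is orthogonal to Q because A is skew; only the pairing of Q A with P
  survives.\<close>

lemma inner_error_derivative:
  assumes PQ: "(P, Q) \<in> state_space" and A: "transpose A = - A" and w: "w \<in> so3"
  shows "inner (Q - P) (Q ** (A + w) - P ** w) = - inner (transpose Q ** P) A"
proof -
  have Q: "Q \<in> SO3" using PQ by (auto simp: state_space_def)
  have "Q ** (A + w) - P ** w = Q ** A + (Q - P) ** w" by (simp add: matmul_simps)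
  then have "inner (Q - P) (Q ** (A + w) - P ** w) = inner (Q ** A) (Q - P) + inner ((Q - P) ** w) (Q - P)"
    by (simp add: inner_add_right inner_commute)
  also have "inner ((Q - P) ** w) (Q - P) = 0"
    using inner_skew(1)[OF so3_transpose[OF w]] .
  also have "inner (Q ** A) (Q - P) = inner (Q ** A) (Q ** mat 1) - inner A (transpose Q ** P)"
    by (simp add: inner_diff_right inner_matmul_left)
  also have "inner (Q ** A) (Q ** mat 1) = 0"
    unfolding inner_SO3_left[OF Q] using inner_skew(2)[OF A] by (simp add: inner_commute)
  finally show ?thesis by (simp add: inner_commute)
qed

lemma trace_error:
  assumes "(P, Q) \<in> state_space"
  shows "3 - trace (transpose Q ** P) = (norm (Q - P))\<^sup>2 / 2"
    and "1 + trace (transpose Q ** P) = 4 - (norm (Q - P))\<^sup>2 / 2"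
proof -
  have "(norm (Q - P))\<^sup>2 = 2 * (3 - trace (transpose Q ** P))"
    using assms norm_SO3_diff[of P Q] by (simp add: state_space_iff norm_minus_commute)
  then show "3 - trace (transpose Q ** P) = (norm (Q - P))\<^sup>2 / 2"
    "1 + trace (transpose Q ** P) = 4 - (norm (Q - P))\<^sup>2 / 2" by (simp_all add: field_simps)
qed

lemma rhs_a_derivative:
  assumes v: "v \<in> rhs_a \<omega> (P, Q) t" and PQ: "(P, Q) \<in> state_space" and w: "\<omega> t \<in> so3"
  shows "norm v \<le> 6 + norm (\<omega> t)"
    and "inner (Q - P) (v - P ** \<omega> t) \<le> - sqrt (4 - (norm (Q - P))\<^sup>2 / 2) * ((norm (Q - P))\<^sup>2 / 2)"
proof -
  define E where "E = transpose Q ** P"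
  note E = state_space_error(1,2)[OF PQ, folded E_def]
  have Q: "Q \<in> SO3" using PQ by (auto simp: state_space_def)
  have v: "v = Q ** (rot_log E + \<omega> t)"
    using v state_space_error(4)[OF PQ] by (simp add: rhs_a_def \<omega>_a_def E_def)
  \<comment> \<open>With pi < 4 this gives the bound 6 on the norm of the logarithm.\<close>
  have "sqrt 2 \<le> 3 / 2" by (rule real_le_lsqrt) (simp_all add: power2_eq_square)
  then have "sqrt 2 * rot_angle E \<le> 3 / 2 * 4"
    using rot_angle_bounds[OF E(1)] pi_less_4 by (intro mult_mono) auto
  then have "norm (rot_log E) \<le> 6" using norm_rot_log[OF E] by simp
  then show "norm v \<le> 6 + norm (\<omega> t)"
    unfolding v norm_SO3_left[OF Q] by (intro norm_triangle_mono) auto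
  have "transpose (rot_log E) = - rot_log E"
    unfolding rot_log_nonsingular[OF E] transpose_linear_simps transpose_transpose
    by (simp flip: scaleR_minus_right)
  then have "inner (Q - P) (v - P ** \<omega> t) = - inner E (rot_log E)"
    unfolding v E_def by (rule inner_error_derivative[OF PQ _ w])
  also have "\<dots> \<le> - (sqrt (1 + trace E) * (3 - trace E))"
    using inner_rot_log_ge[OF E] by simp
  finally show "inner (Q - P) (v - P ** \<omega> t) \<le> - sqrt (4 - (norm (Q - P))\<^sup>2 / 2) * ((norm (Q - P))\<^sup>2 / 2)"
    unfolding E_def trace_error[OF PQ] by simp
qed

lemma rhs_f_derivative:
  assumes v: "v \<in> rhs_f \<omega> (P, Q) t" and PQ: "(P, Q) \<in> state_space" and w: "\<omega> t \<in> so3"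
  shows "inner (Q - P) (v - P ** \<omega> t) \<le> - norm (Q - P) * sqrt (4 - (norm (Q - P))\<^sup>2 / 2) / 2"
proof (cases "P = Q")
  case True
  then show ?thesis by simp
next
  case False
  define E where "E = transpose Q ** P"
  note E = state_space_error(1,2)[OF PQ, folded E_def] state_space_error(3)[OF PQ False, folded E_def]
  note n = skew_part_nonzero[OF E]
  have v: "v = Q ** (unit_skew_part E + \<omega> t)"
    using v unfolding rhs_f_off_diagonal[OF PQ False] \<omega>_f_off_diagonal[OF PQ False] E_def by simp
  have "transpose (unit_skew_part E) = - unit_skew_part E"
    unfolding unit_skew_part_def transpose_linear_simps transpose_transpose
    by (simp flip: scaleR_minus_right)
  then have "inner (Q - P) (v - P ** \<omega> t) = - inner E (unit_skew_part E)"
    unfolding v E_def by (rule inner_error_derivative[OF PQ _ w])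
  also have "\<dots> = - norm (E - transpose E) / 2"
    unfolding unit_skew_part_def inner_scaleR_right inner_skew_part[OF E(1)]
    using n by (simp add: power2_eq_square)
  \<comment> \<open>The double-angle formula sin \<theta> = 2 sin (\<theta>/2) cos (\<theta>/2) in
    terms of the error norm, which is 2 sqrt 2 sin (\<theta>/2).\<close>
  also have "norm (E - transpose E) = norm (Q - P) * sqrt (4 - (norm (Q - P))\<^sup>2 / 2)"
  proof -
    have "(norm (E - transpose E))\<^sup>2 = (norm (Q - P))\<^sup>2 * (4 - (norm (Q - P))\<^sup>2 / 2)"
      unfolding norm_SO3_skew_part[OF E(1)] unfolding E_def trace_error[OF PQ] by simp
    then show ?thesis
      by (metis norm_ge_zero real_sqrt_abs abs_norm_cancel real_sqrt_mult)
  qed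
  finally show ?thesis by simp
qed

lemma dissipative_closed_loop: "F \<in> {rhs_a \<omega>, rhs_f \<omega>} \<Longrightarrow> dissipative \<omega> F"
proof -
  have root: "sqrt (4 - (norm (Q - P))\<^sup>2 / 2) \<ge> 0" if "(P, Q) \<in> state_space" for P Q
    using that by (simp add: state_space_iff)
  have "dissipative \<omega> (rhs_a \<omega>)"
    unfolding dissipative_def
  proof (intro allI ballI impI)
    fix P Q t v assume *: "v \<in> rhs_a \<omega> (P, Q) t" "(P, Q) \<in> state_space" "\<omega> t \<in> so3"
    have "sqrt (4 - (norm (Q - P))\<^sup>2 / 2) * ((norm (Q - P))\<^sup>2 / 2) \<ge> 0"
      using root[OF *(2)] by (intro mult_nonneg_nonneg) auto
    then show "norm v \<le> 6 + norm (\<omega> t) \<and> inner (Q - P) (v - P ** \<omega> t) \<le> 0"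
      using rhs_a_derivative[OF *] by simp
  qed
  moreover have "dissipative \<omega> (rhs_f \<omega>)"
    unfolding dissipative_def
  proof (intro allI ballI impI)
    fix P Q t v assume *: "v \<in> rhs_f \<omega> (P, Q) t" "(P, Q) \<in> state_space" "\<omega> t \<in> so3"
    have "norm (Q - P) * sqrt (4 - (norm (Q - P))\<^sup>2 / 2) \<ge> 0"
      using root[OF *(2)] by (intro mult_nonneg_nonneg) auto
    then show "norm v \<le> 6 + norm (\<omega> t) \<and> inner (Q - P) (v - P ** \<omega> t) \<le> 0"
      using rhs_f_derivative[OF *] rhs_f_bounded[OF *(1)] by simp
  qed
  ultimately show "F \<in> {rhs_a \<omega>, rhs_f \<omega>} \<Longrightarrow> dissipative \<omega> F" by blast
qed

lemma closed_loop_solution_iff: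
  "closed_loop_solution \<omega> F J R\<^sub>r R\<^sub>1 \<longleftrightarrow>
     is_interval J \<and> 0 \<in> J \<and> J \<subseteq> {0..} \<and>
     (\<forall>t\<in>J. (R\<^sub>r t, R\<^sub>1 t) \<in> state_space) \<and>
     (\<forall>a b. {a..b} \<subseteq> J \<longrightarrow>
        absolutely_continuous_on {a..b} R\<^sub>r \<and> absolutely_continuous_on {a..b} R\<^sub>1) \<and>
     (\<exists>N. negligible N \<and> (\<forall>t\<in>J - N.
        (R\<^sub>r has_vector_derivative (R\<^sub>r t ** \<omega> t)) (at t within J) \<and>
        (\<exists>v\<in>F (R\<^sub>r t, R\<^sub>1 t) t. (R\<^sub>1 has_vector_derivative v) (at t within J))))"
proof (cases "is_interval J")
  case True
  then have J: "J \<in> sets lebesgue" by (simp add: real_interval_borel_measurable)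
  show ?thesis
    unfolding closed_loop_solution_def AE_lebesgue_on_iff_negligible[OF J] ..
qed (simp add: closed_loop_solution_def)

section \<open>A priori estimates along a given solution\<close>

locale closed_loop =
  fixes \<omega> :: "real \<Rightarrow> mat3" and F J R\<^sub>r R\<^sub>1
  assumes so3: "\<And>t. t \<ge> 0 \<Longrightarrow> \<omega> t \<in> so3"
    and bd: "\<And>T. \<exists>B. AE t in lebesgue_on {0..T}. norm (\<omega> t) \<le> B"
    and dissipative: "dissipative \<omega> F"
    and sol: "closed_loop_solution \<omega> F J R\<^sub>r R\<^sub>1"
begin

lemma zero_in: "0 \<in> J" and sub: "J \<subseteq> {0..}" and interval: "is_interval J"
  and state: "t \<in> J \<Longrightarrow> (R\<^sub>r t, R\<^sub>1 t) \<in> state_space"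
  and ac: "{a..b} \<subseteq> J \<Longrightarrow> absolutely_continuous_on {a..b} R\<^sub>r"
    "{a..b} \<subseteq> J \<Longrightarrow> absolutely_continuous_on {a..b} R\<^sub>1"
  using sol by (simp_all add: closed_loop_solution_def)

lemma subinterval: "s \<in> J \<Longrightarrow> t \<in> J \<Longrightarrow> {s..t} \<subseteq> J"
  using interval unfolding is_interval_1 by (meson atLeastAtMost_iff subsetI)

lemma derivatives_ae:
  obtains N where "negligible N"
    "\<forall>t\<in>J - N. (R\<^sub>r has_vector_derivative (R\<^sub>r t ** \<omega> t)) (at t within J) \<and>
        (\<exists>v\<in>F (R\<^sub>r t, R\<^sub>1 t) t. (R\<^sub>1 has_vector_derivative v) (at t within J))"
  using sol unfolding closed_loop_solution_iff by (elim exE conjE) (rule that)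

definition V :: "real \<Rightarrow> real" where "V t = (norm (R\<^sub>1 t - R\<^sub>r t))\<^sup>2"

lemma V_bounds: "t \<in> J \<Longrightarrow> 0 \<le> V t \<and> V t < 8"
  using state[of t] unfolding V_def state_space_iff by simp

lemma ac_error: "{a..b} \<subseteq> J \<Longrightarrow> absolutely_continuous_on {a..b} (\<lambda>t. R\<^sub>1 t - R\<^sub>r t)"
proof (rule absolutely_continuous_on_dominated2[OF ac(2) ac(1), where L = 1 and M = 1])
  fix x y
  have "(R\<^sub>1 x - R\<^sub>r x) - (R\<^sub>1 y - R\<^sub>r y) = (R\<^sub>1 x - R\<^sub>1 y) - (R\<^sub>r x - R\<^sub>r y)" by simp
  then show "dist (R\<^sub>1 x - R\<^sub>r x) (R\<^sub>1 y - R\<^sub>r y) \<le> 1 * dist (R\<^sub>1 x) (R\<^sub>1 y) + 1 * dist (R\<^sub>r x) (R\<^sub>r y)"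
    unfolding dist_norm by (metis mult_1 norm_triangle_ineq4)
qed

lemma ac_norm_error: "{a..b} \<subseteq> J \<Longrightarrow> absolutely_continuous_on {a..b} (\<lambda>t. norm (R\<^sub>1 t - R\<^sub>r t))"
  by (rule absolutely_continuous_on_dominated[OF ac_error, where L = 1])
     (auto simp: dist_norm norm_triangle_ineq3)

lemma ac_V: "{a..b} \<subseteq> J \<Longrightarrow> absolutely_continuous_on {a..b} V"
proof (rule absolutely_continuous_on_dominated[OF ac_norm_error, where L = 6])
  fix x y assume J: "{a..b} \<subseteq> J" and xy: "x \<in> {a..b}" "y \<in> {a..b}"
  define p q where "p = norm (R\<^sub>1 x - R\<^sub>r x)" "q = norm (R\<^sub>1 y - R\<^sub>r y)"
  \<comment> \<open>V < 8 < 9 bounds the error norm by 3, so squaring multiplies increments by at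
    most 6.\<close>
  have "p\<^sup>2 < 3\<^sup>2" "q\<^sup>2 < 3\<^sup>2" using V_bounds[of x] V_bounds[of y] J xy unfolding V_def p_q_def by auto
  then have "p < 3" "q < 3" by (auto intro: power2_less_imp_less)
  moreover have "0 \<le> p" "0 \<le> q" by (auto simp: p_q_def)
  ultimately have "\<bar>p + q\<bar> * \<bar>p - q\<bar> \<le> 6 * \<bar>p - q\<bar>" by (intro mult_right_mono) auto
  moreover have "p\<^sup>2 - q\<^sup>2 = (p + q) * (p - q)" by (simp add: power2_eq_square algebra_simps)
  ultimately show "dist (V x) (V y) \<le> 6 * dist (norm (R\<^sub>1 x - R\<^sub>r x)) (norm (R\<^sub>1 y - R\<^sub>r y))"
    unfolding V_def p_q_def[symmetric] dist_real_def by (simp add: abs_mult)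
qed

lemma V_derivative:
  assumes "(R\<^sub>r has_vector_derivative (R\<^sub>r t ** \<omega> t)) (at t within S)" "(R\<^sub>1 has_vector_derivative v) (at t within S)"
  shows "(V has_real_derivative 2 * inner (R\<^sub>1 t - R\<^sub>r t) (v - R\<^sub>r t ** \<omega> t)) (at t within S)"
proof -
  have "((\<lambda>t. R\<^sub>1 t - R\<^sub>r t) has_derivative (\<lambda>h. h *\<^sub>R (v - R\<^sub>r t ** \<omega> t))) (at t within S)"
    using has_vector_derivative_diff[OF assms(2,1)] by (simp add: has_vector_derivative_def)
  from has_derivative_inner[OF this this] show ?thesis
    unfolding V_def power2_norm_eq_inner has_field_derivative_def
    by (rule has_derivative_eq_rhs) (simp add: fun_eq_iff inner_commute)
qed

lemma V_decreasing:
  assumes "s \<in> J" "t \<in> J" "s \<le> t"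
  shows "V t \<le> V s"
proof -
  note J = subinterval[OF assms(1,2)]
  obtain N where N: "negligible N" and der:
    "\<forall>t\<in>J - N. (R\<^sub>r has_vector_derivative (R\<^sub>r t ** \<omega> t)) (at t within J) \<and>
        (\<exists>v\<in>F (R\<^sub>r t, R\<^sub>1 t) t. (R\<^sub>1 has_vector_derivative v) (at t within J))"
    by (rule derivatives_ae)
  have "V t - V s \<le> 0 * (t - s)"
  proof (rule absolutely_continuous_on_increment_le[OF ac_V[OF J] \<open>s \<le> t\<close> N])
    fix x assume "x \<in> {s..t} - N"
    then have x: "x \<in> J - N" using J by blast
    then obtain v where v: "v \<in> F (R\<^sub>r x, R\<^sub>1 x) x" "(R\<^sub>1 has_vector_derivative v) (at x within J)"
      using der by blast
    have "(V has_real_derivative 2 * inner (R\<^sub>1 x - R\<^sub>r x) (v - R\<^sub>r x ** \<omega> x)) (at x within J)"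
      using der x v by (intro V_derivative) auto
    then have "(V has_vector_derivative 2 * inner (R\<^sub>1 x - R\<^sub>r x) (v - R\<^sub>r x ** \<omega> x)) (at x within {s..t})"
      using has_vector_derivative_within_subset[OF _ J] by (simp add: has_real_derivative_iff_has_vector_derivative)
    moreover have "inner (R\<^sub>1 x - R\<^sub>r x) (v - R\<^sub>r x ** \<omega> x) \<le> 0"
      using dissipative v(1) state[of x] so3[of x] sub x unfolding dissipative_def by blast
    ultimately show "\<exists>D\<le>0. (V has_vector_derivative D) (at x within {s..t})"
      by (intro exI conjI) auto
  qed
  then show ?thesis by simp
qed

lemma V_le_initial: "t \<in> J \<Longrightarrow> V t \<le> V 0"
  using V_decreasing[OF zero_in] sub by auto

section \<open>Continuation of solutions to all times\<close>

lemma lipschitz_bounded: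
  assumes "J \<subseteq> {0..b}"
  shows "\<exists>L. L-lipschitz_on J R\<^sub>r \<and> L-lipschitz_on J R\<^sub>1"
proof -
  obtain N where N: "negligible N" and der:
    "\<forall>t\<in>J - N. (R\<^sub>r has_vector_derivative (R\<^sub>r t ** \<omega> t)) (at t within J) \<and>
        (\<exists>v\<in>F (R\<^sub>r t, R\<^sub>1 t) t. (R\<^sub>1 has_vector_derivative v) (at t within J))"
    by (rule derivatives_ae)
  obtain B where "AE t in lebesgue_on {0..b}. norm (\<omega> t) \<le> B" using bd[of b] ..
  then have "\<exists>N. negligible N \<and> (\<forall>t\<in>{0..b} - N. norm (\<omega> t) \<le> B)"
    by (subst (asm) AE_lebesgue_on_iff_negligible) auto
  then obtain N' where N': "negligible N' \<and> (\<forall>t\<in>{0..b} - N'. norm (\<omega> t) \<le> B)" ..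
  define M where "M = 6 + \<bar>B\<bar>"
  have NN: "negligible (N \<union> N')" using N N' by simp
  have R\<^sub>r: "dist (R\<^sub>r s) (R\<^sub>r t) \<le> M * dist s t" if "s \<in> J" "t \<in> J" "s \<le> t" for s t
  proof -
    note J = subinterval[OF that(1,2)]
    have "norm (R\<^sub>r t - R\<^sub>r s) \<le> M * (t - s)"
    proof (rule absolutely_continuous_on_norm_le[OF ac(1)[OF J] that(3) NN])
      fix x assume x: "x \<in> {s..t} - (N \<union> N')"
      then have xJ: "x \<in> J" using J by blast
      have "norm (R\<^sub>r x ** \<omega> x) = norm (\<omega> x)"
        using state[OF xJ] by (simp add: state_space_iff norm_SO3_left)
      also have "\<dots> \<le> M" using N' x xJ assms by (force simp: M_def)
      finally show "\<exists>D. (R\<^sub>r has_vector_derivative D) (at x within {s..t}) \<and> norm D \<le> M"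
        using der x xJ has_vector_derivative_within_subset[OF _ J] by blast
    qed (simp add: M_def)
    then show ?thesis using that by (simp add: dist_norm norm_minus_commute)
  qed
  have R\<^sub>1: "dist (R\<^sub>1 s) (R\<^sub>1 t) \<le> M * dist s t" if "s \<in> J" "t \<in> J" "s \<le> t" for s t
  proof -
    note J = subinterval[OF that(1,2)]
    have "norm (R\<^sub>1 t - R\<^sub>1 s) \<le> M * (t - s)"
    proof (rule absolutely_continuous_on_norm_le[OF ac(2)[OF J] that(3) NN])
      fix x assume x: "x \<in> {s..t} - (N \<union> N')"
      then have xJ: "x \<in> J" using J by blast
      then obtain v where v: "v \<in> F (R\<^sub>r x, R\<^sub>1 x) x" "(R\<^sub>1 has_vector_derivative v) (at x within J)"
        using der x by blast
      have "norm v \<le> 6 + norm (\<omega> x)"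
        using dissipative v(1) state[OF xJ] so3[of x] sub xJ unfolding dissipative_def by blast
      also have "\<dots> \<le> M" using N' x xJ assms by (force simp: M_def)
      finally show "\<exists>D. (R\<^sub>1 has_vector_derivative D) (at x within {s..t}) \<and> norm D \<le> M"
        using v(2) has_vector_derivative_within_subset[OF _ J] by blast
    qed (simp add: M_def)
    then show ?thesis using that by (simp add: dist_norm norm_minus_commute)
  qed
  have "M-lipschitz_on J R\<^sub>r"
  proof (rule lipschitz_onI)
    show "dist (R\<^sub>r s) (R\<^sub>r t) \<le> M * dist s t" if "s \<in> J" "t \<in> J" for s t
      using R\<^sub>r[of s t] R\<^sub>r[of t s] that by (cases "s \<le> t") (auto simp: dist_commute)
  qed (simp add: M_def)
  moreover have "M-lipschitz_on J R\<^sub>1"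
  proof (rule lipschitz_onI)
    show "dist (R\<^sub>1 s) (R\<^sub>1 t) \<le> M * dist s t" if "s \<in> J" "t \<in> J" for s t
      using R\<^sub>1[of s t] R\<^sub>1[of t s] that by (cases "s \<le> t") (auto simp: dist_commute)
  qed (simp add: M_def)
  ultimately show ?thesis by blast
qed

text \<open>The endpoint b need not belong to J. The open condition V < 8 alone could be lost in the
  limit; the closed condition V \<le> V(0) persists, and V(0) < 8.\<close>

lemma extension_to_endpoint:
  assumes "J \<subseteq> {0..b}" "b \<in> closure J"
  obtains g\<^sub>r g\<^sub>1 L where "L-lipschitz_on (closure J) g\<^sub>r" "L-lipschitz_on (closure J) g\<^sub>1"
    "\<forall>t\<in>J. g\<^sub>r t = R\<^sub>r t \<and> g\<^sub>1 t = R\<^sub>1 t" "(g\<^sub>r b, g\<^sub>1 b) \<in> state_space"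
proof -
  obtain L where L: "L-lipschitz_on J R\<^sub>r" "L-lipschitz_on J R\<^sub>1"
    using lipschitz_bounded[OF assms(1)] by blast
  obtain g\<^sub>r where g\<^sub>r: "L-lipschitz_on (closure J) g\<^sub>r" "\<forall>x\<in>J. g\<^sub>r x = R\<^sub>r x"
    using lipschitz_extend_closure[OF L(1)] by blast
  obtain g\<^sub>1 where g\<^sub>1: "L-lipschitz_on (closure J) g\<^sub>1" "\<forall>x\<in>J. g\<^sub>1 x = R\<^sub>1 x"
    using lipschitz_extend_closure[OF L(2)] by blast
  have cont: "continuous_on (closure J) g\<^sub>r" "continuous_on (closure J) g\<^sub>1"
    using g\<^sub>r(1) g\<^sub>1(1) lipschitz_on_continuous_on by blast+
  have "g\<^sub>r ` closure J \<subseteq> SO3"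
    using state g\<^sub>r(2) by (intro image_closure_subset[OF cont(1) closed_SO3]) (auto simp: state_space_iff)
  moreover have "g\<^sub>1 ` closure J \<subseteq> SO3"
    using state g\<^sub>1(2) by (intro image_closure_subset[OF cont(2) closed_SO3]) (auto simp: state_space_iff)
  moreover have "(\<lambda>t. (norm (g\<^sub>1 t - g\<^sub>r t))\<^sup>2) ` closure J \<subseteq> {..V 0}"
  proof (rule image_closure_subset)
    show "continuous_on (closure J) (\<lambda>t. (norm (g\<^sub>1 t - g\<^sub>r t))\<^sup>2)"
      by (intro continuous_intros cont)
    show "(\<lambda>t. (norm (g\<^sub>1 t - g\<^sub>r t))\<^sup>2) ` J \<subseteq> {..V 0}"
      using V_le_initial g\<^sub>r(2) g\<^sub>1(2) by (auto simp: V_def)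
  qed simp
  ultimately have "(g\<^sub>r b, g\<^sub>1 b) \<in> state_space"
    using assms(2) V_bounds[OF zero_in] by (force simp: state_space_iff)
  then show ?thesis using that[of L g\<^sub>r g\<^sub>1] g\<^sub>r g\<^sub>1 by simp
qed

text \<open>Formulated with the closure of J and the extensions of the curves, so that J may contain
  its endpoint b or not.\<close>

lemma glue_local_solution:
  assumes J: "J \<subseteq> {0..b}" "{0..<b} \<subseteq> J" "b \<in> closure J" "0 \<le> b"
    and g: "L-lipschitz_on (closure J) g\<^sub>r" "L-lipschitz_on (closure J) g\<^sub>1"
    and gJ: "\<forall>t\<in>J. g\<^sub>r t = R\<^sub>r t \<and> g\<^sub>1 t = R\<^sub>1 t" and gb: "(g\<^sub>r b, g\<^sub>1 b) \<in> state_space"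
    and S: "local_solution \<omega> F b h S\<^sub>r S\<^sub>1" "S\<^sub>r b = g\<^sub>r b" "S\<^sub>1 b = g\<^sub>1 b" and "0 < h"
  shows "closed_loop_solution \<omega> F {0..b + h}
    (\<lambda>t. if t \<le> b then g\<^sub>r t else S\<^sub>r t) (\<lambda>t. if t \<le> b then g\<^sub>1 t else S\<^sub>1 t)"
proof -
  let ?r = "\<lambda>t. if t \<le> b then g\<^sub>r t else S\<^sub>r t" and ?l = "\<lambda>t. if t \<le> b then g\<^sub>1 t else S\<^sub>1 t"
  have cl: "{0..b} \<subseteq> closure J"
  proof
    fix t assume "t \<in> {0..b}"
    then show "t \<in> closure J" using J(2,3) closure_subset[of J] by (cases "t = b") force+
  qed
  have concat: "absolutely_continuous_on T (\<lambda>t. if t \<le> b then f t else k t)"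
    if f: "L-lipschitz_on (closure J) f" and k: "\<exists>L. \<forall>s\<in>{b..b + h}. \<forall>t\<in>{b..b + h}. dist (k s) (k t) \<le> L * \<bar>s - t\<bar>"
      and eq: "k b = f b" and T: "T \<subseteq> {0..b + h}" for f k :: "real \<Rightarrow> mat3" and T
  proof -
    obtain L' where L': "\<forall>s\<in>{b..b + h}. \<forall>t\<in>{b..b + h}. dist (k s) (k t) \<le> L' * \<bar>s - t\<bar>"
      using k ..
    define M where "M = \<bar>L\<bar> + \<bar>L'\<bar>"
    have "M-lipschitz_on {0..b} f"
      by (rule lipschitz_on_mono[OF f cl]) (simp add: M_def)
    moreover have "M-lipschitz_on {b..b + h} k"
    proof (rule lipschitz_onI)
      fix s t assume st: "s \<in> {b..b + h}" "t \<in> {b..b + h}"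
      have "dist (k s) (k t) \<le> L' * \<bar>s - t\<bar>" using L' st by blast
      also have "\<dots> \<le> M * \<bar>s - t\<bar>" by (intro mult_right_mono) (auto simp: M_def)
      finally show "dist (k s) (k t) \<le> M * dist s t" by (simp add: dist_real_def)
    qed (simp add: M_def)
    ultimately have lip: "M-lipschitz_on {0..b + h} (\<lambda>t. if t \<le> b then f t else k t)"
      using eq by (intro lipschitz_on_concat) auto
    show ?thesis
      by (rule lipschitz_imp_absolutely_continuous_on)
        (rule lipschitz_onD[OF lip, unfolded dist_real_def], use T in auto)
  qed
  obtain N where N: "negligible N" and der:
    "\<forall>t\<in>J - N. (R\<^sub>r has_vector_derivative (R\<^sub>r t ** \<omega> t)) (at t within J) \<and>
        (\<exists>v\<in>F (R\<^sub>r t, R\<^sub>1 t) t. (R\<^sub>1 has_vector_derivative v) (at t within J))"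
    by (rule derivatives_ae)
  obtain N' where N': "negligible N'" and der': "\<forall>t\<in>{b..b + h} - N'.
        (S\<^sub>r has_vector_derivative S\<^sub>r t ** \<omega> t) (at t within {b..b + h}) \<and>
        (\<exists>v\<in>F (S\<^sub>r t, S\<^sub>1 t) t. (S\<^sub>1 has_vector_derivative v) (at t within {b..b + h}))"
    using S(1) unfolding local_solution_def by (elim exE conjE) (rule that)
  have state_S: "\<forall>t\<in>{b..b + h}. (S\<^sub>r t, S\<^sub>1 t) \<in> state_space"
    using S(1) unfolding local_solution_def by (elim conjE)
  have left: "(f' has_vector_derivative D) (at t within {0..b + h})"
    if "(f has_vector_derivative D) (at t within J)" "t \<in> J" "t < b" "\<And>s. s \<in> J \<Longrightarrow> s < b \<Longrightarrow> f s = f' s"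
    for f f' :: "real \<Rightarrow> mat3" and D t
  proof (rule has_vector_derivative_agree_on_open[OF open_lessThan[of b] _ that(2) _ _ that(1)])
    show "{..<b} \<inter> J = {..<b} \<inter> {0..b + h}" using J \<open>0 < h\<close> by auto
  qed (use that in auto)
  have right: "(f' has_vector_derivative D) (at t within {0..b + h})"
    if "(f has_vector_derivative D) (at t within {b..b + h})" "t \<in> {b..b + h}" "b < t" "\<And>s. b < s \<Longrightarrow> f s = f' s"
    for f f' :: "real \<Rightarrow> mat3" and D t
  proof (rule has_vector_derivative_agree_on_open[OF open_greaterThan[of b] _ that(2) _ _ that(1)])
    show "{b<..} \<inter> {b..b + h} = {b<..} \<inter> {0..b + h}" using \<open>0 \<le> b\<close> by auto
  qed (use that in auto)
  show ?thesis
    unfolding closed_loop_solution_iff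
  \<comment> \<open>The junction b is exceptional: the one-sided derivatives of the two pieces may
    differ there.\<close>
  proof (intro conjI allI impI ballI exI[of _ "insert b (N \<union> N')"])
    show "(?r t, ?l t) \<in> state_space" if "t \<in> {0..b + h}" for t
    proof -
      consider "t < b" | "t = b" | "t > b" by linarith
      then show ?thesis
      proof cases
        case 1
        then have "t \<in> J" using J(2) that by auto
        then show ?thesis using 1 gJ state by simp
      qed (use gb state_S that in auto)
    qed
    have k: "\<exists>L. \<forall>s\<in>{b..b + h}. \<forall>t\<in>{b..b + h}. dist (S\<^sub>r s) (S\<^sub>r t) \<le> L * \<bar>s - t\<bar>"
      "\<exists>L. \<forall>s\<in>{b..b + h}. \<forall>t\<in>{b..b + h}. dist (S\<^sub>1 s) (S\<^sub>1 t) \<le> L * \<bar>s - t\<bar>"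
      using S(1) unfolding local_solution_def by blast+
    fix u v assume uv: "{u..v} \<subseteq> {0..b + h}"
    show "absolutely_continuous_on {u..v} ?r" by (rule concat[OF g(1) k(1) S(2) uv])
    show "absolutely_continuous_on {u..v} ?l" by (rule concat[OF g(2) k(2) S(3) uv])
  next
    fix t assume t: "t \<in> {0..b + h} - insert b (N \<union> N')"
    show "(?r has_vector_derivative ?r t ** \<omega> t) (at t within {0..b + h})"
    proof (cases "t < b")
      case True
      then have tJ: "t \<in> J - N" using J(2) t by auto
      then have "(R\<^sub>r has_vector_derivative R\<^sub>r t ** \<omega> t) (at t within J)" using der by blast
      then have "(?r has_vector_derivative R\<^sub>r t ** \<omega> t) (at t within {0..b + h})"
        using True tJ gJ by (intro left) auto
      then show ?thesis using True tJ gJ by simp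
    next
      case False
      then have tS: "t \<in> {b..b + h} - N'" "b < t" using t by auto
      then have "(S\<^sub>r has_vector_derivative S\<^sub>r t ** \<omega> t) (at t within {b..b + h})" using der' by blast
      then have "(?r has_vector_derivative S\<^sub>r t ** \<omega> t) (at t within {0..b + h})"
        using tS by (intro right) auto
      then show ?thesis using tS by simp
    qed
    show "\<exists>v\<in>F (?r t, ?l t) t. (?l has_vector_derivative v) (at t within {0..b + h})"
    proof (cases "t < b")
      case True
      then have tJ: "t \<in> J - N" using J(2) t by auto
      then obtain v where v: "v \<in> F (R\<^sub>r t, R\<^sub>1 t) t" "(R\<^sub>1 has_vector_derivative v) (at t within J)"
        using der by blast
      then have "(?l has_vector_derivative v) (at t within {0..b + h})"
        using True tJ gJ by (intro left) auto
      then show ?thesis using True tJ gJ v(1) by (intro bexI[of _ v]) auto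
    next
      case False
      then have tS: "t \<in> {b..b + h} - N'" "b < t" using t by auto
      then obtain v where v: "v \<in> F (S\<^sub>r t, S\<^sub>1 t) t" "(S\<^sub>1 has_vector_derivative v) (at t within {b..b + h})"
        using der' by blast
      then have "(?l has_vector_derivative v) (at t within {0..b + h})"
        using tS by (intro right) auto
      then show ?thesis using tS v(1) by (intro bexI[of _ v]) auto
    qed
  qed (use N N' J(4) \<open>0 < h\<close> in auto)
qed

text \<open>If J omits a time u, it is bounded by u. The solution then has a nonsingular limit at
  Sup J and continues from it, which contradicts maximality.\<close>

lemma maximal_imp_global:
  assumes max: "maximal_solution \<omega> F J R\<^sub>r R\<^sub>1" and F: "F \<in> {rhs_a \<omega>, rhs_f \<omega>}"
    and meas: "\<omega> \<in> borel_measurable (lebesgue_on {0..})"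
  shows "J = {0..}"
proof (rule ccontr)
  assume "J \<noteq> {0..}"
  then obtain u where u: "u \<ge> 0" "u \<notin> J" using sub by auto
  have below_u: "t \<le> u" if "t \<in> J" for t
    using subinterval[OF zero_in that] u by (meson atLeastAtMost_iff in_mono linear)
  define b where "b = Sup J"
  have bdd: "bdd_above J" using below_u by (rule bdd_aboveI)
  have le_b: "t \<le> b" if "t \<in> J" for t unfolding b_def by (rule cSup_upper[OF that bdd])
  have J1: "J \<subseteq> {0..b}" using le_b sub by auto
  have J2: "{0..<b} \<subseteq> J"
  proof
    fix t assume t: "t \<in> {0..<b}"
    then obtain s where "s \<in> J" "t < s"
      using less_cSup_iff[OF _ bdd, of t] zero_in unfolding b_def by auto
    then show "t \<in> J" using subinterval[OF zero_in, of s] t by auto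
  qed
  have J3: "b \<in> closure J"
    unfolding b_def using zero_in by (intro closure_contains_Sup[OF _ bdd]) auto
  have J4: "0 \<le> b" using le_b[OF zero_in] .
  obtain g\<^sub>r g\<^sub>1 L where g: "L-lipschitz_on (closure J) g\<^sub>r" "L-lipschitz_on (closure J) g\<^sub>1"
    "\<forall>t\<in>J. g\<^sub>r t = R\<^sub>r t \<and> g\<^sub>1 t = R\<^sub>1 t" "(g\<^sub>r b, g\<^sub>1 b) \<in> state_space"
    by (rule extension_to_endpoint[OF J1 J3]) (rule that)
  obtain h S\<^sub>r S\<^sub>1 where h: "0 < h" and S: "S\<^sub>r b = g\<^sub>r b" "S\<^sub>1 b = g\<^sub>1 b" "local_solution \<omega> F b h S\<^sub>r S\<^sub>1"
    using ex_local_solution[OF so3 meas bd F g(4) J4] by auto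
  have "closed_loop_solution \<omega> F {0..b + h}
    (\<lambda>t. if t \<le> b then g\<^sub>r t else S\<^sub>r t) (\<lambda>t. if t \<le> b then g\<^sub>1 t else S\<^sub>1 t)"
    by (rule glue_local_solution[OF J1 J2 J3 J4 g S(3,1,2) h])
  moreover have "J \<subset> {0..b + h}"
  proof
    show "J \<subseteq> {0..b + h}" using J1 h by auto
    show "J \<noteq> {0..b + h}" using le_b[of "b + h"] h J4 by auto
  qed
  moreover have "\<forall>t\<in>J. (if t \<le> b then g\<^sub>r t else S\<^sub>r t) = R\<^sub>r t \<and> (if t \<le> b then g\<^sub>1 t else S\<^sub>1 t) = R\<^sub>1 t"
    using g(3) le_b by auto
  ultimately show False
    using max unfolding maximal_solution_def by blast
qed

section \<open>Decay of the error and tracking\<close>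

lemma uniform_decay_rate:
  obtains c where "c > 0" "\<forall>t\<in>J. c \<le> sqrt (4 - (norm (R\<^sub>1 t - R\<^sub>r t))\<^sup>2 / 2)"
proof (rule that[of "sqrt (4 - V 0 / 2)"])
  \<comment> \<open>The rate depends on the initial error and degenerates as V(0) approaches the
    singular value 8.\<close>
  show "0 < sqrt (4 - V 0 / 2)" using V_bounds[OF zero_in] by simp
  show "\<forall>t\<in>J. sqrt (4 - V 0 / 2) \<le> sqrt (4 - (norm (R\<^sub>1 t - R\<^sub>r t))\<^sup>2 / 2)"
    using V_le_initial unfolding V_def by auto
qed

lemma exponential_tracking:
  assumes F: "F = rhs_a \<omega>" and J: "J = {0..}"
  shows "tracks_exponentially R\<^sub>1 R\<^sub>r"
proof -
  obtain c where c: "c > 0" "\<forall>t\<in>J. c \<le> sqrt (4 - (norm (R\<^sub>1 t - R\<^sub>r t))\<^sup>2 / 2)"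
    by (rule uniform_decay_rate)
  obtain N where N: "negligible N" and der:
    "\<forall>t\<in>J - N. (R\<^sub>r has_vector_derivative (R\<^sub>r t ** \<omega> t)) (at t within J) \<and>
        (\<exists>v\<in>F (R\<^sub>r t, R\<^sub>1 t) t. (R\<^sub>1 has_vector_derivative v) (at t within J))"
    by (rule derivatives_ae)
  have decay: "exp (c * T) * V T \<le> V 0" if "T \<ge> 0" for T
  proof -
    \<comment> \<open>Integrating factor: V' \<le> -c V becomes W' \<le> 0 almost
      everywhere.\<close>
    define W where "W t = exp (c * t) * V t" for t
    have sT: "{0..T} \<subseteq> J" using J by auto
    \<comment> \<open>The tangent line inequality, which yields the Lipschitz constant of the
      integrating factor on [0, T].\<close>
    have exp_le: "exp y - exp x \<le> exp y * (y - x)" for x y :: real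
    proof -
      have "1 - exp (x - y) \<le> y - x" using exp_ge_add_one_self[of "x - y"] by linarith
      then have "exp y * (1 - exp (x - y)) \<le> exp y * (y - x)" by (intro mult_left_mono) auto
      then show ?thesis by (simp add: algebra_simps flip: exp_add)
    qed
    have acW: "absolutely_continuous_on {0..T} W"
    proof (rule absolutely_continuous_on_dominated2[OF ac_V[OF sT] absolutely_continuous_on_ident])
      fix x y assume xy: "x \<in> {0..T}" "y \<in> {0..T}"
      have bound: "exp (c * x) \<le> exp (c * T)" "exp (c * y) \<le> exp (c * T)" using xy c(1) by auto
      have lip: "\<bar>exp (c * x) - exp (c * y)\<bar> \<le> exp (c * T) * c * \<bar>x - y\<bar>"
      proof -
        have *: "exp (c * s) - exp (c * r) \<le> exp (c * T) * c * (s - r)"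
          if "r \<le> s" "s \<in> {0..T}" for r s
        proof -
          have "exp (c * s) - exp (c * r) \<le> exp (c * s) * (c * s - c * r)" by (rule exp_le)
          also have "\<dots> \<le> exp (c * T) * (c * s - c * r)"
            using that c(1) by (intro mult_right_mono) auto
          finally show ?thesis by (simp add: algebra_simps)
        qed
        show ?thesis
        proof (cases "x \<le> y")
          case True
          then have "exp (c * x) \<le> exp (c * y)" using c(1) by simp
          then show ?thesis using *[OF True xy(2)] True by simp
        next
          case False
          then have "exp (c * y) \<le> exp (c * x)" using c(1) by simp
          then show ?thesis using *[of y x] xy False by simp
        qed
      qed
      have "W x - W y = exp (c * x) * (V x - V y) + V y * (exp (c * x) - exp (c * y))"
        by (simp add: W_def algebra_simps)
      then have "\<bar>W x - W y\<bar> \<le> exp (c * x) * \<bar>V x - V y\<bar> + \<bar>V y\<bar> * \<bar>exp (c * x) - exp (c * y)\<bar>"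
        by (metis abs_exp_cancel abs_mult abs_triangle_ineq)
      also have "\<dots> \<le> exp (c * T) * \<bar>V x - V y\<bar> + 8 * (exp (c * T) * c * \<bar>x - y\<bar>)"
        using bound(1) lip V_bounds[of y] sT xy by (intro add_mono mult_mono mult_right_mono) auto
      finally show "dist (W x) (W y) \<le> exp (c * T) * dist (V x) (V y) + (8 * exp (c * T) * c) * dist x y"
        by (simp add: dist_real_def algebra_simps)
    qed
    have "W T - W 0 \<le> 0 * (T - 0)"
    proof (rule absolutely_continuous_on_increment_le[OF acW that N])
      fix x assume "x \<in> {0..T} - N"
      then have x: "x \<in> J - N" "x \<in> J" "0 \<le> x" using sT by auto
      obtain v where v: "v \<in> F (R\<^sub>r x, R\<^sub>1 x) x" "(R\<^sub>1 has_vector_derivative v) (at x within J)"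
        using der x(1) by blast
      define D where "D = inner (R\<^sub>1 x - R\<^sub>r x) (v - R\<^sub>r x ** \<omega> x)"
      have "D \<le> - sqrt (4 - (norm (R\<^sub>1 x - R\<^sub>r x))\<^sup>2 / 2) * ((norm (R\<^sub>1 x - R\<^sub>r x))\<^sup>2 / 2)"
        unfolding D_def using v(1) F by (intro rhs_a_derivative state so3 x) auto
      also have "\<dots> \<le> - c * (V x / 2)"
        unfolding V_def using c(2) x(2) by (simp add: mult_right_mono)
      finally have D: "2 * D \<le> - c * V x" by simp
      have "(V has_real_derivative 2 * D) (at x within J)"
        unfolding D_def using der x v by (intro V_derivative) auto
      then have "(V has_real_derivative 2 * D) (at x within {0..T})"
        by (rule has_field_derivative_subset[OF _ sT])
      then have "(W has_real_derivative c * exp (c * x) * V x + exp (c * x) * (2 * D)) (at x within {0..T})"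
        unfolding W_def by (auto intro!: derivative_eq_intros)
      moreover have "exp (c * x) * (2 * D) \<le> exp (c * x) * (- c * V x)"
        using D by (intro mult_left_mono) auto
      ultimately show "\<exists>D\<le>0. (W has_vector_derivative D) (at x within {0..T})"
        by (intro exI[of _ "c * exp (c * x) * V x + exp (c * x) * (2 * D)"])
           (auto simp: has_real_derivative_iff_has_vector_derivative algebra_simps)
    qed
    then show ?thesis by (simp add: W_def)
  qed
  \<comment> \<open>The square root halves the rate of V, and V(0) < 9 gives the constant 3.\<close>
  have "norm (R\<^sub>1 t - R\<^sub>r t) \<le> 3 * exp (- (c / 2) * t)" if "t \<ge> 0" for t
  proof (rule power2_le_imp_le)
    have "exp (- (c * t)) * (exp (c * t) * V t) \<le> exp (- (c * t)) * 9"
      using decay[OF that] V_bounds[OF zero_in] by (intro mult_left_mono) auto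
    then have "V t \<le> exp (- (c * t)) * 9" by (simp flip: mult.assoc exp_add)
    also have "\<dots> = (3 * exp (- (c / 2) * t))\<^sup>2"
      by (simp add: power_mult_distrib flip: exp_double)
    finally show "(norm (R\<^sub>1 t - R\<^sub>r t))\<^sup>2 \<le> (3 * exp (- (c / 2) * t))\<^sup>2" by (simp add: V_def)
  qed simp
  then show ?thesis
    unfolding tracks_exponentially_def using c(1)
    by (intro exI[of _ 3] exI[of _ "c / 2"] conjI) auto
qed

lemma finite_time_tracking:
  assumes F: "F = rhs_f \<omega>" and J: "J = {0..}"
  shows "tracks_in_finite_time R\<^sub>1 R\<^sub>r"
proof -
  obtain c where c: "c > 0" "\<forall>t\<in>J. c \<le> sqrt (4 - (norm (R\<^sub>1 t - R\<^sub>r t))\<^sup>2 / 2)"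
    by (rule uniform_decay_rate)
  obtain N where N: "negligible N" and der:
    "\<forall>t\<in>J - N. (R\<^sub>r has_vector_derivative (R\<^sub>r t ** \<omega> t)) (at t within J) \<and>
        (\<exists>v\<in>F (R\<^sub>r t, R\<^sub>1 t) t. (R\<^sub>1 has_vector_derivative v) (at t within J))"
    by (rule derivatives_ae)
  have "\<exists>T>0. R\<^sub>1 T = R\<^sub>r T"
  proof (rule ccontr)
    assume "\<nexists>T. T > 0 \<and> R\<^sub>1 T = R\<^sub>r T"
    then have ne: "R\<^sub>1 t \<noteq> R\<^sub>r t" if "t > 0" for t using that by blast
    define W where "W t = norm (R\<^sub>1 t - R\<^sub>r t)" for t
    \<comment> \<open>At rate c / 2 the time 8 / c removes 4 from W, more than W 1 < 3. The count
      starts at time 1 because the initial states may coincide, while the contradiction hypothesis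
      concerns positive times.\<close>
    define T where "T = 1 + 8 / c"
    have T: "1 \<le> T" using c(1) by (simp add: T_def)
    have sT: "{1..T} \<subseteq> J" using J by auto
    have acW: "absolutely_continuous_on {1..T} W"
      unfolding W_def by (rule ac_norm_error[OF sT])
    have "W T - W 1 \<le> (- (c / 2)) * (T - 1)"
    proof (rule absolutely_continuous_on_increment_le[OF acW T N])
      fix x assume x': "x \<in> {1..T} - N"
      then have x: "x \<in> J - N" "x \<in> J" "0 < x" using sT by auto
      obtain v where v: "v \<in> F (R\<^sub>r x, R\<^sub>1 x) x" "(R\<^sub>1 has_vector_derivative v) (at x within J)"
        using der x(1) by blast
      define D where "D = inner (R\<^sub>1 x - R\<^sub>r x) (v - R\<^sub>r x ** \<omega> x)"
      have W: "W x > 0" using ne[OF x(3)] by (simp add: W_def)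
      have "D \<le> - W x * sqrt (4 - (norm (R\<^sub>1 x - R\<^sub>r x))\<^sup>2 / 2) / 2"
        unfolding D_def W_def using v(1) F x(3) by (intro rhs_f_derivative state so3 x) auto
      also have "\<dots> \<le> - W x * c / 2"
        using c(2) x(2) W by (simp add: mult_left_mono)
      finally have D: "D / W x \<le> - (c / 2)" using W by (simp add: field_simps)
      have "(V has_real_derivative 2 * D) (at x within J)"
        unfolding D_def using der x v by (intro V_derivative) auto
      then have dV: "(V has_real_derivative 2 * D) (at x within {1..T})"
        by (rule has_field_derivative_subset[OF _ sT])
      have VW: "V t = (W t)\<^sup>2" "W t = sqrt (V t)" for t by (simp_all add: V_def W_def)
      have "((\<lambda>t. sqrt (V t)) has_real_derivative inverse (sqrt (V x)) / 2 * (2 * D)) (at x within {1..T})"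
        using W by (intro DERIV_chain2[OF DERIV_real_sqrt dV]) (simp add: VW(1))
      then have "(W has_real_derivative D / W x) (at x within {1..T})"
        unfolding VW(2)[symmetric, abs_def] VW(2)[symmetric] by (simp add: field_simps)
      then show "\<exists>D\<le>- (c / 2). (W has_vector_derivative D) (at x within {1..T})"
        using D by (auto simp: has_real_derivative_iff_has_vector_derivative)
    qed
    also have "(- (c / 2)) * (T - 1) = - 4" using c(1) by (simp add: T_def)
    finally have "W T \<le> W 1 - 4" by simp
    moreover have "W 1 < 3"
    proof -
      have "(W 1)\<^sup>2 < 3\<^sup>2" using V_bounds[of 1] J by (simp add: V_def W_def)
      then show ?thesis by (rule power2_less_imp_less) simp
    qed
    moreover have "W T \<ge> 0" by (simp add: W_def)
    ultimately show False by simp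
  qed
  then obtain T where T: "T > 0" "R\<^sub>1 T = R\<^sub>r T" by blast
  \<comment> \<open>The longer interval makes T an interior point, so the two-sided limit at T is
    the value 0.\<close>
  have "continuous_on {0..T + 1} (\<lambda>t. R\<^sub>1 t - R\<^sub>r t)"
    by (rule absolutely_continuous_on_imp_continuous_on[OF ac_error]) (use J in auto)
  then have "continuous (at T) (\<lambda>t. R\<^sub>1 t - R\<^sub>r t)"
    using T(1) by (intro continuous_on_interior) auto
  then have "((\<lambda>t. R\<^sub>1 t - R\<^sub>r t) \<longlongrightarrow> 0) (at T)"
    using T(2) by (simp add: continuous_at)
  then show ?thesis
    unfolding tracks_in_finite_time_def using T(1) by blast
qed

end

theorem theorem2:
  fixes \<omega>\<^sub>r :: "real \<Rightarrow> mat3"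
  assumes "\<And>t. t \<ge> 0 \<Longrightarrow> \<omega>\<^sub>r t \<in> so3"
    and "\<omega>\<^sub>r \<in> borel_measurable (lebesgue_on {0..})"
    and "\<And>T. \<exists>B. AE t in lebesgue_on {0..T}. norm (\<omega>\<^sub>r t) \<le> B"
  shows
    "(\<forall>F \<in> {rhs_a \<omega>\<^sub>r, rhs_f \<omega>\<^sub>r}. \<forall>J R\<^sub>r R\<^sub>1.
        nonsingular_state (R\<^sub>r 0) (R\<^sub>1 0) \<longrightarrow> maximal_solution \<omega>\<^sub>r F J R\<^sub>r R\<^sub>1 \<longrightarrow>
          J = {0..} \<and> (\<forall>t\<ge>0. nonsingular_state (R\<^sub>r t) (R\<^sub>1 t))) \<and>
     (\<forall>J R\<^sub>r R\<^sub>1.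
        nonsingular_state (R\<^sub>r 0) (R\<^sub>1 0) \<longrightarrow> maximal_solution \<omega>\<^sub>r (rhs_a \<omega>\<^sub>r) J R\<^sub>r R\<^sub>1 \<longrightarrow>
          tracks_exponentially R\<^sub>1 R\<^sub>r) \<and>
     (\<forall>J R\<^sub>r R\<^sub>1.
        nonsingular_state (R\<^sub>r 0) (R\<^sub>1 0) \<longrightarrow> maximal_solution \<omega>\<^sub>r (rhs_f \<omega>\<^sub>r) J R\<^sub>r R\<^sub>1 \<longrightarrow>
          tracks_in_finite_time R\<^sub>1 R\<^sub>r)"
proof -
  have loop: "closed_loop \<omega>\<^sub>r F J R\<^sub>r R\<^sub>1"
    if "F \<in> {rhs_a \<omega>\<^sub>r, rhs_f \<omega>\<^sub>r}" "maximal_solution \<omega>\<^sub>r F J R\<^sub>r R\<^sub>1" for F J R\<^sub>r R\<^sub>1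
    using assms(1,3) dissipative_closed_loop[OF that(1)] that(2)
    by unfold_locales (auto simp: maximal_solution_def)
  have global: "J = {0..}"
    if "F \<in> {rhs_a \<omega>\<^sub>r, rhs_f \<omega>\<^sub>r}" "maximal_solution \<omega>\<^sub>r F J R\<^sub>r R\<^sub>1" for F J R\<^sub>r R\<^sub>1
    by (rule closed_loop.maximal_imp_global[OF loop[OF that] that(2,1) assms(2)])
  show ?thesis
  proof (intro conjI ballI allI impI)
    fix F J R\<^sub>r R\<^sub>1 and t :: real
    assume *: "F \<in> {rhs_a \<omega>\<^sub>r, rhs_f \<omega>\<^sub>r}" "maximal_solution \<omega>\<^sub>r F J R\<^sub>r R\<^sub>1"
    show J: "J = {0..}" by (rule global[OF *])
    show "nonsingular_state (R\<^sub>r t) (R\<^sub>1 t)" if "0 \<le> t"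
      using closed_loop.state[OF loop[OF *], of t] that J by (simp add: state_space_def)
  next
    fix J R\<^sub>r R\<^sub>1 assume *: "maximal_solution \<omega>\<^sub>r (rhs_a \<omega>\<^sub>r) J R\<^sub>r R\<^sub>1"
    show "tracks_exponentially R\<^sub>1 R\<^sub>r"
      by (rule closed_loop.exponential_tracking[OF loop[OF _ *] refl global[OF _ *]]) auto
  next
    fix J R\<^sub>r R\<^sub>1 assume *: "maximal_solution \<omega>\<^sub>r (rhs_f \<omega>\<^sub>r) J R\<^sub>r R\<^sub>1"
    show "tracks_in_finite_time R\<^sub>1 R\<^sub>r"
      by (rule closed_loop.finite_time_tracking[OF loop[OF _ *] refl global[OF _ *]]) auto
  qed
qed

end
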